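(* The linear space isomorphism $\mathcal A\simeq\mathbb C[Q]\otimes\mathcal H$ is true, where $\mathbb C[Q]$ is the space of all polynomials in $Q$.
   Context: Fix a positive integer $n$ and a nonzero complex number $q$ that is not a root of unity. Put $[a]=(q^a-q^{-a})/(q-q^{-1})$. $\mathcal A$ is the unital associative $\mathbb C$-algebra generated by $z_1,\dots,z_n,w_1,\dots,w_n$ with relations $z_iz_j=qz_jz_i$ and $w_iw_j=q^{-1}w_jw_i$ for $i<j$; $w_jz_i=qz_iw_j$ for $i\ne j$; $w_kz_k=z_kw_k+(1-q^2)\sum_{s<k}z_sw_s$. Both the monomials $z_1^{r_1}\cdots z_n^{r_n}w_1^{s_1}\cdots w_n^{s_n}$ and the monomials $w_1^{r_1}\cdots w_n^{r_n}z_1^{s_1}\cdots z_n^{s_n}$ form bases of $\mathcal A$. Linear operators $\partial_i,\bar\partial_i$ on $\mathcal A$ are defined on these bases by $\partial_i(z_1^{r_1}\cdots z_n^{r_n}w_1^{s_1}\cdots w_n^{s_n})=q^{r_{i+1}+\cdots+r_n}[r_i]\,z_1^{r_1}\cdots z_i^{r_i-1}\cdots z_n^{r_n}w_1^{s_1}\cdots w_n^{s_n}$ and $\bar\partial_i(w_1^{r_1}\cdots w_n^{r_n}z_1^{s_1}\cdots z_n^{s_n})=q^{-(r_{i+1}+\cdots+r_n)}[r_i]\,w_1^{r_1}\cdots w_i^{r_i-1}\cdots w_n^{r_n}z_1^{s_1}\cdots z_n^{s_n}$ (both are $0$ if $r_i=0$). The $q$-Laplace operator is $\Delta_q=\sum_{i=1}^n\partial_i\bar\partial_i$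 $(=\sum_{i=1}^n q^{2(i-1)}\bar\partial_i\partial_i)$. $Q=\sum_{i=1}^n z_iw_i$, a central element of $\mathcal A$. $\mathcal H=\{p\in\mathcal A:\Delta_qp=0\}$ is the space of $q$-harmonic polynomials. *)

theory Defs
  imports Complex_Main "HOL-Library.Poly_Mapping" "HOL-Computational_Algebra.Polynomial"
begin

section \<open>Free algebras and algebras given by generators and relations\<close>

text \<open>Words form a monoid written additively, as the convolution product of
  \<^theory>\<open>HOL-Library.Poly_Mapping\<close> requires. Hence \<open>'g word \<Rightarrow>\<^sub>0 complex\<close> is the free unital
  associative complex algebra on \<open>'g\<close>, with its library ring structure.\<close>

datatype 'g word = Word (letters: "'g list")

instantiation word :: (type) monoid_add
begin

definition zero_word :: "'a word" where
  "0 = Word []"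

definition plus_word :: "'a word \<Rightarrow> 'a word \<Rightarrow> 'a word" where
  "u + v = Word (letters u @ letters v)"

instance
  by standard (simp_all add: zero_word_def plus_word_def)

end

definition free_alg :: "'g set \<Rightarrow> ('g word \<Rightarrow>\<^sub>0 complex) set" where
  "free_alg G = {p. \<forall>u\<in>Poly_Mapping.keys p. set (letters u) \<subseteq> G}"

definition free_gen :: "'g \<Rightarrow> 'g word \<Rightarrow>\<^sub>0 complex" where
  "free_gen x = Poly_Mapping.single (Word [x]) 1"

definition free_const :: "complex \<Rightarrow> 'g word \<Rightarrow>\<^sub>0 complex" where
  "free_const c = Poly_Mapping.single 0 c"

inductive_set two_sided_ideal :: "'r::ring_1 set \<Rightarrow> 'r set \<Rightarrow> 'r set"
  for F :: "'r::ring_1 set" and R :: "'r set" where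
  zero: "0 \<in> two_sided_ideal F R"
| base: "r \<in> R \<Longrightarrow> r \<in> two_sided_ideal F R"
| add: "a \<in> two_sided_ideal F R \<Longrightarrow> b \<in> two_sided_ideal F R \<Longrightarrow> a + b \<in> two_sided_ideal F R"
| mult_left: "x \<in> F \<Longrightarrow> a \<in> two_sided_ideal F R \<Longrightarrow> x * a \<in> two_sided_ideal F R"
| mult_right: "x \<in> F \<Longrightarrow> a \<in> two_sided_ideal F R \<Longrightarrow> a * x \<in> two_sided_ideal F R"

locale complex_algebra = vector_space scale
  for scale :: "complex \<Rightarrow> 'a::ring_1 \<Rightarrow> 'a" +
  assumes scale_mult_left: "scale c x * y = scale c (x * y)"
    and scale_mult_right: "x * scale c y = scale c (x * y)"

definition free_eval :: "(complex \<Rightarrow> 'a::ring_1 \<Rightarrow> 'a) \<Rightarrow> ('g \<Rightarrow> 'a) \<Rightarrow> ('g word \<Rightarrow>\<^sub>0 complex) \<Rightarrow> 'a" where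
  "free_eval scale g p =
     (\<Sum>u\<in>Poly_Mapping.keys p. scale (Poly_Mapping.lookup p u) (prod_list (map g (letters u))))"

text \<open>The algebra on the type \<open>'a\<close> is the quotient of the free algebra on \<open>G\<close> by the two-sided
  ideal generated by \<open>R\<close>, the generator \<open>x \<in> G\<close> being sent to \<open>g x\<close>. This determines the algebra
  together with its generators up to a unique isomorphism.\<close>

definition presented_by ::
  "(complex \<Rightarrow> 'a::ring_1 \<Rightarrow> 'a) \<Rightarrow> 'g set \<Rightarrow> ('g word \<Rightarrow>\<^sub>0 complex) set \<Rightarrow> ('g \<Rightarrow> 'a) \<Rightarrow> bool" where
  "presented_by scale G R g \<longleftrightarrow>
     complex_algebra scale \<and>
     free_eval scale g ` free_alg G = UNIV \<and>
     {p \<in> free_alg G. free_eval scale g p = 0} = two_sided_ideal (free_alg G) R"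


section \<open>The algebra generated by the z's and w's\<close>

datatype generator = Zgen nat | Wgen nat

definition generators :: "nat \<Rightarrow> generator set" where
  "generators n = Zgen ` {1..n} \<union> Wgen ` {1..n}"

abbreviation fZ :: "nat \<Rightarrow> generator word \<Rightarrow>\<^sub>0 complex" where
  "fZ i \<equiv> free_gen (Zgen i)"

abbreviation fW :: "nat \<Rightarrow> generator word \<Rightarrow>\<^sub>0 complex" where
  "fW i \<equiv> free_gen (Wgen i)"

definition relators :: "nat \<Rightarrow> complex \<Rightarrow> (generator word \<Rightarrow>\<^sub>0 complex) set" where
  "relators n q =
     {fZ i * fZ j - free_const q * fZ j * fZ i | i j. i \<in> {1..n} \<and> j \<in> {1..n} \<and> i < j} \<union>
     {fW i * fW j - free_const (inverse q) * fW j * fW i | i j. i \<in> {1..n} \<and> j \<in> {1..n} \<and> i < j} \<union>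
     {fW j * fZ i - free_const q * fZ i * fW j | i j. i \<in> {1..n} \<and> j \<in> {1..n} \<and> i \<noteq> j} \<union>
     {fW k * fZ k - (fZ k * fW k + free_const (1 - q^2) * (\<Sum>s\<in>{1..<k}. fZ s * fW s)) | k. k \<in> {1..n}}"

definition zw_algebra ::
  "nat \<Rightarrow> complex \<Rightarrow> (complex \<Rightarrow> 'a::ring_1 \<Rightarrow> 'a) \<Rightarrow> (nat \<Rightarrow> 'a) \<Rightarrow> (nat \<Rightarrow> 'a) \<Rightarrow> bool" where
  "zw_algebra n q scale z w \<longleftrightarrow>
     presented_by scale (generators n) (relators n q) (case_generator z w)"


section \<open>The q-Laplace operator and q-harmonic polynomials\<close>

definition qnum :: "complex \<Rightarrow> nat \<Rightarrow> complex" where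
  "qnum q a = (q ^ a - inverse q ^ a) / (q - inverse q)"

definition ordered_monomial :: "nat \<Rightarrow> (nat \<Rightarrow> 'a::monoid_mult) \<Rightarrow> (nat \<Rightarrow> nat) \<Rightarrow> 'a" where
  "ordered_monomial n x r = prod_list (map (\<lambda>i. x i ^ r i) [1..<Suc n])"

text \<open>In the two operators below the truncated \<open>r i - 1\<close> is harmless: for \<open>r i = 0\<close> the coefficient
  \<open>qnum q (r i)\<close> vanishes.\<close>

definition partial ::
  "nat \<Rightarrow> complex \<Rightarrow> (complex \<Rightarrow> 'a::ring_1 \<Rightarrow> 'a) \<Rightarrow> (nat \<Rightarrow> 'a) \<Rightarrow> (nat \<Rightarrow> 'a) \<Rightarrow> nat \<Rightarrow> 'a \<Rightarrow> 'a" where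
  "partial n q scale z w i =
     (THE D. Vector_Spaces.linear scale scale D \<and>
        (\<forall>r s. D (ordered_monomial n z r * ordered_monomial n w s) =
           scale (q ^ (\<Sum>j\<in>{i<..n}. r j) * qnum q (r i))
             (ordered_monomial n z (r(i := r i - 1)) * ordered_monomial n w s)))"

definition partial_bar ::
  "nat \<Rightarrow> complex \<Rightarrow> (complex \<Rightarrow> 'a::ring_1 \<Rightarrow> 'a) \<Rightarrow> (nat \<Rightarrow> 'a) \<Rightarrow> (nat \<Rightarrow> 'a) \<Rightarrow> nat \<Rightarrow> 'a \<Rightarrow> 'a" where
  "partial_bar n q scale z w i =
     (THE D. Vector_Spaces.linear scale scale D \<and>
        (\<forall>r s. D (ordered_monomial n w r * ordered_monomial n z s) =
           scale (inverse q ^ (\<Sum>j\<in>{i<..n}. r j) * qnum q (r i))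
             (ordered_monomial n w (r(i := r i - 1)) * ordered_monomial n z s)))"

definition q_laplace ::
  "nat \<Rightarrow> complex \<Rightarrow> (complex \<Rightarrow> 'a::ring_1 \<Rightarrow> 'a) \<Rightarrow> (nat \<Rightarrow> 'a) \<Rightarrow> (nat \<Rightarrow> 'a) \<Rightarrow> 'a \<Rightarrow> 'a" where
  "q_laplace n q scale z w p =
     (\<Sum>i\<in>{1..n}. partial n q scale z w i (partial_bar n q scale z w i p))"

definition q_harmonic ::
  "nat \<Rightarrow> complex \<Rightarrow> (complex \<Rightarrow> 'a::ring_1 \<Rightarrow> 'a) \<Rightarrow> (nat \<Rightarrow> 'a) \<Rightarrow> (nat \<Rightarrow> 'a) \<Rightarrow> 'a set" where
  "q_harmonic n q scale z w = {p. q_laplace n q scale z w p = 0}"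

definition Q_elem :: "nat \<Rightarrow> (nat \<Rightarrow> 'a::ring_1) \<Rightarrow> (nat \<Rightarrow> 'a) \<Rightarrow> 'a" where
  "Q_elem n z w = (\<Sum>i\<in>{1..n}. z i * w i)"

definition polynomials_in :: "(complex \<Rightarrow> 'a::ring_1 \<Rightarrow> 'a) \<Rightarrow> 'a \<Rightarrow> 'a set" where
  "polynomials_in scale x =
     {\<Sum>i\<le>Polynomial.degree p. scale (coeff p i) (x ^ i) | p :: complex poly. True}"


section \<open>Tensor product of two subspaces\<close>

text \<open>\<open>U \<otimes> V\<close> is the free vector space on the set \<open>U \<times> V\<close> modulo the bilinearity relations;
  its elements are cosets.\<close>

definition pm_scale :: "complex \<Rightarrow> ('k \<Rightarrow>\<^sub>0 complex) \<Rightarrow> ('k \<Rightarrow>\<^sub>0 complex)" where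
  "pm_scale c t = Poly_Mapping.map (\<lambda>x. c * x) t"

definition free_space :: "'a set \<Rightarrow> 'b set \<Rightarrow> ('a \<times> 'b \<Rightarrow>\<^sub>0 complex) set" where
  "free_space U V = {t. Poly_Mapping.keys t \<subseteq> U \<times> V}"

abbreviation free_pair :: "'a \<Rightarrow> 'b \<Rightarrow> ('a \<times> 'b \<Rightarrow>\<^sub>0 complex)" where
  "free_pair u v \<equiv> Poly_Mapping.single (u, v) 1"

definition tensor_null ::
  "(complex \<Rightarrow> 'a::ab_group_add \<Rightarrow> 'a) \<Rightarrow> (complex \<Rightarrow> 'b::ab_group_add \<Rightarrow> 'b) \<Rightarrow>
   'a set \<Rightarrow> 'b set \<Rightarrow> ('a \<times> 'b \<Rightarrow>\<^sub>0 complex) set" where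
  "tensor_null s1 s2 U V = module.span pm_scale
     ({free_pair (u + u') v - free_pair u v - free_pair u' v | u u' v. u \<in> U \<and> u' \<in> U \<and> v \<in> V} \<union>
      {free_pair u (v + v') - free_pair u v - free_pair u v' | u v v'. u \<in> U \<and> v \<in> V \<and> v' \<in> V} \<union>
      {free_pair (s1 c u) v - pm_scale c (free_pair u v) | c u v. u \<in> U \<and> v \<in> V} \<union>
      {free_pair u (s2 c v) - pm_scale c (free_pair u v) | c u v. u \<in> U \<and> v \<in> V})"

definition tensor_coset ::
  "(complex \<Rightarrow> 'a::ab_group_add \<Rightarrow> 'a) \<Rightarrow> (complex \<Rightarrow> 'b::ab_group_add \<Rightarrow> 'b) \<Rightarrow>
   'a set \<Rightarrow> 'b set \<Rightarrow> ('a \<times> 'b \<Rightarrow>\<^sub>0 complex) \<Rightarrow> ('a \<times> 'b \<Rightarrow>\<^sub>0 complex) set" where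
  "tensor_coset s1 s2 U V t = {t'. t' - t \<in> tensor_null s1 s2 U V}"

definition tensor_space ::
  "(complex \<Rightarrow> 'a::ab_group_add \<Rightarrow> 'a) \<Rightarrow> (complex \<Rightarrow> 'b::ab_group_add \<Rightarrow> 'b) \<Rightarrow>
   'a set \<Rightarrow> 'b set \<Rightarrow> ('a \<times> 'b \<Rightarrow>\<^sub>0 complex) set set" where
  "tensor_space s1 s2 U V = tensor_coset s1 s2 U V ` free_space U V"

definition pure_tensor ::
  "(complex \<Rightarrow> 'a::ab_group_add \<Rightarrow> 'a) \<Rightarrow> (complex \<Rightarrow> 'b::ab_group_add \<Rightarrow> 'b) \<Rightarrow>
   'a set \<Rightarrow> 'b set \<Rightarrow> 'a \<Rightarrow> 'b \<Rightarrow> ('a \<times> 'b \<Rightarrow>\<^sub>0 complex) set" where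
  "pure_tensor s1 s2 U V u v = tensor_coset s1 s2 U V (free_pair u v)"

text \<open>Vector space operations on cosets are those of representatives, so linearity of a map out of
  \<open>U \<otimes> V\<close> is expressed on representatives.\<close>

definition tensor_linear ::
  "(complex \<Rightarrow> 'a::ab_group_add \<Rightarrow> 'a) \<Rightarrow> (complex \<Rightarrow> 'b::ab_group_add \<Rightarrow> 'b) \<Rightarrow>
   'a set \<Rightarrow> 'b set \<Rightarrow> (complex \<Rightarrow> 'c::ab_group_add \<Rightarrow> 'c) \<Rightarrow>
   (('a \<times> 'b \<Rightarrow>\<^sub>0 complex) set \<Rightarrow> 'c) \<Rightarrow> bool" where
  "tensor_linear s1 s2 U V s3 \<Phi> \<longleftrightarrow>
     (\<forall>t\<in>free_space U V. \<forall>t'\<in>free_space U V.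
        \<Phi> (tensor_coset s1 s2 U V (t + t')) =
        \<Phi> (tensor_coset s1 s2 U V t) + \<Phi> (tensor_coset s1 s2 U V t')) \<and>
     (\<forall>c. \<forall>t\<in>free_space U V.
        \<Phi> (tensor_coset s1 s2 U V (pm_scale c t)) = s3 c (\<Phi> (tensor_coset s1 s2 U V t)))"

end

theory Submission
  imports Defs "HOL-Library.Function_Algebras"
begin

text \<open>
  Write \<open>D\<^sub>i\<close>, \<open>B\<^sub>i\<close> for the two families of partial derivatives, \<open>L = \<Sum> D\<^sub>i B\<^sub>i\<close> for the
  \<open>q\<close>-Laplace operator and \<open>h = q - 1/q\<close>. The key point is an \<open>sl\<^sub>2\<close>-type relation: on elements of
  total degree \<open>m\<close>, \<open>L Q - Q L\<close> is multiplication by \<open>q^(n-1) [n + m]\<close>. It gives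
  \<open>L (Q^(k+1) x) = q^(n-1) [k+1] [n + m + k] Q^k x\<close> for harmonic \<open>x\<close> of degree \<open>m\<close>, with a nonzero
  coefficient. Hence, by induction on the degree, every element is a unique sum of \<open>Q^k x\<^sub>k\<close> with
  \<open>x\<^sub>k\<close> harmonic.

  The commutator is obtained from the behaviour of \<open>B\<^sub>i\<close> under left multiplication by \<open>z\<^sub>j\<close>, namely
  \<open>B\<^sub>j z\<^sub>j = z\<^sub>j B\<^sub>j\<close> and, for \<open>i \<noteq> j\<close>,
  \<open>B\<^sub>i z\<^sub>j = q^(-1) z\<^sub>j B\<^sub>i + [i < j] h q^(2(j-i)-1) z\<^sub>i B\<^sub>j\<close>, which makes the sum
  defining \<open>L z\<^sub>j\<close> telescope.

  That the two families of ordered monomials are bases is proved with a faithful module. Putting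
  \<open>Q\<^sub>k = \<Sum> z\<^sub>s w\<^sub>s\<close> (\<open>s \<le> k\<close>), the relations become \<open>q\<close>-commutation relations between the \<open>z\<^sub>i\<close> and the
  commuting \<open>Q\<^sub>k\<close>, and \<open>w\<^sub>k = z\<^sub>k^(-1) (Q\<^sub>k - Q\<^sub>k\<^sub>-\<^sub>1)\<close>; so the algebra acts on Laurent monomials in the
  \<open>z\<^sub>i\<close> and \<open>Q\<^sub>k\<close>, triangularly for the order in which \<open>Q\<^sub>k\<close> has weight \<open>k\<close>.
\<close>

section \<open>Modules over a finitely presented algebra\<close>

text \<open>Updating outside the support is the same as adding a \<open>single\<close>, so the
  library rule for \<open>update\<close> yields an additive one. That form suits maps known through
  their behaviour on sums.\<close>

lemma poly_mapping_add_induct [case_names zero single add]: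
  fixes p :: "'k \<Rightarrow>\<^sub>0 'b::monoid_add"
  assumes "P 0" "\<And>k c. P (Poly_Mapping.single k c)" "\<And>p p'. P p \<Longrightarrow> P p' \<Longrightarrow> P (p + p')"
  shows "P p"
proof (induction p rule: update_induct)
  case const
  then show ?case using assms(1) .
next
  case (update f a b)
  have "Poly_Mapping.update a b f = Poly_Mapping.single a b + f"
  proof (rule poly_mapping_eqI)
    fix k
    show "Poly_Mapping.lookup (Poly_Mapping.update a b f) k
      = Poly_Mapping.lookup (Poly_Mapping.single a b + f) k"
      using update by (cases "k = a") (auto simp: lookup_update lookup_add in_keys_iff lookup_single)
  qed
  then show ?case using assms update by simp
qed

section \<open>Linear actions of the free algebra\<close>

definition act ::
  "(complex \<Rightarrow> 'v::ab_group_add \<Rightarrow> 'v) \<Rightarrow> ('g \<Rightarrow> 'v \<Rightarrow> 'v) \<Rightarrow> ('g word \<Rightarrow>\<^sub>0 complex) \<Rightarrow> 'v \<Rightarrow> 'v" where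
  "act s f p v = (\<Sum>u\<in>Poly_Mapping.keys p. s (Poly_Mapping.lookup p u) (foldr f (letters u) v))"

locale complex_space = vector_space scale
  for scale :: "complex \<Rightarrow> 'v::ab_group_add \<Rightarrow> 'v"
begin

lemma act_superset:
  assumes "finite K" "Poly_Mapping.keys p \<subseteq> K"
  shows "act scale f p v = (\<Sum>u\<in>K. scale (Poly_Mapping.lookup p u) (foldr f (letters u) v))"
  unfolding act_def using assms
  by (intro sum.mono_neutral_left) (auto simp: in_keys_iff)

lemma act_zero [simp]: "act scale f 0 v = 0"
  by (simp add: act_def)

lemma act_add: "act scale f (p + p') v = act scale f p v + act scale f p' v"
proof -
  let ?K = "Poly_Mapping.keys p \<union> Poly_Mapping.keys p'"
  have "finite ?K" "Poly_Mapping.keys (p + p') \<subseteq> ?K"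
    using keys_add[of p p'] by auto
  then show ?thesis
    by (simp add: act_superset[of ?K] lookup_add scale_left_distrib sum.distrib)
qed

lemma act_single [simp]: "act scale f (Poly_Mapping.single u c) v = scale c (foldr f (letters u) v)"
  by (simp add: act_def)

lemma act_diff: "act scale f (p - p') v = act scale f p v - act scale f p' v"
  using act_add[of f "p - p'" p' v] by (simp add: algebra_simps)

lemma act_sum: "act scale f (\<Sum>i\<in>I. p i) v = (\<Sum>i\<in>I. act scale f (p i) v)"
  by (induction I rule: infinite_finite_induct) (auto simp: act_add)

lemma act_free_const [simp]: "act scale f (free_const c) v = scale c v"
  by (simp add: free_const_def zero_word_def)

lemma act_free_gen [simp]: "act scale f (free_gen x) v = f x v"
  by (simp add: free_gen_def)

lemma act_linear:
  assumes "\<And>x. Vector_Spaces.linear scale scale (f x)"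
  shows "Vector_Spaces.linear scale scale (act scale f p)"
proof -
  have fold_linear: "Vector_Spaces.linear scale scale (foldr f us)" for us
  proof (induction us)
    case Nil
    then show ?case by (simp add: Vector_Spaces.linear_iff vector_space_axioms)
  next
    case (Cons x us)
    then show ?case
      using assms[of x] by (simp add: Vector_Spaces.linear_iff)
  qed
  then have fold_hom: "foldr f us (a + b) = foldr f us a + foldr f us b"
    "foldr f us (scale c a) = scale c (foldr f us a)" for us a b c
    by (auto simp: Vector_Spaces.linear_iff)
  show ?thesis
    unfolding Vector_Spaces.linear_iff
    by (auto simp: act_def fold_hom sum.distrib scale_right_distrib scale_sum_right
        mult.commute vector_space_axioms)
qed

text \<open>\<open>foldr\<close> lets the first letter act last, so concatenated words act by
  composition. Additivity in both factors reduces the claim to multiples of words.\<close>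

lemma act_mult:
  assumes "\<And>x. Vector_Spaces.linear scale scale (f x)"
  shows "act scale f (p * p') v = act scale f p (act scale f p' v)"
proof (induction p rule: poly_mapping_add_induct)
  case zero
  then show ?case by simp
next
  case (add p1 p2)
  then show ?case by (simp add: distrib_right act_add)
next
  case (single u c)
  interpret L: Vector_Spaces.linear scale scale "act scale f (Poly_Mapping.single u c)"
    by (rule act_linear[OF assms])
  show ?case
  proof (induction p' rule: poly_mapping_add_induct)
    case zero
    then show ?case by (simp add: L.zero del: act_single)
  next
    case (add p1 p2)
    then show ?case by (simp add: distrib_left act_add L.add del: act_single)
  next
    case (single u' c')
    interpret L: Vector_Spaces.linear scale scale "act scale f (Poly_Mapping.single u 1)"
      by (rule act_linear[OF assms])
    have "foldr f (letters u) (scale c' w) = scale c' (foldr f (letters u) w)" for w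
      using L.scale[of c' w] by simp
    then show ?case by (simp add: mult_single plus_word_def)
  qed
qed

text \<open>Left multiples act as zero because the operators are linear, right multiples because the
  element of the ideal is then evaluated at another vector. Hence \<open>v\<close> stays arbitrary
  in the induction.\<close>

lemma act_ideal_eq_0:
  assumes "\<And>x. Vector_Spaces.linear scale scale (f x)"
    and "\<And>r v. r \<in> R \<Longrightarrow> act scale f r v = 0"
    and "p \<in> two_sided_ideal F R"
  shows "act scale f p v = 0"
  using assms(3)
proof (induction arbitrary: v rule: two_sided_ideal.induct)
  case (mult_left x a)
  interpret L: Vector_Spaces.linear scale scale "act scale f x"
    by (rule act_linear[OF assms(1)])
  show ?case using mult_left by (simp add: act_mult[OF assms(1)])
qed (auto simp: act_add act_mult[OF assms(1)] assms(2))

end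

text \<open>The algebra acts on itself by left multiplication, and evaluation is the orbit map of
  \<open>1\<close>; so all facts about \<open>act\<close> apply to \<open>free_eval\<close>.\<close>

lemma free_eval_eq_act: "free_eval s g p = act s (\<lambda>x. (*) (g x)) p 1"
proof -
  have "prod_list (map g us) = foldr (\<lambda>x. (*) (g x)) us 1" for us
    by (induction us) auto
  then show ?thesis by (simp add: free_eval_def act_def)
qed

sublocale complex_algebra \<subseteq> complex_space scale ..

lemma (in complex_algebra) linear_mult_left: "Vector_Spaces.linear scale scale ((*) a)"
  by (simp add: Vector_Spaces.linear_iff vector_space_axioms distrib_left scale_mult_right)

lemma free_alg_add: "p \<in> free_alg G \<Longrightarrow> p' \<in> free_alg G \<Longrightarrow> p + p' \<in> free_alg G"
  using keys_add[of p p'] by (fastforce simp: free_alg_def)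

lemma free_alg_diff: "p \<in> free_alg G \<Longrightarrow> p' \<in> free_alg G \<Longrightarrow> p - p' \<in> free_alg G"
  using keys_diff[of p p'] by (fastforce simp: free_alg_def)

lemma free_alg_mult: "p \<in> free_alg G \<Longrightarrow> p' \<in> free_alg G \<Longrightarrow> p * p' \<in> free_alg G"
  using keys_mult[of p p'] by (fastforce simp: free_alg_def plus_word_def)

lemma free_alg_gen: "x \<in> G \<Longrightarrow> free_gen x \<in> free_alg G"
  by (simp add: free_alg_def free_gen_def)

lemma free_alg_const: "free_const c \<in> free_alg G"
  by (simp add: free_alg_def free_const_def zero_word_def)

section \<open>Universal property of a presented algebra\<close>

locale presented_algebra =
  fixes scale :: "complex \<Rightarrow> 'a::ring_1 \<Rightarrow> 'a" and G :: "'g set" and R and g :: "'g \<Rightarrow> 'a"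
  assumes presented: "presented_by scale G R g"
begin

sublocale complex_algebra scale
  using presented by (simp add: presented_by_def)

lemma act_regular: "act scale (\<lambda>x. (*) (g x)) p a = free_eval scale g p * a"
  unfolding free_eval_eq_act act_def
proof -
  have "foldr (\<lambda>x. (*) (g x)) us a = foldr (\<lambda>x. (*) (g x)) us 1 * a" for us
    by (induction us) (auto simp: mult.assoc)
  then show "(\<Sum>u\<in>Poly_Mapping.keys p. scale (Poly_Mapping.lookup p u) (foldr (\<lambda>x. (*) (g x)) (letters u) a)) =
    (\<Sum>u\<in>Poly_Mapping.keys p. scale (Poly_Mapping.lookup p u) (foldr (\<lambda>x. (*) (g x)) (letters u) 1)) * a"
    by (simp add: sum_distrib_right scale_mult_left)
qed

lemma relator_eval: "r \<in> R \<Longrightarrow> free_eval scale g r = 0"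
  using presented two_sided_ideal.base[of r R "free_alg G"] by (auto simp: presented_by_def)

lemma free_eval_surj: "\<exists>p. p \<in> free_alg G \<and> free_eval scale g p = a"
proof -
  have "a \<in> free_eval scale g ` free_alg G"
    using presented by (simp add: presented_by_def)
  then obtain p where "a = free_eval scale g p" "p \<in> free_alg G"
    by (rule imageE)
  then show ?thesis by (intro exI[of _ p]) simp
qed

text \<open>Products of generators span the algebra, and each of them arises from \<open>1\<close>
  by successive left multiplications.\<close>

lemma generated_induct:
  assumes S: "subspace S" and "1 \<in> S" and "\<And>x a. x \<in> G \<Longrightarrow> a \<in> S \<Longrightarrow> g x * a \<in> S"
  shows "a \<in> S"
proof -
  obtain p where p: "p \<in> free_alg G" "free_eval scale g p = a"
    using free_eval_surj by auto
  have "prod_list (map g us) \<in> S" if "set us \<subseteq> G" for us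
    using that by (induction us) (auto intro: assms)
  then show ?thesis
    using p unfolding free_eval_def free_alg_def
    by (auto intro!: subspace_sum[OF S] subspace_scale[OF S])
qed

text \<open>Two preimages of \<open>a\<close> in the free algebra differ by an element of the ideal,
  which acts as zero; so the orbit map \<open>T a = a v\<close> is well defined on the
  quotient.\<close>

lemma module_map:
  fixes s :: "complex \<Rightarrow> 'v::ab_group_add \<Rightarrow> 'v"
  assumes lin: "\<And>x. Vector_Spaces.linear s s (f x)"
    and rel: "\<And>r v. r \<in> R \<Longrightarrow> act s f r v = 0"
  obtains T where "Vector_Spaces.linear scale s T" "T 1 = v"
    "\<And>x a. x \<in> G \<Longrightarrow> T (g x * a) = f x (T a)"
proof -
  interpret V: complex_space s
    using lin[of undefined] by (simp add: Vector_Spaces.linear_iff complex_space_def)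
  \<comment> \<open>Any preimage in the free algebra will do: \<open>T_eval\<close> shows that the
    choice does not matter.\<close>
  define rep where "rep a = (SOME p. p \<in> free_alg G \<and> free_eval scale g p = a)" for a
  have "rep a \<in> free_alg G \<and> free_eval scale g (rep a) = a" for a
    unfolding rep_def by (rule someI_ex) (rule free_eval_surj)
  then have rep: "rep a \<in> free_alg G" "free_eval scale g (rep a) = a" for a
    by auto
  define T where "T a = act s f (rep a) v" for a
  have T_eval: "T (free_eval scale g p) = act s f p v" if "p \<in> free_alg G" for p
  proof -
    let ?d = "rep (free_eval scale g p) - p"
    have "free_eval scale g ?d = 0"
      by (simp add: free_eval_eq_act act_diff) (simp add: free_eval_eq_act[symmetric] rep)
    moreover have "?d \<in> free_alg G" using that rep by (intro free_alg_diff)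
    ultimately have "?d \<in> two_sided_ideal (free_alg G) R"
      using presented by (auto simp: presented_by_def)
    then have "act s f ?d v = 0"
      using V.act_ideal_eq_0[OF lin rel] by blast
    then show ?thesis by (simp add: T_def V.act_diff)
  qed
  have eval_add: "free_eval scale g (p + p') = free_eval scale g p + free_eval scale g p'" for p p'
    by (simp add: free_eval_eq_act act_add)
  have eval_mult: "free_eval scale g (p * p') = free_eval scale g p * free_eval scale g p'" for p p'
    using act_regular[of p "free_eval scale g p'"]
    by (simp add: free_eval_eq_act act_mult[OF linear_mult_left])
  have eval_const: "free_eval scale g (free_const c * p) = scale c (free_eval scale g p)" for c p
    unfolding free_eval_eq_act act_mult[OF linear_mult_left] by simp
  have eval_gen: "free_eval scale g (free_gen x) = g x" for x
    by (simp add: free_eval_eq_act)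
  show ?thesis
  proof (rule that)
    have "T (a + b) = T a + T b" for a b
      using T_eval[OF free_alg_add[OF rep(1) rep(1)], of a b]
      by (simp add: eval_add rep V.act_add T_def)
    moreover have "T (scale c a) = s c (T a)" for c a
      using T_eval[OF free_alg_mult[OF free_alg_const rep(1)], of c a]
      by (simp add: eval_const rep V.act_mult[OF lin] T_def)
    ultimately show "Vector_Spaces.linear scale s T"
      by (simp add: Vector_Spaces.linear_iff vector_space_axioms V.vector_space_axioms)
    show "T 1 = v"
      using T_eval[OF free_alg_const, of 1] by (simp add: free_eval_eq_act)
    show "T (g x * a) = f x (T a)" if "x \<in> G" for x a
      using T_eval[OF free_alg_mult[OF free_alg_gen[OF that] rep(1)], of a]
      by (simp add: eval_mult eval_gen rep V.act_mult[OF lin] T_def)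
  qed
qed

end

section \<open>A faithful module\<close>

text \<open>A function \<open>f\<close> stands for the Laurent series \<open>\<Sum> f a b z^\<alpha> Q^b\<close> with
  \<open>a k = \<alpha>\<^sub>1 + \<dots> + \<alpha>\<^sub>k\<close>; with partial sums as indices no sums occur in the exponents of \<open>q\<close>. The
  case \<open>j = 1\<close> of \<open>model_w\<close> reflects \<open>Q\<^sub>0 = 0\<close>.\<close>

type_synonym model = "(nat \<Rightarrow> int) \<Rightarrow> (nat \<Rightarrow> int) \<Rightarrow> complex"

definition model_scale :: "complex \<Rightarrow> model \<Rightarrow> model" where
  "model_scale c f = (\<lambda>a b. c * f a b)"

text \<open>On its way to its own power \<open>z_j\<close> passes \<open>z_1, ..., z_(j-1)\<close>,
  whose exponents add up to \<open>a (j - 1)\<close>. The argument of \<open>f\<close> is shifted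
  backwards because \<open>f\<close> holds coefficients.\<close>

definition model_z :: "complex \<Rightarrow> nat \<Rightarrow> model \<Rightarrow> model" where
  "model_z q j f = (\<lambda>a b. q powi (- a (j - 1)) * f (\<lambda>k. a k - of_bool (j \<le> k)) b)"

text \<open>The formula is \<open>z_j^(-1) (Q_j - Q_(j-1))\<close>. The squares come from
  \<open>Q_k z_i = q^2 z_i Q_k\<close> for \<open>i > k\<close>, and the summand \<open>1\<close>
  from reading the exponents before \<open>z_j^(-1)\<close> lowers them.\<close>

definition model_w :: "complex \<Rightarrow> nat \<Rightarrow> nat \<Rightarrow> model \<Rightarrow> model" where
  "model_w q n j f = (\<lambda>a b. q powi (a (j - 1)) *
     ((q powi (a n - a j))\<^sup>2 * f (\<lambda>k. a k + of_bool (j \<le> k)) (\<lambda>k. b k - of_bool (k = j))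
      - (if j = 1 then 0 else (q powi (a n + 1 - a (j - 1)))\<^sup>2
           * f (\<lambda>k. a k + of_bool (j \<le> k)) (\<lambda>k. b k - of_bool (k = j - 1)))))"

interpretation model: complex_space model_scale
  by standard (auto simp: model_scale_def fun_eq_iff algebra_simps)

lemma linear_model:
  "Vector_Spaces.linear model_scale model_scale (case_generator (model_z q) (model_w q n) x)"
  by (auto simp: Vector_Spaces.linear_iff model.vector_space_axioms model_z_def model_w_def
      model_scale_def fun_eq_iff algebra_simps split: generator.split)

lemma model_zz:
  assumes "q \<noteq> 0" "i \<ge> 1" "i < j"
  shows "model_z q i (model_z q j f) = model_scale q (model_z q j (model_z q i f))"
proof -
  \<comment> \<open>\<open>z_i\<close> shifts the partial sum \<open>a (j - 1)\<close> in the power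
    of \<open>z_j\<close>, but \<open>z_j\<close> does not shift \<open>a (i - 1)\<close>; this
    asymmetry is the factor \<open>q\<close>.\<close>
  have "i \<le> j - 1" "\<not> j \<le> i - 1" using assms by auto
  then show ?thesis using assms
    by (auto simp: model_z_def model_scale_def fun_eq_iff algebra_simps power_int_add power_int_diff power_int_minus
      divide_inverse power2_eq_square)
qed

lemma model_wz:
  assumes "q \<noteq> 0" "i \<ge> 1" "i \<le> n" "j \<ge> 1" "j \<le> n" "i \<noteq> j"
  shows "model_w q n j (model_z q i f) = model_scale q (model_z q i (model_w q n j f))"
proof -
  have *: "i \<le> j - 1 \<longleftrightarrow> i < j" "j \<le> i - 1 \<longleftrightarrow> j < i" using assms by auto
  show ?thesis using assms
    by (auto simp: model_z_def model_w_def model_scale_def fun_eq_iff algebra_simps power_int_add power_int_diff power_int_minus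
      divide_inverse power2_eq_square *)
      (simp_all add: field_simps)
qed

lemma model_ww:
  assumes "q \<noteq> 0" "i \<ge> 1" "j \<le> n" "i < j"
  shows "model_w q n i (model_w q n j f) = model_scale (inverse q) (model_w q n j (model_w q n i f))"
proof -
  have *: "i \<le> j - 1" "\<not> j \<le> i - 1" using assms by auto
  show ?thesis using assms
    by (auto simp: model_w_def model_scale_def fun_eq_iff algebra_simps power_int_add power_int_diff power_int_minus
      divide_inverse power2_eq_square *)
      (simp_all add: field_simps)
qed

lemma model_wz_diag:
  assumes "q \<noteq> 0" "k \<ge> 1" "k \<le> n"
  shows "model_w q n k (model_z q k f) = model_z q k (model_w q n k f)
     + model_scale (1 - q\<^sup>2) (\<Sum>s\<in>{1..<k}. model_z q s (model_w q n s f))"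
proof -
  \<comment> \<open>This is the action of \<open>Q_k\<close> on \<open>f\<close>. Since
    \<open>z_s w_s\<close> acts as \<open>Q_s - Q_(s-1)\<close>, the sum in the relation
    telescopes.\<close>
  define Q where "Q k = (\<lambda>a b. if k = 0 then 0 else (q powi (a n - a k))\<^sup>2 * f a (\<lambda>i. b i - of_bool (i = k)))" for k
  have "model_z q s (model_w q n s f) = Q s - Q (s - 1)" if "1 \<le> s" "s \<le> n" for s
    using that assms by (auto simp: model_z_def model_w_def Q_def fun_eq_iff algebra_simps power_int_add power_int_diff power_int_minus
      divide_inverse power2_eq_square)
      (simp_all add: field_simps)
  moreover from this have "(\<Sum>s\<in>{1..<k}. model_z q s (model_w q n s f)) = (\<Sum>s\<in>{1..<k}. Q s - Q (s - 1))"
    using assms by (intro sum.cong) auto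
  moreover have "(\<Sum>s\<in>{1..<k}. Q s - Q (s - 1)) = Q (k - 1)"
    using assms(2) 
  proof (induction k rule: dec_induct)
    case base
    then show ?case by (simp add: Q_def fun_eq_iff)
  next
    case (step k)
    then show ?case by (simp add: sum.atLeastLessThan_Suc)
  qed
  ultimately show ?thesis using assms
    by (auto simp: model_z_def model_w_def Q_def model_scale_def fun_eq_iff algebra_simps power_int_add power_int_diff power_int_minus
      divide_inverse power2_eq_square)
      (simp_all add: field_simps)
qed

lemma (in complex_space) act_relator:
  assumes lin: "\<And>x. Vector_Spaces.linear scale scale (f x)"
    and zz: "\<And>i j v. i \<in> {1..n} \<Longrightarrow> j \<in> {1..n} \<Longrightarrow> i < j \<Longrightarrow>
      f (Zgen i) (f (Zgen j) v) = scale q (f (Zgen j) (f (Zgen i) v))"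
    and ww: "\<And>i j v. i \<in> {1..n} \<Longrightarrow> j \<in> {1..n} \<Longrightarrow> i < j \<Longrightarrow>
      f (Wgen i) (f (Wgen j) v) = scale (inverse q) (f (Wgen j) (f (Wgen i) v))"
    and wz: "\<And>i j v. i \<in> {1..n} \<Longrightarrow> j \<in> {1..n} \<Longrightarrow> i \<noteq> j \<Longrightarrow>
      f (Wgen j) (f (Zgen i) v) = scale q (f (Zgen i) (f (Wgen j) v))"
    and diag: "\<And>k v. k \<in> {1..n} \<Longrightarrow> f (Wgen k) (f (Zgen k) v) = f (Zgen k) (f (Wgen k) v)
      + scale (1 - q\<^sup>2) (\<Sum>s\<in>{1..<k}. f (Zgen s) (f (Wgen s) v))"
    and r: "r \<in> relators n q"
  shows "act scale f r v = 0"
  using r unfolding relators_def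
  by (auto simp: act_diff act_add act_sum act_mult[OF lin] zz ww wz diag simp del: atLeastAtMost_iff)

section \<open>Leading terms and linear independence\<close>

definition weight :: "nat \<Rightarrow> (nat \<Rightarrow> int) \<Rightarrow> int" where
  "weight n b = (\<Sum>k\<in>{1..n}. int k * b k)"

text \<open>Each generator shifts the \<open>z\<close>-exponents of all terms equally, so only the
  \<open>Q\<close>-parts have to be compared by weight.\<close>

definition lead :: "nat \<Rightarrow> model \<Rightarrow> (nat \<Rightarrow> int) \<Rightarrow> (nat \<Rightarrow> int) \<Rightarrow> bool" where
  "lead n f a b \<longleftrightarrow> f a b \<noteq> 0 \<and>
     (\<forall>a' b'. f a' b' \<noteq> 0 \<longrightarrow> a' = a \<and> (b' = b \<or> weight n b' < weight n b))"

lemma lead_unique: "lead n f a b \<Longrightarrow> lead n f a' b' \<Longrightarrow> a = a' \<and> b = b'"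
  unfolding lead_def by (metis less_asym)

lemma weight_add: "j \<le> n \<Longrightarrow> weight n (\<lambda>k. b k + c * of_bool (k = j)) = weight n b + c * int j"
proof -
  assume "j \<le> n"
  have "weight n (\<lambda>k. b k + c * of_bool (k = j)) = weight n b + (\<Sum>k\<in>{1..n}. int k * (c * of_bool (k = j)))"
    by (simp add: weight_def distrib_left sum.distrib)
  also have "(\<Sum>k\<in>{1..n}. int k * (c * of_bool (k = j))) = (\<Sum>k\<in>{1..n}. if k = j then c * int k else 0)"
    by (intro sum.cong) auto
  also have "\<dots> = c * int j"
    using \<open>j \<le> n\<close> by (cases "j = 0") auto
  finally show ?thesis .
qed

lemma lead_z:
  assumes "q \<noteq> 0" "lead n f a b"
  shows "lead n (model_z q j f) (\<lambda>k. a k + of_bool (j \<le> k)) b"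
proof -
  have "a' = (\<lambda>k. a k + of_bool (j \<le> k)) \<and> (b' = b \<or> weight n b' < weight n b)"
    if "model_z q j f a' b' \<noteq> 0" for a' b'
  proof -
    have "f (\<lambda>k. a' k - of_bool (j \<le> k)) b' \<noteq> 0"
      using that by (auto simp: model_z_def)
    then have "(\<lambda>k. a' k - of_bool (j \<le> k)) = a" "b' = b \<or> weight n b' < weight n b"
      using assms(2) by (auto simp: lead_def)
    then show ?thesis by (auto simp: fun_eq_iff algebra_simps)
  qed
  moreover have "model_z q j f (\<lambda>k. a k + of_bool (j \<le> k)) b \<noteq> 0"
    using assms by (simp add: model_z_def lead_def)
  ultimately show ?thesis unfolding lead_def by blast
qed

text \<open>One part of \<open>w_j\<close> raises the exponent of \<open>Q_j\<close>, gaining weight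
  \<open>j\<close>, the other that of \<open>Q_(j-1)\<close>, gaining only \<open>j - 1\<close>; the
  former therefore gives the new leading term.\<close>

lemma lead_w:
  assumes q: "q \<noteq> 0" and j: "j \<ge> 1" "j \<le> n" and f: "lead n f a b"
  shows "lead n (model_w q n j f) (\<lambda>k. a k - of_bool (j \<le> k)) (\<lambda>k. b k + of_bool (k = j))"
    (is "lead n ?f ?a ?b")
proof -
  have top: "weight n ?b = weight n b + int j"
    using weight_add[of j n b 1] j by simp
  have supp: "a' = a \<and> (b' = b \<or> weight n b' < weight n b)" if "f a' b' \<noteq> 0" for a' b'
    using f that by (auto simp: lead_def)
  have "a' = ?a \<and> (b' = ?b \<or> weight n b' < weight n ?b)" if nz: "?f a' b' \<noteq> 0" for a' b'
  proof -
    consider (1) "f (\<lambda>k. a' k + of_bool (j \<le> k)) (\<lambda>k. b' k - of_bool (k = j)) \<noteq> 0"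
      | (2) "f (\<lambda>k. a' k + of_bool (j \<le> k)) (\<lambda>k. b' k - of_bool (k = j - 1)) \<noteq> 0"
      using nz unfolding model_w_def by (cases "f (\<lambda>k. a' k + of_bool (j \<le> k)) (\<lambda>k. b' k - of_bool (k = j)) = 0") (auto split: if_splits)
    then show ?thesis
    proof cases
      case 1
      have "weight n (\<lambda>k. b' k - of_bool (k = j)) = weight n b' - int j"
        using weight_add[of j n b' "-1"] j by simp
      then show ?thesis
        using supp[OF 1] top by (auto simp: fun_eq_iff algebra_simps)
    next
      case 2
      have "weight n (\<lambda>k. b' k - of_bool (k = j - 1)) = weight n b' - int (j - 1)"
        using weight_add[of "j - 1" n b' "-1"] j by simp
      moreover have "int (j - 1) < int j" using j by simp
      moreover have "weight n (\<lambda>k. b' k - of_bool (k = j - 1)) \<le> weight n b"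
        using supp[OF 2] by auto
      ultimately have "weight n b' < weight n ?b"
        using top by linarith
      then show ?thesis
        using supp[OF 2] by (auto simp: fun_eq_iff algebra_simps)
    qed
  qed
  moreover have "?f ?a ?b \<noteq> 0"
  proof -
    \<comment> \<open>The \<open>Q_(j-1)\<close> part cannot cancel the leading coefficient: that
      would need a term of \<open>f\<close> of larger weight than \<open>b\<close>.\<close>
    have "f a (\<lambda>k. b k + of_bool (k = j) - of_bool (k = j - 1)) = 0"
    proof (rule ccontr)
      assume *: "f a (\<lambda>k. b k + of_bool (k = j) - of_bool (k = j - 1)) \<noteq> 0"
      have "weight n (\<lambda>k. b k + of_bool (k = j) - of_bool (k = j - 1)) = weight n b + int j - int (j - 1)"
        using weight_add[of "j - 1" n ?b "-1"] j top by simp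
      moreover have "int (j - 1) < int j" using j by simp
      moreover have "(\<lambda>k. b k + of_bool (k = j) - of_bool (k = j - 1)) j \<noteq> b j"
        using j by simp
      ultimately show False using supp[OF *] by auto
    qed
    then show ?thesis
      using q f by (auto simp: model_w_def lead_def)
  qed
  ultimately show ?thesis unfolding lead_def by blast
qed

text \<open>In a vanishing combination take, among the vectors with nonzero coefficient, one whose
  leading position has maximal weight. At that position the images of all the others vanish.\<close>

lemma lead_independent:
  assumes "Vector_Spaces.linear scale model_scale T"
    and lead: "\<And>i. i \<in> I \<Longrightarrow> lead n (T (v i)) (fst (pos i)) (snd (pos i))"
    and inj: "inj_on pos I"
  shows "inj_on v I" and "\<not> module.dependent scale (v ` I)"
proof -
  interpret T: Vector_Spaces.linear scale model_scale T by fact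
  show v: "inj_on v I"
    using lead inj unfolding inj_on_def by (metis lead_unique prod_eqI)
  show "\<not> T.vs1.dependent (v ` I)"
  proof (rule ccontr)
    assume "\<not> ?thesis"
    then obtain t u x where t: "finite t" "t \<subseteq> v ` I" "(\<Sum>x\<in>t. scale (u x) x) = 0" "x \<in> t" "u x \<noteq> 0"
      unfolding T.vs1.dependent_explicit by blast
    obtain S where S: "finite S" "S \<subseteq> I" "t = v ` S"
      using finite_subset_image[OF t(1,2)] by blast
    with t obtain i where S: "finite S" "S \<subseteq> I" "(\<Sum>x\<in>v ` S. scale (u x) x) = 0" "i \<in> S" "u (v i) \<noteq> 0"
      by auto
    define S' where "S' = {i \<in> S. u (v i) \<noteq> 0}"
    define m where "m = Max ((\<lambda>i. weight n (snd (pos i))) ` S')"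
    have S': "finite S'" "S' \<noteq> {}" using S by (auto simp: S'_def)
    then have "m \<in> (\<lambda>i. weight n (snd (pos i))) ` S'"
      unfolding m_def by (intro Max_in) auto
    then obtain j where j: "j \<in> S'" "weight n (snd (pos j)) = m" by auto
    have max: "weight n (snd (pos k)) \<le> m" if "k \<in> S'" for k
      unfolding m_def using that S' by (intro Max_ge) auto
    have "(\<Sum>k\<in>S. scale (u (v k)) (v k)) = 0"
      using S v by (subst (asm) sum.reindex) (auto intro: inj_on_subset)
    then have "0 = T (\<Sum>k\<in>S. scale (u (v k)) (v k)) (fst (pos j)) (snd (pos j))"
      by (simp add: T.zero)
    also have "\<dots> = (\<Sum>k\<in>S. u (v k) * T (v k) (fst (pos j)) (snd (pos j)))"
    proof -
      have "sum g S a b = (\<Sum>k\<in>S. g k a b)" for g :: "_ \<Rightarrow> model" and a b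
        by (induction S rule: infinite_finite_induct) auto
      then show ?thesis by (simp add: T.sum T.scale model_scale_def)
    qed
    also have "\<dots> = (\<Sum>k\<in>{j}. u (v k) * T (v k) (fst (pos j)) (snd (pos j)))"
    proof (rule sum.mono_neutral_right)
      show "\<forall>k\<in>S - {j}. u (v k) * T (v k) (fst (pos j)) (snd (pos j)) = 0"
      proof (rule ballI, rule ccontr)
        fix k assume k: "k \<in> S - {j}" "u (v k) * T (v k) (fst (pos j)) (snd (pos j)) \<noteq> 0"
        then have "k \<in> S'" "T (v k) (fst (pos j)) (snd (pos j)) \<noteq> 0" by (auto simp: S'_def)
        moreover have "lead n (T (v k)) (fst (pos k)) (snd (pos k))" using k S lead by auto
        ultimately have "fst (pos j) = fst (pos k) \<and>
            (snd (pos j) = snd (pos k) \<or> weight n (snd (pos j)) < weight n (snd (pos k)))"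
          unfolding lead_def by blast
        then have "pos j = pos k"
          using max[OF \<open>k \<in> S'\<close>] j by (auto simp: prod_eq_iff)
        then show False
          using k j S inj by (auto simp: inj_on_def S'_def)
      qed
    qed (use S j in \<open>auto simp: S'_def\<close>)
    finally show False
      using j S lead[of j] by (auto simp: S'_def lead_def)
  qed
qed

section \<open>Pairs of q-commuting families and partial derivatives\<close>

text \<open>Numerator and denominator both change sign, so exchanging \<open>q\<close> with
  \<open>inverse q\<close> leaves the q-numbers as they are.\<close>

lemma qnum_inverse: "qnum (inverse q) a = qnum q a"
  unfolding qnum_def using minus_divide_divide[of "q ^ a - inverse q ^ a" "q - inverse q"] by simp

lemma sum_upd_Suc:
  fixes r :: "'i \<Rightarrow> nat"
  assumes "finite A"
  shows "(\<Sum>i\<in>A. (r(j := Suc (r j))) i) = (\<Sum>i\<in>A. r i) + of_bool (j \<in> A)"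
  using assms by (induction A) auto

text \<open>The additive form avoids a truncated subtraction of sums.\<close>

lemma sum_upd_pred:
  fixes r :: "'i \<Rightarrow> nat"
  assumes "finite A" "r j > 0"
  shows "(\<Sum>i\<in>A. (r(j := r j - 1)) i) + of_bool (j \<in> A) = (\<Sum>i\<in>A. r i)"
  using assms by (induction A) auto

lemma ordered_monomial_cong:
  "(\<And>i. i \<in> {1..n} \<Longrightarrow> r i = r' i) \<Longrightarrow> ordered_monomial n x r = ordered_monomial n x r'"
  unfolding ordered_monomial_def by (intro arg_cong[of _ _ prod_list] map_cong) auto

lemma ordered_monomial_zero: "(\<And>i. i \<in> {1..n} \<Longrightarrow> r i = 0) \<Longrightarrow> ordered_monomial n x r = 1"
proof -
  assume r: "\<And>i. i \<in> {1..n} \<Longrightarrow> r i = 0"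
  have "prod_list (map (\<lambda>i. x i ^ r i) js) = 1" if "set js \<subseteq> {1..n}" for js
    using that r by (induction js) auto
  from this[of "[1..<Suc n]"] show ?thesis
    by (auto simp: ordered_monomial_def atLeastLessThanSuc_atLeastAtMost simp del: upt_Suc)
qed

section \<open>Linear maps and multiplication of ordered monomials\<close>

named_theorems lin_intros

context complex_algebra
begin

abbreviation lin :: "('a \<Rightarrow> 'a) \<Rightarrow> bool" where
  "lin \<equiv> Vector_Spaces.linear scale scale"

lemmas lin_iff = Vector_Spaces.linear_iff[of scale scale, simplified vector_space_axioms simp_thms]

lemma lin_ident [lin_intros]: "lin (\<lambda>x. x)"
  and lin_zero [lin_intros]: "lin (\<lambda>x. 0)"
  and lin_add [lin_intros]: "lin F \<Longrightarrow> lin G \<Longrightarrow> lin (\<lambda>x. F x + G x)"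
  and lin_diff [lin_intros]: "lin F \<Longrightarrow> lin G \<Longrightarrow> lin (\<lambda>x. F x - G x)"
  and lin_scale [lin_intros]: "lin F \<Longrightarrow> lin (\<lambda>x. scale c (F x))"
  and lin_mult [lin_intros]: "lin F \<Longrightarrow> lin (\<lambda>x. a * F x)"
  and lin_if [lin_intros]: "lin F \<Longrightarrow> lin G \<Longrightarrow> lin (\<lambda>x. if b then F x else G x)"
  and lin_comp: "lin F \<Longrightarrow> lin G \<Longrightarrow> lin (\<lambda>x. F (G x))"
  by (auto simp: lin_iff algebra_simps scale_right_distrib scale_right_diff_distrib scale_mult_right)

lemma lin_sum [lin_intros]: "(\<And>i. i \<in> I \<Longrightarrow> lin (F i)) \<Longrightarrow> lin (\<lambda>x. \<Sum>i\<in>I. F i x)"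
  by (induction I rule: infinite_finite_induct) (auto intro: lin_intros)

lemma lin_map_add: "lin F \<Longrightarrow> F (x + y) = F x + F y"
  and lin_map_scale: "lin F \<Longrightarrow> F (scale c x) = scale c (F x)"
  by (auto simp: lin_iff)

lemma lin_map_zero: "lin F \<Longrightarrow> F 0 = 0"
  using lin_map_scale[of F 0 0] by simp

lemma lin_map_diff: "lin F \<Longrightarrow> F (x - y) = F x - F y"
  using lin_map_add[of F "x - y" y] by (simp add: algebra_simps)

lemma lin_map_sum: "lin F \<Longrightarrow> F (sum g A) = (\<Sum>i\<in>A. F (g i))"
  by (induction A rule: infinite_finite_induct) (auto simp: lin_map_zero lin_map_add)

lemma subspace_eq: "lin F \<Longrightarrow> lin G \<Longrightarrow> subspace {x. F x = G x}"
  by (rule subspaceI) (auto simp: lin_iff lin_map_zero)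

lemma subspace_vimage: "lin F \<Longrightarrow> subspace S \<Longrightarrow> subspace {x. F x \<in> S}"
  by (rule subspaceI) (auto simp: lin_map_zero lin_map_add lin_map_scale subspace_0 subspace_add subspace_scale)

lemma span_map:
  assumes "x \<in> span B" "lin F" "\<And>b. b \<in> B \<Longrightarrow> F b \<in> S" "subspace S"
  shows "F x \<in> S"
  using span_subspace_induct[OF assms(1) subspace_vimage[OF assms(2,4)]] assms(3) by blast

text \<open>\<open>x j\<close> passes \<open>x 1, ..., x (j - 1)\<close>, each factor costing
  \<open>inverse c\<close>, and then joins its own power. The constant is \<open>q\<close> for the
  \<open>z\<close>'s and \<open>inverse q\<close> for the \<open>w\<close>'s.\<close>

lemma ordered_monomial_mult:
  assumes comm: "\<And>i j. i \<in> {1..n} \<Longrightarrow> j \<in> {1..n} \<Longrightarrow> i < j \<Longrightarrow> x i * x j = scale c (x j * x i)"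
    and c: "c \<noteq> 0" and j: "j \<in> {1..n}"
  shows "x j * ordered_monomial n x r =
    scale (inverse c ^ (\<Sum>i\<in>{1..<j}. r i)) (ordered_monomial n x (r(j := Suc (r j))))"
proof -
  have comm': "x j * x i = scale (inverse c) (x i * x j)" if "i \<in> {1..<j}" for i
    using comm[of i j] that j c by simp
  have comm_pow: "x j * x i ^ m = scale (inverse c ^ m) (x i ^ m * x j)" if "i \<in> {1..<j}" for i m
  proof (induction m)
    case (Suc m)
    have "x j * x i ^ Suc m = (x j * x i) * x i ^ m" by (simp add: mult.assoc)
    also have "\<dots> = scale (inverse c) (x i * (x j * x i ^ m))"
      by (simp add: comm'[OF that] scale_mult_left mult.assoc)
    finally show ?case by (simp add: Suc scale_mult_right mult.assoc)
  qed simp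
  have left: "x j * prod_list (map (\<lambda>i. x i ^ r i) [1..<m]) =
      scale (inverse c ^ (\<Sum>i\<in>{1..<m}. r i)) (prod_list (map (\<lambda>i. x i ^ r i) [1..<m]) * x j)"
    if "1 \<le> m" "m \<le> j" for m
    using that
  proof (induction m rule: dec_induct)
    case (step m)
    let ?p = "prod_list (map (\<lambda>i. x i ^ r i) [1..<m])"
    have "x j * (?p * x m ^ r m) = (x j * ?p) * x m ^ r m" by (simp add: mult.assoc)
    also have "\<dots> = scale (inverse c ^ (\<Sum>i\<in>{1..<m}. r i)) (?p * (x j * x m ^ r m))"
      using step by (simp add: scale_mult_left mult.assoc)
    also have "x j * x m ^ r m = scale (inverse c ^ r m) (x m ^ r m * x j)"
      using step by (intro comm_pow) auto
    finally show ?case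
      using step by (simp add: scale_mult_right mult.assoc power_add)
  qed simp
  have split: "[1..<Suc n] = [1..<j] @ j # [Suc j..<Suc n]"
    using j upt_add_eq_append[of 1 j "Suc n - j"] by (simp add: upt_conv_Cons)
  have upd: "map (\<lambda>i. x i ^ (r(j := Suc (r j))) i) [1..<j] = map (\<lambda>i. x i ^ r i) [1..<j]"
    "map (\<lambda>i. x i ^ (r(j := Suc (r j))) i) [Suc j..<Suc n] = map (\<lambda>i. x i ^ r i) [Suc j..<Suc n]"
    by (auto simp del: upt_Suc)
  have eq1: "ordered_monomial n x (r(j := Suc (r j))) = prod_list (map (\<lambda>i. x i ^ r i) [1..<j]) * (x j ^ Suc (r j)
      * prod_list (map (\<lambda>i. x i ^ r i) [Suc j..<Suc n]))"
    unfolding ordered_monomial_def split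
    by (simp only: map_append list.map upd prod_list.append prod_list.Cons fun_upd_same)
  have eq2: "x j * ordered_monomial n x r = (x j * prod_list (map (\<lambda>i. x i ^ r i) [1..<j])) * (x j ^ r j
      * prod_list (map (\<lambda>i. x i ^ r i) [Suc j..<Suc n]))"
    unfolding ordered_monomial_def split by (simp add: mult.assoc)
  have "1 \<le> j" using j by simp
  from left[OF this order_refl] show ?thesis
    unfolding eq1 eq2 by (simp only: scale_mult_left mult.assoc power_Suc)
qed

end

text \<open>The coefficients \<open>d\<close> are arbitrary so that exchanging \<open>z\<close> with \<open>w\<close> and \<open>q\<close> with \<open>1/q\<close> gives
  another instance, whose derivatives \<open>partial\<close> are the given \<open>partial_bar\<close>.\<close>

locale q_pair = complex_algebra scale
  for scale :: "complex \<Rightarrow> 'a::ring_1 \<Rightarrow> 'a" +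
  fixes n :: nat and q :: complex and z w :: "nat \<Rightarrow> 'a" and d :: "nat \<Rightarrow> nat \<Rightarrow> complex"
  assumes q: "q \<noteq> 0" "q\<^sup>2 \<noteq> 1"
    and zz: "i \<in> {1..n} \<Longrightarrow> j \<in> {1..n} \<Longrightarrow> i < j \<Longrightarrow> z i * z j = scale q (z j * z i)"
    and ww: "i \<in> {1..n} \<Longrightarrow> j \<in> {1..n} \<Longrightarrow> i < j \<Longrightarrow> w i * w j = scale (inverse q) (w j * w i)"
    and wz: "i \<in> {1..n} \<Longrightarrow> j \<in> {1..n} \<Longrightarrow> i \<noteq> j \<Longrightarrow> w j * z i = scale q (z i * w j)"
    and diag: "k \<in> {1..n} \<Longrightarrow> w k * z k = z k * w k + (\<Sum>s\<in>{1..<k}. scale (d k s) (z s * w s))"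
    and generated: "subspace S \<Longrightarrow> 1 \<in> S \<Longrightarrow>
      (\<And>j a. j \<in> {1..n} \<Longrightarrow> a \<in> S \<Longrightarrow> z j * a \<in> S) \<Longrightarrow>
      (\<And>j a. j \<in> {1..n} \<Longrightarrow> a \<in> S \<Longrightarrow> w j * a \<in> S) \<Longrightarrow> a \<in> S"
    and inj_monomial: "inj_on (\<lambda>(r, s). ordered_monomial n z r * ordered_monomial n w s)
      {(r, s). \<forall>i. i \<notin> {1..n} \<longrightarrow> r i = 0 \<and> s i = 0}"
    and independent_monomial: "independent ((\<lambda>(r, s). ordered_monomial n z r * ordered_monomial n w s) `
      {(r, s). \<forall>i. i \<notin> {1..n} \<longrightarrow> r i = 0 \<and> s i = 0})"
begin

section \<open>The monomial basis and the bigrading\<close>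

definition mon :: "(nat \<Rightarrow> nat) \<Rightarrow> (nat \<Rightarrow> nat) \<Rightarrow> 'a" where
  "mon r s = ordered_monomial n z r * ordered_monomial n w s"

abbreviation "h \<equiv> q - inverse q"

lemma h: "h \<noteq> 0"
  using q by (auto simp: field_simps power2_eq_square)

lemma z_mon: "j \<in> {1..n} \<Longrightarrow>
    z j * mon r s = scale (inverse q ^ (\<Sum>i\<in>{1..<j}. r i)) (mon (r(j := Suc (r j))) s)"
  using ordered_monomial_mult[of n z q j r, OF zz q(1)]
  by (simp add: mon_def mult.assoc[symmetric] scale_mult_left)

lemma w_monomial: "j \<in> {1..n} \<Longrightarrow> w j * ordered_monomial n w s =
    scale (q ^ (\<Sum>i\<in>{1..<j}. s i)) (ordered_monomial n w (s(j := Suc (s j))))"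
  using ordered_monomial_mult[of n w "inverse q", OF ww] q by simp

lemma mon_cong: "(\<And>i. i \<in> {1..n} \<Longrightarrow> r i = r' i) \<Longrightarrow> (\<And>i. i \<in> {1..n} \<Longrightarrow> s i = s' i) \<Longrightarrow> mon r s = mon r' s'"
  unfolding mon_def using ordered_monomial_cong[of n r r' z] ordered_monomial_cong[of n s s' w] by simp

definition hom :: "nat \<Rightarrow> nat \<Rightarrow> 'a set" where
  "hom a b = span {mon r s | r s. (\<Sum>i\<in>{1..n}. r i) = a \<and> (\<Sum>i\<in>{1..n}. s i) = b}"

lemma subspace_hom: "subspace (hom a b)"
  by (simp add: hom_def)

lemma mon_hom: "mon r s \<in> hom (\<Sum>i\<in>{1..n}. r i) (\<Sum>i\<in>{1..n}. s i)"
  unfolding hom_def by (intro span_base) auto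

lemma hom_map:
  assumes "x \<in> hom a b" "lin F" "subspace S"
    and "\<And>r s. (\<Sum>i\<in>{1..n}. r i) = a \<Longrightarrow> (\<Sum>i\<in>{1..n}. s i) = b \<Longrightarrow> F (mon r s) \<in> S"
  shows "F x \<in> S"
  by (rule span_map[OF assms(1)[unfolded hom_def] assms(2)]) (use assms in auto)

lemma hom_eq:
  assumes "x \<in> hom a b" "lin F" "lin G"
    and "\<And>r s. (\<Sum>i\<in>{1..n}. r i) = a \<Longrightarrow> (\<Sum>i\<in>{1..n}. s i) = b \<Longrightarrow> F (mon r s) = G (mon r s)"
  shows "F x = G x"
  using hom_map[OF assms(1) lin_ident subspace_eq[OF assms(2,3)]] assms(4) by auto

lemma z_hom:
  assumes "j \<in> {1..n}" "x \<in> hom a b"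
  shows "z j * x \<in> hom (Suc a) b"
proof (rule hom_map[OF assms(2)])
  fix r s :: "nat \<Rightarrow> nat" assume "(\<Sum>i\<in>{1..n}. r i) = a" "(\<Sum>i\<in>{1..n}. s i) = b"
  then show "z j * mon r s \<in> hom (Suc a) b"
    using mon_hom[of "r(j := Suc (r j))" s] assms(1)
    by (simp add: z_mon subspace_scale[OF subspace_hom] sum_upd_Suc del: fun_upd_apply)
qed (auto intro: lin_intros subspace_hom)

text \<open>A factor \<open>z_i\<close> is split off and \<open>w_j\<close> is moved past it. For
  \<open>i = j\<close> this creates products \<open>z_t w_t\<close> with other indices
  \<open>t\<close>, so the induction on \<open>a\<close> keeps the index arbitrary.\<close>

lemma w_hom:
  assumes "j \<in> {1..n}" "x \<in> hom a b"
  shows "w j * x \<in> hom a (Suc b)"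
  using assms
proof (induction a arbitrary: j x)
  case 0
  show ?case
  proof (rule hom_map[OF 0(2)])
    fix r s :: "nat \<Rightarrow> nat" assume r: "(\<Sum>i\<in>{1..n}. r i) = 0" and s: "(\<Sum>i\<in>{1..n}. s i) = b"
    have "mon r s = ordered_monomial n w s" for s
      unfolding mon_def using r by (subst ordered_monomial_zero) auto
    then show "w j * mon r s \<in> hom 0 (Suc b)"
      using mon_hom[of r "s(j := Suc (s j))"] 0(1) r s
      by (simp add: w_monomial subspace_scale[OF subspace_hom] sum_upd_Suc del: fun_upd_apply)
  qed (auto intro: lin_intros subspace_hom)
next
  case (Suc a)
  show ?case
  proof (rule hom_map[OF Suc.prems(2)])
    fix r s :: "nat \<Rightarrow> nat" assume r: "(\<Sum>i\<in>{1..n}. r i) = Suc a" and s: "(\<Sum>i\<in>{1..n}. s i) = b"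
    then obtain i where i: "i \<in> {1..n}" "r i > 0"
      by (metis gr0I sum.neutral nat.distinct(1))
    define r' where "r' = r(i := r i - 1)"
    have "(\<Sum>k\<in>{1..n}. r' k) = a"
      using sum_upd_pred[of "{1..n}" r i] i r by (simp add: r'_def del: fun_upd_apply)
    then have x: "mon r' s \<in> hom a b" using mon_hom[of r' s] s by simp
    have "r'(i := Suc (r' i)) = r" using i by (auto simp: r'_def)
    \<comment> \<open>\<open>z_i\<close> need not be the first factor, so splitting it off on the
      left costs a power of \<open>q\<close>.\<close>
    then have mon: "mon r s = scale (q ^ (\<Sum>k\<in>{1..<i}. r' k)) (z i * mon r' s)"
      using z_mon[OF i(1), of r' s] q by (simp add: power_mult_distrib[symmetric])
    have "w j * (z i * mon r' s) \<in> hom (Suc a) (Suc b)"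
    proof (cases "i = j")
      case True
      have "w j * (z i * mon r' s) = z j * (w j * mon r' s)
          + (\<Sum>t\<in>{1..<j}. scale (d j t) (z t * (w t * mon r' s)))"
        using diag[OF Suc.prems(1)] True
        by (simp add: mult.assoc[symmetric] distrib_right sum_distrib_right scale_mult_left)
      moreover have "z t * (w t * mon r' s) \<in> hom (Suc a) (Suc b)" if "t \<in> {1..n}" for t
        using that x by (intro z_hom Suc.IH)
      ultimately show ?thesis
        using Suc.prems(1) by (auto intro!: subspace_add subspace_sum subspace_scale subspace_hom)
    next
      case False
      have "w j * (z i * mon r' s) = scale q (z i * (w j * mon r' s))"
        using wz[OF i(1) Suc.prems(1) False] by (simp add: mult.assoc[symmetric] scale_mult_left)
      then show ?thesis
        using i x Suc.prems(1) by (auto intro!: subspace_scale subspace_hom z_hom Suc.IH)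
    qed
    then show "w j * mon r s \<in> hom (Suc a) (Suc b)"
      by (simp add: mon scale_mult_right subspace_scale[OF subspace_hom])
  qed (auto intro: lin_intros subspace_hom)
qed

text \<open>Left multiplication by a generator takes a monomial into a single component
  \<open>hom a b\<close>, which is spanned by monomials.\<close>

lemma span_mon: "x \<in> span (range (case_prod mon))"
proof (rule generated)
  have hom_span: "hom a b \<subseteq> span (range (case_prod mon))" for a b
    unfolding hom_def by (intro span_mono) auto
  have "mon (\<lambda>_. 0) (\<lambda>_. 0) = 1"
    by (simp add: mon_def ordered_monomial_zero)
  then show "1 \<in> span (range (case_prod mon))"
    by (metis (no_types) case_prod_conv rangeI span_base)
  fix j x assume "j \<in> {1..n}" and x: "x \<in> span (range (case_prod mon))"
  then have "z j * mon r s \<in> span (range (case_prod mon))" "w j * mon r s \<in> span (range (case_prod mon))" for r s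
    using z_hom[OF _ mon_hom] w_hom[OF _ mon_hom] hom_span by blast+
  then show "z j * x \<in> span (range (case_prod mon))" "w j * x \<in> span (range (case_prod mon))"
    by - ((rule span_map[OF x lin_mult[OF lin_ident] _ subspace_span], auto)+)
qed (rule subspace_span)

lemma mon_eq:
  assumes "lin F" "lin G" "\<And>r s. F (mon r s) = G (mon r s)"
  shows "F x = G x"
proof -
  have "b \<in> {x. F x = G x}" if "b \<in> range (case_prod mon)" for b
    using that assms(3) by auto
  from span_map[OF span_mon[of x] lin_ident this subspace_eq[OF assms(1,2)]]
  show ?thesis by simp
qed

text \<open>Every monomial arises from one in the \<open>w\<close>'s alone by left multiplication
  with \<open>z\<close>'s. For the exchanged pair the induction starts at \<open>z\<close>-monomials
  and adds \<open>w\<close>'s.\<close>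

lemma zfirst_induct:
  assumes "subspace P" "\<And>s. ordered_monomial n w s \<in> P" "\<And>j x. j \<in> {1..n} \<Longrightarrow> x \<in> P \<Longrightarrow> z j * x \<in> P"
  shows "x \<in> P"
proof -
  have pow: "z j ^ m * x \<in> P" if "j \<in> {1..n}" "x \<in> P" for j m x
    using that by (induction m) (auto simp: mult.assoc intro: assms)
  have "prod_list (map (\<lambda>i. z i ^ r i) js) * x \<in> P" if "set js \<subseteq> {1..n}" "x \<in> P" for js r x
    using that by (induction js) (auto simp: mult.assoc intro: pow)
  from this[of "[1..<Suc n]" "ordered_monomial n w _"] have "mon r s \<in> P" for r s
    by (auto simp: mon_def ordered_monomial_def[of n z] assms(2)
      atLeastLessThanSuc_atLeastAtMost simp del: upt_Suc)
  then have "b \<in> P" if "b \<in> range (case_prod mon)" for b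
    using that by auto
  from span_map[OF span_mon[of x] lin_ident this assms(1)] show ?thesis by simp
qed

text \<open>The basis is indexed by exponents supported in \<open>{1..n}\<close>, while
  \<open>r\<close> and \<open>s\<close> are arbitrary functions; hence \<open>f\<close> must ignore
  the values outside. This justifies each \<open>THE\<close> that defines an operator by its values
  on monomials.\<close>

lemma linear_on_mon:
  assumes "\<And>r r' s s'. (\<And>i. i \<in> {1..n} \<Longrightarrow> r i = r' i) \<Longrightarrow> (\<And>i. i \<in> {1..n} \<Longrightarrow> s i = s' i) \<Longrightarrow> f r s = f r' s'"
  shows "\<exists>!F. lin F \<and> (\<forall>r s. F (mon r s) = f r s)"
proof (rule ex_ex1I)
  let ?I = "{(r :: nat \<Rightarrow> nat, s :: nat \<Rightarrow> nat). \<forall>i. i \<notin> {1..n} \<longrightarrow> r i = 0 \<and> s i = 0}"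
  have mon: "(\<lambda>(r, s). ordered_monomial n z r * ordered_monomial n w s) = case_prod mon"
    by (simp add: fun_eq_iff mon_def)
  interpret P: vector_space_pair scale scale ..
  define F where "F = P.construct (case_prod mon ` ?I) (\<lambda>x. case_prod f (the_inv_into ?I (case_prod mon) x))"
  have ind: "independent (case_prod mon ` ?I)" and inj: "inj_on (case_prod mon) ?I"
    using independent_monomial inj_monomial by (simp_all add: mon)
  have "F (mon r s) = f r s" for r s
  proof -
    define r' s' where "r' = (\<lambda>i. if i \<in> {1..n} then r i else 0)" and "s' = (\<lambda>i. if i \<in> {1..n} then s i else 0)"
    have I: "(r', s') \<in> ?I" by (auto simp: r'_def s'_def)
    have "mon r s = case_prod mon (r', s')"
      by (simp, intro mon_cong) (auto simp: r'_def s'_def)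
    moreover have "F (case_prod mon (r', s')) = case_prod f (r', s')"
      unfolding F_def using I by (subst P.construct_basis[OF ind]) (auto simp: the_inv_into_f_f[OF inj I, simplified])
    moreover have "f r s = f r' s'"
      by (intro assms) (auto simp: r'_def s'_def)
    ultimately show ?thesis by simp
  qed
  then show "\<exists>F. lin F \<and> (\<forall>r s. F (mon r s) = f r s)"
    unfolding F_def using P.linear_construct[OF ind] by blast
next
  fix F G assume FG: "lin F \<and> (\<forall>r s. F (mon r s) = f r s)" "lin G \<and> (\<forall>r s. G (mon r s) = f r s)"
  show "F = G"
  proof
    show "F x = G x" for x by (rule mon_eq) (use FG in auto)
  qed
qed

section \<open>Derivatives and diagonal operators\<close>

abbreviation D :: "nat \<Rightarrow> 'a \<Rightarrow> 'a" where
  "D \<equiv> partial n q scale z w"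

lemma D_lin_mon: "lin (D i) \<and> (\<forall>r s. D i (mon r s) =
    scale (q ^ (\<Sum>j\<in>{i<..n}. r j) * qnum q (r i)) (mon (r(i := r i - 1)) s))"
  if "i \<in> {1..n}"
proof -
  let ?f = "\<lambda>r s. scale (q ^ (\<Sum>j\<in>{i<..n}. r j) * qnum q (r i)) (mon (r(i := r i - 1)) s)"
  have "\<exists>!F. lin F \<and> (\<forall>r s. F (mon r s) = ?f r s)"
  proof (rule linear_on_mon)
    fix r r' s s' :: "nat \<Rightarrow> nat"
    assume r: "\<And>i. i \<in> {1..n} \<Longrightarrow> r i = r' i" "\<And>i. i \<in> {1..n} \<Longrightarrow> s i = s' i"
    have "(\<Sum>j\<in>{i<..n}. r j) = (\<Sum>j\<in>{i<..n}. r' j)" by (rule sum.cong) (simp_all add: r)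
    moreover have "r i = r' i" using that by (rule r)
    moreover have "mon (r(i := r i - 1)) s = mon (r'(i := r' i - 1)) s'"
      by (rule mon_cong) (simp_all add: r)
    ultimately show "?f r s = ?f r' s'" by simp
  qed
  from theI'[OF this] show ?thesis
    unfolding partial_def mon_def .
qed

lemma lin_D: "i \<in> {1..n} \<Longrightarrow> lin F \<Longrightarrow> lin (\<lambda>x. D i (F x))"
  using lin_comp[of "D i" F] D_lin_mon[of i] by simp

lemma D_mon: "i \<in> {1..n} \<Longrightarrow> D i (mon r s) =
    scale (q ^ (\<Sum>j\<in>{i<..n}. r j) * qnum q (r i)) (mon (r(i := r i - 1)) s)"
  using D_lin_mon by blast

text \<open>Sums over \<open>i\<close> of \<open>z\<^sub>i D\<^sub>i\<close> and \<open>D\<^sub>i z\<^sub>i\<close> telescope when expressed in the diagonal operators \<open>M i\<close>;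
  \<open>M 0\<close> and \<open>M n\<close> depend only on the degree.\<close>

definition M :: "nat \<Rightarrow> 'a \<Rightarrow> 'a" where
  "M i = (THE F. lin F \<and> (\<forall>r s. F (mon r s) =
     scale (q ^ (\<Sum>j\<in>{i<..n}. r j) * inverse q ^ (\<Sum>j\<in>{1..i}. r j)) (mon r s)))"

lemma M_lin_mon: "lin (M i) \<and> (\<forall>r s. M i (mon r s) =
     scale (q ^ (\<Sum>j\<in>{i<..n}. r j) * inverse q ^ (\<Sum>j\<in>{1..i}. r j)) (mon r s))"
  if "i \<le> n"
proof -
  let ?f = "\<lambda>r s. scale (q ^ (\<Sum>j\<in>{i<..n}. r j) * inverse q ^ (\<Sum>j\<in>{1..i}. r j)) (mon r s)"
  have "\<exists>!F. lin F \<and> (\<forall>r s. F (mon r s) = ?f r s)"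
  proof (rule linear_on_mon)
    fix r r' s s' :: "nat \<Rightarrow> nat"
    assume r: "\<And>i. i \<in> {1..n} \<Longrightarrow> r i = r' i" "\<And>i. i \<in> {1..n} \<Longrightarrow> s i = s' i"
    have "(\<Sum>j\<in>{i<..n}. r j) = (\<Sum>j\<in>{i<..n}. r' j)" by (rule sum.cong) (simp_all add: r)
    moreover have "(\<Sum>j\<in>{1..i}. r j) = (\<Sum>j\<in>{1..i}. r' j)"
      using that by (intro sum.cong refl r) auto
    moreover have "mon r s = mon r' s'"
      using r by (rule mon_cong)
    ultimately show "?f r s = ?f r' s'" by simp
  qed
  from theI'[OF this] show ?thesis
    unfolding M_def .
qed

lemma lin_M: "i \<le> n \<Longrightarrow> lin F \<Longrightarrow> lin (\<lambda>x. M i (F x))"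
  using lin_comp[of "M i" F] M_lin_mon[of i] by simp

lemma M_mon: "i \<le> n \<Longrightarrow> M i (mon r s) =
    scale (q ^ (\<Sum>j\<in>{i<..n}. r j) * inverse q ^ (\<Sum>j\<in>{1..i}. r j)) (mon r s)"
  using M_lin_mon by blast

lemma M_mon_pred:
  assumes "i \<in> {1..n}"
  shows "M (i - 1) (mon r s) =
    scale (q ^ ((\<Sum>j\<in>{i<..n}. r j) + r i) * inverse q ^ (\<Sum>j\<in>{1..<i}. r j)) (mon r s)"
proof -
  have "{i - 1<..n} = insert i {i<..n}" "{1..i - 1} = {1..<i}" using assms by auto
  moreover have "i - 1 \<le> n" "i \<notin> {i<..n}" using assms by auto
  ultimately show ?thesis
    by (simp add: M_mon add.commute del: One_nat_def)
qed

lemma M_mon_here: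
  assumes "i \<in> {1..n}"
  shows "M i (mon r s) =
    scale (q ^ (\<Sum>j\<in>{i<..n}. r j) * inverse q ^ ((\<Sum>j\<in>{1..<i}. r j) + r i)) (mon r s)"
proof -
  have "{1..i} = insert i {1..<i}" using assms by auto
  then show ?thesis using assms by (simp add: M_mon add.commute)
qed

text \<open>For \<open>i < j\<close> the additional \<open>z_j\<close> contributes a factor
  \<open>q\<close> to \<open>D_i\<close>, and lowering \<open>r_i\<close> saves a factor
  \<open>inverse q\<close> in the reordering of \<open>z_j\<close>, so the powers agree. For
  \<open>i > j\<close> neither power changes.\<close>

lemma D_z_neq:
  assumes ij: "i \<in> {1..n}" "j \<in> {1..n}" "i \<noteq> j"
  shows "D i (z j * x) = z j * D i x"
proof (rule mon_eq[of "\<lambda>x. D i (z j * x)" "\<lambda>x. z j * D i x"])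
  fix r s :: "nat \<Rightarrow> nat"
  show "D i (z j * mon r s) = z j * D i (mon r s)"
  proof (cases "r i = 0")
    \<comment> \<open>The predecessor is truncated here, but the coefficient
      \<open>qnum q 0 = 0\<close> makes both sides vanish.\<close>
    case True
    then show ?thesis
      using ij lin_map_scale[OF lin_D[OF ij(1) lin_ident]] by (simp add: z_mon D_mon qnum_def)
  next
    case False
    define r1 r2 where "r1 = r(j := Suc (r j))" and "r2 = r(i := r i - 1)"
    have upd: "r1(i := r1 i - 1) = r2(j := Suc (r2 j))" "r1 i = r i"
      using ij by (auto simp: r1_def r2_def)
    have "D i (z j * mon r s) = scale (inverse q ^ (\<Sum>k\<in>{1..<j}. r k) * q ^ (\<Sum>k\<in>{i<..n}. r1 k) * qnum q (r i))
        (mon (r1(i := r1 i - 1)) s)"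
      using ij lin_map_scale[OF lin_D[OF ij(1) lin_ident]] upd
      by (simp add: z_mon D_mon r1_def[symmetric] mult.assoc del: fun_upd_apply One_nat_def)
    moreover have "z j * D i (mon r s) = scale (q ^ (\<Sum>k\<in>{i<..n}. r k) * qnum q (r i) * inverse q ^ (\<Sum>k\<in>{1..<j}. r2 k))
        (mon (r2(j := Suc (r2 j))) s)"
      using ij by (simp add: z_mon D_mon r2_def[symmetric] scale_mult_right del: fun_upd_apply One_nat_def)
    moreover have "(\<Sum>k\<in>{i<..n}. r1 k) = (\<Sum>k\<in>{i<..n}. r k) + of_bool (i < j)"
      using ij sum_upd_Suc[of "{i<..n}" r j] by (simp add: r1_def)
    moreover have "(\<Sum>k\<in>{1..<j}. r k) = (\<Sum>k\<in>{1..<j}. r2 k) + of_bool (i < j)"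
      using ij False sum_upd_pred[of "{1..<j}" r i] by (simp add: r2_def)
    ultimately show ?thesis using q upd(1)
      by (cases "i < j") (simp_all add: field_simps)
  qed
qed (use ij in \<open>auto intro!: lin_intros lin_D\<close>)

lemma h_qnum: "h * qnum q m = q ^ m - inverse q ^ m"
  using h by (simp add: qnum_def)

text \<open>On a monomial \<open>z_i D_i\<close> is a power of \<open>q\<close> times
  \<open>[r_i]\<close>, and \<open>h [r_i] = q^(r_i) - q^(-r_i)\<close> splits this into the
  eigenvalues of \<open>M (i - 1)\<close> and \<open>M i\<close>.\<close>

lemma z_D:
  assumes "i \<in> {1..n}"
  shows "scale h (z i * D i x) = M (i - 1) x - M i x"
proof (rule mon_eq[of "\<lambda>x. scale h (z i * D i x)" "\<lambda>x. M (i - 1) x - M i x"])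
  fix r s :: "nat \<Rightarrow> nat"
  define R L where "R = (\<Sum>j\<in>{i<..n}. r j)" and "L = (\<Sum>j\<in>{1..<i}. r j)"
  have "scale h (z i * D i (mon r s)) = scale ((q ^ (R + r i) * inverse q ^ L) - q ^ R * inverse q ^ (L + r i)) (mon r s)"
  proof (cases "r i = 0")
    case True
    then show ?thesis using assms by (simp add: D_mon qnum_def)
  next
    case False
    have "h * (q ^ R * qnum q (r i) * inverse q ^ L) = q ^ R * inverse q ^ L * (h * qnum q (r i))"
      by (simp only: ac_simps)
    also have "\<dots> = (q ^ (R + r i) * inverse q ^ L) - q ^ R * inverse q ^ (L + r i)"
      unfolding h_qnum by (simp only: power_add right_diff_distrib ac_simps)
    finally have "h * (q ^ R * qnum q (r i) * inverse q ^ L) = (q ^ (R + r i) * inverse q ^ L) - q ^ R * inverse q ^ (L + r i)" .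
    moreover have "(\<Sum>j\<in>{1..<i}. (r(i := r i - 1)) j) = L"
      unfolding L_def by (intro sum.cong) auto
    ultimately show ?thesis
      using assms False by (simp add: D_mon z_mon scale_mult_right R_def[symmetric] del: fun_upd_apply) simp
  qed
  then show "scale h (z i * D i (mon r s)) = M (i - 1) (mon r s) - M i (mon r s)"
    using assms by (simp only: M_mon_pred M_mon_here R_def L_def scale_left_diff_distrib)
qed (use assms in \<open>auto intro!: lin_intros lin_D lin_M\<close>)

text \<open>In this order the q-number is \<open>[r_i + 1]\<close>, which accounts for the factors
  \<open>q\<close> and \<open>inverse q\<close>.\<close>

lemma D_z:
  assumes "i \<in> {1..n}"
  shows "scale h (D i (z i * x)) = scale q (M (i - 1) x) - scale (inverse q) (M i x)"
proof (rule mon_eq[of "\<lambda>x. scale h (D i (z i * x))" "\<lambda>x. scale q (M (i - 1) x) - scale (inverse q) (M i x)"])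
  fix r s :: "nat \<Rightarrow> nat"
  define R L where "R = (\<Sum>j\<in>{i<..n}. r j)" and "L = (\<Sum>j\<in>{1..<i}. r j)"
  have "(\<Sum>j\<in>{i<..n}. (r(i := Suc (r i))) j) = R"
    unfolding R_def by (intro sum.cong) auto
  then have "scale h (D i (z i * mon r s)) = scale (h * (inverse q ^ L * (q ^ R * qnum q (Suc (r i))))) (mon r s)"
    using assms lin_map_scale[OF lin_D[OF assms lin_ident]]
    by (simp add: D_mon z_mon L_def)
  also have "h * (inverse q ^ L * (q ^ R * qnum q (Suc (r i)))) = q ^ R * inverse q ^ L * (h * qnum q (Suc (r i)))"
    by (simp only: ac_simps)
  also have "\<dots> = q * (q ^ (R + r i) * inverse q ^ L) - inverse q * (q ^ R * inverse q ^ (L + r i))"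
    unfolding h_qnum by (simp only: power_add power_Suc right_diff_distrib ac_simps)
  finally show "scale h (D i (z i * mon r s)) = scale q (M (i - 1) (mon r s)) - scale (inverse q) (M i (mon r s))"
    using assms by (simp add: M_mon_pred M_mon_here R_def L_def scale_left_diff_distrib del: One_nat_def)
qed (use assms in \<open>auto intro!: lin_intros lin_D lin_M\<close>)

lemma M_0_hom: "x \<in> hom a b \<Longrightarrow> M 0 x = scale (q ^ a) x"
proof (erule hom_eq)
  fix r s :: "nat \<Rightarrow> nat" assume "(\<Sum>i\<in>{1..n}. r i) = a"
  moreover have "{0<..n} = {1..n}" by auto
  ultimately show "M 0 (mon r s) = scale (q ^ a) (mon r s)" by (simp add: M_mon)
qed (auto intro!: lin_intros lin_M)

lemma M_n_hom: "x \<in> hom a b \<Longrightarrow> M n x = scale (inverse q ^ a) x"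
  by (erule hom_eq) (auto intro!: lin_intros lin_M simp: M_mon)

lemma monomial_w_eq_mon: "ordered_monomial n w s = mon (\<lambda>_. 0) s"
  by (simp add: mon_def ordered_monomial_zero)

lemma D_monomial_w: "i \<in> {1..n} \<Longrightarrow> D i (ordered_monomial n w s) = 0"
  by (simp add: monomial_w_eq_mon D_mon qnum_def)

lemma M_monomial_w: "i \<le> n \<Longrightarrow> M i (ordered_monomial n w s) = ordered_monomial n w s"
  by (simp add: monomial_w_eq_mon M_mon)

lemma D_hom_0: "i \<in> {1..n} \<Longrightarrow> x \<in> hom 0 b \<Longrightarrow> D i x = 0"
  by (rule hom_eq[where G = "\<lambda>_. 0"]) (auto intro!: lin_intros lin_D simp: D_mon qnum_def)

lemma D_hom_Suc:
  assumes "i \<in> {1..n}" "x \<in> hom (Suc a) b"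
  shows "D i x \<in> hom a b"
proof (rule hom_map[OF assms(2)])
  fix r s :: "nat \<Rightarrow> nat" assume "(\<Sum>i\<in>{1..n}. r i) = Suc a" "(\<Sum>i\<in>{1..n}. s i) = b"
  then have "mon (r(i := r i - 1)) s \<in> hom a b" if "r i \<noteq> 0"
    using mon_hom[of "r(i := r i - 1)" s] sum_upd_pred[of "{1..n}" r i] that assms(1)
    by (simp del: fun_upd_apply)
  then show "D i (mon r s) \<in> hom a b"
    using assms(1) subspace_hom[of a b]
    by (cases "r i = 0") (auto simp: D_mon qnum_def subspace_0 subspace_scale simp del: fun_upd_apply)
qed (auto intro!: lin_D lin_intros subspace_hom assms)

end

context q_pair
begin

lemma w_monomial_hom:
  assumes "y \<in> hom a b"
  shows "ordered_monomial n w s * y \<in> hom a (b + (\<Sum>i\<in>{1..n}. s i))"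
proof -
  have pow: "w j ^ m * y \<in> hom a (b + m)" if "j \<in> {1..n}" "y \<in> hom a b" for j m b y
    using that by (induction m) (auto simp: mult.assoc intro: w_hom)
  have "prod_list (map (\<lambda>i. w i ^ s i) js) * y \<in> hom a (b + sum_list (map s js))" if "set js \<subseteq> {1..n}" for js
    using that
  proof (induction js)
    case (Cons j js)
    then have "w j ^ s j * (prod_list (map (\<lambda>i. w i ^ s i) js) * y) \<in> hom a (b + sum_list (map s js) + s j)"
      by (intro pow) auto
    then show ?case by (simp add: mult.assoc ac_simps)
  qed (use assms in simp)
  from this[of "[1..<Suc n]"] show ?thesis
    by (auto simp: ordered_monomial_def atLeastLessThanSuc_atLeastAtMost sum_list_distinct_conv_sum_set simp del: upt_Suc)
qed

lemma hom_cover: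
  assumes "lin F" "lin G" "\<And>a b x. x \<in> hom a b \<Longrightarrow> F x = G x"
  shows "F x = G x"
  by (rule mon_eq[of F G]) (use assms mon_hom in blast)+

end

section \<open>The q-Laplace operator and multiplication by Q\<close>

locale q_double = complex_algebra scale +
  Z: q_pair scale n q z w "\<lambda>_ _. 1 - q\<^sup>2" +
  W: q_pair scale n "inverse q" w z d
  for scale :: "complex \<Rightarrow> 'a::ring_1 \<Rightarrow> 'a" and n q z w d
begin

abbreviation "h \<equiv> q - inverse q"
abbreviation "D \<equiv> partial n q scale z w"
abbreviation "B \<equiv> partial n (inverse q) scale w z"
abbreviation "M \<equiv> Z.M"
abbreviation "N \<equiv> W.M"

lemma q_cancel [simp]: "q * inverse q = 1" "inverse q * q = 1"
  "q * (inverse q * c) = c" "inverse q * (q * c) = c"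
  using Z.q by (auto simp: field_simps)

text \<open>A coefficient with a factor 2 is split into two equal vectors, so that each can cancel
  separately during normalisation.\<close>

lemma scale_two: "scale (2 * c) x = scale c x + scale c x"
  "scale (a * (2 * c)) x = scale (a * c) x + scale (a * c) x"
  "scale (a * (b * (2 * c))) x = scale (a * (b * c)) x + scale (a * (b * c)) x"
  "scale (a * 2) x = scale a x + scale a x"
  "scale (a * (b * 2)) x = scale (a * b) x + scale (a * b) x"
  "scale (a * (b * (c * 2))) x = scale (a * (b * c)) x + scale (a * (b * c)) x"
  by (simp_all add: scale_left_distrib[symmetric])

lemmas vec_simps = scale_two scale_left_distrib scale_left_diff_distrib scale_right_distrib
  scale_right_diff_distrib scale_mult_left scale_mult_right algebra_simps power2_eq_square

lemma scale_h_cancel: "scale h x = scale h y \<Longrightarrow> x = y"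
  using Z.h by simp

lemma lin_B: "i \<in> {1..n} \<Longrightarrow> lin F \<Longrightarrow> lin (\<lambda>x. B i (F x))"
  by (rule W.lin_D)

lemmas B_add = lin_map_add[OF lin_B[OF _ lin_ident]]
lemmas B_scale = lin_map_scale[OF lin_B[OF _ lin_ident]]
lemmas D_add = lin_map_add[OF Z.lin_D[OF _ lin_ident]]
lemmas D_scale = lin_map_scale[OF Z.lin_D[OF _ lin_ident]]
lemmas M_add = lin_map_add[OF Z.lin_M[OF _ lin_ident]]
lemmas M_diff = lin_map_diff[OF Z.lin_M[OF _ lin_ident]]
lemmas M_scale = lin_map_scale[OF Z.lin_M[OF _ lin_ident]]

text \<open>The exchanged pair has \<open>-h\<close> in place of \<open>h\<close>, which reverses
  the difference of diagonal operators.\<close>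

lemma w_B: "i \<in> {1..n} \<Longrightarrow> N i x = N (i - 1) x + scale h (w i * B i x)"
  using W.z_D[of i x] by (simp add: vec_simps)

lemma h_B_w: "i \<in> {1..n} \<Longrightarrow> scale h (B i (w i * x)) = scale q (N i x) - scale (inverse q) (N (i - 1) x)"
  using W.D_z[of i x] by (simp add: vec_simps)

lemma B_w: "i \<in> {1..n} \<Longrightarrow> B i (w i * x) = scale q (w i * B i x) + N (i - 1) x"
  by (rule scale_h_cancel) (simp only: h_B_w w_B, simp add: vec_simps)

lemma D_z: "i \<in> {1..n} \<Longrightarrow> D i (z i * x) = scale (inverse q) (z i * D i x) + M (i - 1) x"
proof (rule scale_h_cancel)
  assume i: "i \<in> {1..n}"
  have "M i x = M (i - 1) x - scale h (z i * D i x)"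
    unfolding Z.z_D[OF i] by simp
  then show "scale h (D i (z i * x)) = scale h (scale (inverse q) (z i * D i x) + M (i - 1) x)"
    unfolding Z.D_z[OF i] by (simp only:) (simp add: vec_simps)
qed

lemmas B_w_neq = W.D_z_neq
lemmas D_z_neq = Z.D_z_neq

lemma wz: "i \<in> {1..n} \<Longrightarrow> j \<in> {1..n} \<Longrightarrow> i \<noteq> j \<Longrightarrow> w j * (z i * x) = scale q (z i * (w j * x))"
  using Z.wz[of i j] by (simp add: mult.assoc[symmetric] scale_mult_left)

lemma zw: "i \<in> {1..n} \<Longrightarrow> j \<in> {1..n} \<Longrightarrow> i \<noteq> j \<Longrightarrow> z i * (w j * x) = scale (inverse q) (w j * (z i * x))"
  by (simp add: wz)

section \<open>Partial sums of Q and the two bigradings\<close>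

definition Q :: "nat \<Rightarrow> 'a" where
  "Q m = (\<Sum>s\<in>{1..m}. z s * w s)"

lemma Q_0 [simp]: "Q 0 = 0"
  by (simp add: Q_def)

lemma zw_diag: "k \<in> {1..n} \<Longrightarrow> z k * (w k * x) = Q k * x - Q (k - 1) * x"
  by (cases k) (auto simp: Q_def distrib_right mult.assoc)

text \<open>The sum in the diagonal relation is \<open>Q (k - 1)\<close>, and
  \<open>z_k w_k = Q k - Q (k - 1)\<close>. Thus both products of \<open>z_k\<close> and
  \<open>w_k\<close> are expressed by partial sums.\<close>

lemma wz_diag: "k \<in> {1..n} \<Longrightarrow> w k * (z k * x) = Q k * x - scale (q\<^sup>2) (Q (k - 1) * x)"
proof -
  assume k: "k \<in> {1..n}"
  then have "{1..<k} = {1..k - 1}" by auto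
  then have "w k * z k = z k * w k + scale (1 - q\<^sup>2) (Q (k - 1))"
    using Z.diag[OF k] by (simp add: Q_def scale_sum_right)
  then have "w k * (z k * x) = z k * (w k * x) + scale (1 - q\<^sup>2) (Q (k - 1) * x)"
    by (simp add: mult.assoc[symmetric] distrib_right scale_mult_left)
  then show ?thesis by (simp add: zw_diag[OF k] vec_simps)
qed

text \<open>A summand \<open>z_s w_s\<close> picks up \<open>q^2\<close> if \<open>s < j\<close> and
  nothing if \<open>s > j\<close>. At \<open>s = j\<close> the term \<open>- q^2 Q (j - 1)\<close>
  in \<open>w_j z_j\<close> cancels what was accumulated. In particular \<open>Q n\<close> commutes
  with every \<open>z_j\<close>.\<close>

lemma Q_z:
  assumes "j \<in> {1..n}" "m \<le> n"
  shows "Q m * (z j * x) = (if j \<le> m then z j * (Q m * x) else scale (q\<^sup>2) (z j * (Q m * x)))"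
  using assms(2)
proof (induction m arbitrary: x)
  case (Suc m)
  let ?k = "Suc m"
  have k: "?k \<in> {1..n}" using Suc by simp
  have step: "Q ?k * y = Q m * y + z ?k * (w ?k * y)" for y
    using zw_diag[OF k, of y] by simp
  consider "?k < j" | "?k = j" | "j < ?k" by linarith
  then show ?case
  proof cases
    case 1
    have "z ?k * (z j * y) = scale q (z j * (z ?k * y))" for y
      using Z.zz[OF k assms(1) 1] by (simp add: mult.assoc[symmetric] scale_mult_left)
    then show ?thesis
      using 1 k assms(1) Suc by (simp add: step wz vec_simps)
  next
    case 2
    have "Q ?k * (z j * x) = Q m * (z j * x) + z j * (w j * (z j * x))"
      using step[of "z j * x"] unfolding 2 .
    also have "\<dots> = z j * (Q ?k * x)"
    proof -
      have "w j * (z j * x) = Q j * x - scale (q\<^sup>2) (Q m * x)"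
        using wz_diag[OF k, of x] unfolding 2[symmetric] by simp
      moreover have "Q m * (z j * x) = scale (q\<^sup>2) (z j * (Q m * x))"
        using Suc 2 by simp
      ultimately show ?thesis unfolding 2 by (simp only:) (simp add: vec_simps)
    qed
    finally show ?thesis using 2 by simp
  next
    case 3
    have "z ?k * (z j * y) = scale (inverse q) (z j * (z ?k * y))" for y
      using Z.zz[OF assms(1) k 3] Z.q by (simp add: mult.assoc[symmetric] scale_mult_left)
    then show ?thesis
      using 3 k assms(1) Suc by (simp add: step wz vec_simps)
  qed
qed simp

text \<open>The \<open>w\<close>-part of a monomial has bidegree \<open>(b, 0)\<close> in the
  exchanged pair, and left multiplication by \<open>z\<close>'s adds the second degree
  there.\<close>

lemma hom_swap: "Z.hom a b \<subseteq> W.hom b a"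
proof
  fix x assume "x \<in> Z.hom a b"
  then show "x \<in> W.hom b a"
  proof (rule Z.hom_map[OF _ lin_ident W.subspace_hom])
    fix r s :: "nat \<Rightarrow> nat" assume *: "(\<Sum>i\<in>{1..n}. r i) = a" "(\<Sum>i\<in>{1..n}. s i) = b"
    have "ordered_monomial n w s \<in> W.hom b 0"
      using W.mon_hom[of s "\<lambda>_. 0"] * by (simp add: W.mon_def ordered_monomial_zero)
    from W.w_monomial_hom[OF this, of r] show "Z.mon r s \<in> W.hom b a"
      using * by (simp add: Z.mon_def)
  qed
qed

lemma N_hom:
  assumes "x \<in> Z.hom a b"
  shows "N 0 x = scale (inverse q ^ b) x" "N n x = scale (q ^ b) x"
  using W.M_0_hom[of x b a] W.M_n_hom[of x b a] hom_swap assms by auto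

lemma M_hom:
  assumes "x \<in> Z.hom a b"
  shows "M 0 x = scale (q ^ a) x" "M n x = scale (inverse q ^ a) x"
  using Z.M_0_hom[of x] Z.M_n_hom[of x] assms by auto

lemma N_0_z: "j \<in> {1..n} \<Longrightarrow> N 0 (z j * x) = z j * N 0 x"
  by (rule Z.hom_cover[of "\<lambda>x. N 0 (z j * x)" "\<lambda>x. z j * N 0 x"])
    (auto intro!: lin_intros W.lin_M simp: N_hom N_hom[OF Z.z_hom] scale_mult_right)

lemma N_n_z: "j \<in> {1..n} \<Longrightarrow> N n (z j * x) = z j * N n x"
  by (rule Z.hom_cover[of "\<lambda>x. N n (z j * x)" "\<lambda>x. z j * N n x"])
    (auto intro!: lin_intros W.lin_M simp: N_hom N_hom[OF Z.z_hom] scale_mult_right)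

lemma M_0_z: "j \<in> {1..n} \<Longrightarrow> M 0 (z j * x) = scale q (z j * M 0 x)"
  by (rule Z.hom_cover[of "\<lambda>x. M 0 (z j * x)" "\<lambda>x. scale q (z j * M 0 x)"])
    (auto intro!: lin_intros Z.lin_M simp: M_hom M_hom[OF Z.z_hom] scale_mult_right)

lemma M_n_z: "j \<in> {1..n} \<Longrightarrow> M n (z j * x) = scale (inverse q) (z j * M n x)"
  by (rule Z.hom_cover[of "\<lambda>x. M n (z j * x)" "\<lambda>x. scale (inverse q) (z j * M n x)"])
    (auto intro!: lin_intros Z.lin_M simp: M_hom M_hom[OF Z.z_hom] scale_mult_right)

lemma Q_hom: "x \<in> Z.hom a b \<Longrightarrow> Q n * x \<in> Z.hom (Suc a) (Suc b)"
  by (auto simp: Q_def sum_distrib_right mult.assoc intro!: subspace_sum Z.subspace_hom Z.z_hom Z.w_hom)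

lemma M_0_Q: "M 0 (Q n * x) = scale q (Q n * M 0 x)"
  by (rule Z.hom_cover[of "\<lambda>x. M 0 (Q n * x)" "\<lambda>x. scale q (Q n * M 0 x)"])
    (auto intro!: lin_intros Z.lin_M simp: M_hom M_hom[OF Q_hom] scale_mult_right)

section \<open>The derivatives B under left multiplication by z\<close>

text \<open>It is a predicate in \<open>x\<close> because the rule is proved by induction on
  \<open>x\<close>, and the step to \<open>w k * x\<close> uses its consequences \<open>N_z\<close>
  and \<open>B_Q\<close> at the same \<open>x\<close>.\<close>

definition B_z_rule :: "'a \<Rightarrow> bool" where
  "B_z_rule x \<longleftrightarrow> (\<forall>i\<in>{1..n}. \<forall>j\<in>{1..n}. B i (z j * x) =
     (if i = j then z j * B j x
      else if i < j then scale (inverse q) (z j * B i x) + scale (h * inverse q * q ^ (2 * (j - i))) (z i * B j x)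
      else scale (inverse q) (z j * B i x)))"

text \<open>\<open>N i\<close> arises from \<open>N (i - 1)\<close> by adding
  \<open>h w_i B_i\<close>, so the rule for the \<open>B\<close>'s determines it. The surplus
  disappears at \<open>i = j\<close>, where it cancels against the exchange of \<open>w_j\<close>
  and \<open>z_j\<close>.\<close>

lemma N_z:
  assumes x: "B_z_rule x" and j: "j \<in> {1..n}" and i: "i \<le> n"
  shows "N i (z j * x) = z j * N i x +
    (if i < j then scale (h * h * inverse q * q ^ (2 * (j - i))) (Q i * B j x) else 0)"
  using i
proof (induction i)
  case 0
  then show ?case using j by (simp add: N_0_z)
next
  case (Suc i)
  let ?k = "Suc i"
  have k: "?k \<in> {1..n}" using Suc by simp
  have Nk: "N ?k y = N i y + scale h (w ?k * B ?k y)" for y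
    using w_B[OF k, of y] by simp
  consider "?k < j" | "?k = j" | "j < ?k" by linarith
  then show ?case
  proof cases
    case 1
    define e where "e = q ^ (2 * (j - ?k))"
    have "2 * (j - i) = Suc (Suc (2 * (j - ?k)))" using 1 by simp
    then have pow: "q ^ (2 * (j - i)) = q * (q * e)" by (simp add: e_def)
    have Bk: "B ?k (z j * x) = scale (inverse q) (z j * B ?k x) + scale (h * inverse q * e) (z ?k * B j x)"
      using x k j 1 unfolding B_z_rule_def e_def by auto
    have Ni: "N i (z j * x) = z j * N i x + scale (h * h * inverse q * (q * (q * e))) (Q i * B j x)"
      using 1 Suc by (simp add: pow)
    have "N ?k (z j * x) = z j * N ?k x + scale (h * h * inverse q * e) (Q ?k * B j x)"
      unfolding Nk Ni Bk using 1
      by (simp add: wz[OF j k] wz_diag[OF k, unfolded diff_Suc_1] vec_simps)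
    then show ?thesis using 1 by (simp only: e_def if_True)
  next
    case 2
    have Bk: "B ?k (z j * x) = z j * B j x"
      using x k j 2 unfolding B_z_rule_def by auto
    have Ni: "N i (z j * x) = z j * N i x + scale (h * h * inverse q * (q * q)) (Q i * B j x)"
      using 2 Suc by (auto simp: power2_eq_square)
    have "N ?k (z j * x) = z j * N ?k x"
      unfolding Nk Ni Bk unfolding 2[symmetric]
      by (simp add: wz_diag[OF k, unfolded diff_Suc_1] zw_diag[OF k, unfolded diff_Suc_1] vec_simps)
    then show ?thesis using 2 by simp
  next
    case 3
    have Bk: "B ?k (z j * x) = scale (inverse q) (z j * B ?k x)"
      using x k j 3 unfolding B_z_rule_def by auto
    have Ni: "N i (z j * x) = z j * N i x"
      using 3 Suc by simp
    show ?thesis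
      using 3 unfolding Nk Ni Bk by (simp add: wz[OF j k] vec_simps)
  qed
qed

text \<open>The recursion \<open>Q k = q^2 Q (k - 1) + w_k z_k\<close> puts \<open>w_k\<close> on
  the left, where the action of \<open>B_i\<close> is known; the rule at \<open>x\<close> then
  handles \<open>z_k\<close>.\<close>

lemma B_Q:
  assumes x: "B_z_rule x" and i: "i \<in> {1..n}" and m: "m \<le> n"
  shows "B i (Q m * x) = scale (inverse q) (Q m * B i x) +
    (if i \<le> m then scale (q ^ (2 * (m - i))) (z i * N m x) else 0)"
  using m
proof (induction m)
  case 0
  then show ?case using i lin_map_zero[OF lin_B[OF i lin_ident]] by simp
next
  case (Suc m)
  let ?k = "Suc m"
  have k: "?k \<in> {1..n}" using Suc by simp
  have Nk: "N ?k y = N m y + scale h (w ?k * B ?k y)" for y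
    using w_B[OF k, of y] by simp
  have Qk: "Q ?k * y = scale (q\<^sup>2) (Q m * y) + w ?k * (z ?k * y)" for y
    using wz_diag[OF k, of y] by simp
  have Qk': "Q ?k * y = Q m * y + z ?k * (w ?k * y)" for y
    using zw_diag[OF k, of y] by simp
  have Bk: "B i (Q ?k * x) = scale (q\<^sup>2) (B i (Q m * x)) + B i (w ?k * (z ?k * x))"
    unfolding Qk using i by (simp add: B_add B_scale)
  consider "?k < i" | "?k = i" | "i < ?k" by linarith
  then show ?case
  proof cases
    case 1
    have "B i (z ?k * x) = scale (inverse q) (z ?k * B i x)"
      using x k i 1 unfolding B_z_rule_def by auto
    then show ?thesis
      using 1 Suc B_w_neq[OF i k, of "z ?k * x"] unfolding Bk by (simp add: Qk vec_simps)
  next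
    case 2
    have Bz: "B ?k (z ?k * x) = z ?k * B ?k x"
      using x k unfolding B_z_rule_def by auto
    \<comment> \<open>For \<open>i = ?k\<close> the rule \<open>B_w\<close> brings in
      \<open>N m\<close>; its surplus has exponent 2 because \<open>m\<close> is one less than
      \<open>?k\<close>.\<close>
    have Nz: "N m (z ?k * x) = z ?k * N m x + scale (h * h * inverse q * (q * q)) (Q m * B ?k x)"
      using N_z[OF x k, of m] k by (simp add: power2_eq_square)
    have IH: "B ?k (Q m * x) = scale (inverse q) (Q m * B ?k x)"
      using 2 Suc by simp
    have "B ?k (Q ?k * x) = scale (q\<^sup>2) (B ?k (Q m * x)) + (scale q (w ?k * (z ?k * B ?k x)) + N m (z ?k * x))"
      using Bk B_w[OF k, of "z ?k * x"] Bz unfolding 2[symmetric] by simp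
    also have "\<dots> = scale (inverse q) (Q ?k * B ?k x) + z ?k * N ?k x"
      unfolding IH Nz Nk
      by (simp add: wz_diag[OF k, unfolded diff_Suc_1] zw_diag[OF k, unfolded diff_Suc_1] vec_simps)
    finally show ?thesis using 2 by simp
  next
    case 3
    define e where "e = q ^ (2 * (m - i))"
    have "2 * (?k - i) = Suc (Suc (2 * (m - i)))" using 3 by simp
    then have pow: "q ^ (2 * (?k - i)) = q * (q * e)" by (simp add: e_def)
    have Bz: "B i (z ?k * x) = scale (inverse q) (z ?k * B i x) + scale (h * inverse q * (q * (q * e))) (z i * B ?k x)"
      using x k i 3 unfolding B_z_rule_def pow[symmetric] by auto
    have IH: "B i (Q m * x) = scale (inverse q) (Q m * B i x) + scale e (z i * N m x)"
      using 3 Suc by (simp add: e_def)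
    have ne: "i \<noteq> ?k" using 3 by simp
    have "B i (Q ?k * x) = scale (inverse q) (Q ?k * B i x) + scale (q * (q * e)) (z i * N ?k x)"
      unfolding Bk unfolding B_w_neq[OF i k ne] IH Bz Nk Qk by (simp add: wz[OF i k ne] vec_simps)
    then show ?thesis using 3 by (simp only: pow) simp
  qed
qed

text \<open>\<open>w_k\<close> is moved in front of \<open>z_j\<close>, so that \<open>B_i\<close>
  meets it first. For \<open>k = j\<close> this adds a multiple of \<open>Q (j - 1)\<close>, treated
  by \<open>B_Q\<close>; for \<open>k = i\<close> the derivative produces \<open>N (i - 1)\<close>,
  treated by \<open>N_z\<close>.\<close>

lemma B_z_rule_w:
  assumes x: "B_z_rule x" and k: "k \<in> {1..n}"
  shows "B_z_rule (w k * x)"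
  unfolding B_z_rule_def
proof (intro ballI)
  fix i j assume i: "i \<in> {1..n}" and j: "j \<in> {1..n}"
  have rule: "B i (z j * x) =
     (if i = j then z j * B j x
      else if i < j then scale (inverse q) (z j * B i x) + scale (h * inverse q * q ^ (2 * (j - i))) (z i * B j x)
      else scale (inverse q) (z j * B i x))"
    using x i j unfolding B_z_rule_def by blast
  show "B i (z j * (w k * x)) =
     (if i = j then z j * B j (w k * x)
      else if i < j then scale (inverse q) (z j * B i (w k * x)) + scale (h * inverse q * q ^ (2 * (j - i))) (z i * B j (w k * x))
      else scale (inverse q) (z j * B i (w k * x)))" (is "?lhs = ?rhs")
  proof (cases "k = j")
    case kj: False
    have lhs: "?lhs = scale (inverse q) (B i (w k * (z j * x)))"
      using zw[OF j k] kj i by (simp add: B_scale)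
    have Bj: "B j (w k * x) = w k * B j x"
      using B_w_neq[OF j k] kj by simp
    have wzj: "w k * (z j * y) = scale q (z j * (w k * y))" for y
      using wz[OF j k] kj by simp
    show ?thesis
    proof (cases "k = i")
      case ki: False
      have Bi: "B i (w k * y) = w k * B i y" for y
        using B_w_neq[OF i k] ki by simp
      have wzi: "w k * (z i * y) = scale q (z i * (w k * y))" for y
        using wz[OF i k] ki by simp
      show ?thesis
        unfolding lhs Bi Bj rule by (simp add: wzi wzj vec_simps)
    next
      case ki: True
      have Bi: "B i (w k * y) = scale q (w k * B i y) + N (i - 1) y" for y
        using B_w[OF i] ki by simp
      have i1: "i - 1 \<le> n" using i by auto
      show ?thesis
      proof (cases "i < j")
        case True
        define e where "e = q ^ (2 * (j - i))"
        have exp: "2 * (j - (i - 1)) = Suc (Suc (2 * (j - i)))" using i True by auto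
        have pow: "q ^ (2 * (j - (i - 1))) = q * (q * e)"
          unfolding exp e_def by simp
        have "i - 1 < j" using True by simp
        then have Nz: "N (i - 1) (z j * x) = z j * N (i - 1) x + scale (h * h * inverse q * (q * (q * e))) (Q (i - 1) * B j x)"
          using N_z[OF x j i1] unfolding pow by simp
        have ij: "i \<noteq> j" using True by simp
        show ?thesis
          unfolding lhs Bi Bj rule Nz e_def[symmetric] if_P[OF True] if_not_P[OF ij]
          unfolding ki by (simp add: wzj[unfolded ki] vec_simps wz_diag[OF i] zw_diag[OF i] del: One_nat_def)
      next
        case False
        have ij: "i \<noteq> j" using ki kj by simp
        with False have "\<not> i - 1 < j" by simp
        then have Nz: "N (i - 1) (z j * x) = z j * N (i - 1) x"
          using N_z[OF x j i1] by simp
        show ?thesis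
          unfolding lhs Bi Bj rule Nz if_not_P[OF False] if_not_P[OF ij]
          by (simp add: wzj vec_simps del: One_nat_def)
      qed
    qed
  next
    case kj: True
    have "z j * (w j * x) = w j * (z j * x) + scale (q\<^sup>2 - 1) (Q (j - 1) * x)"
      unfolding wz_diag[OF j] zw_diag[OF j] by (simp add: vec_simps)
    then have lhs: "?lhs = B i (w j * (z j * x)) + scale (q\<^sup>2 - 1) (B i (Q (j - 1) * x))"
      using i kj by (simp add: B_add B_scale)
    have jn: "j - 1 \<le> n" using j by auto
    consider "i < j" | "i = j" | "j < i" by linarith
    then show ?thesis
    proof cases
      case 1
      define e where "e = q ^ (2 * (j - 1 - i))"
      have exp: "2 * (j - i) = Suc (Suc (2 * (j - 1 - i)))" using 1 by auto
      have pow: "q ^ (2 * (j - i)) = q * (q * e)"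
        unfolding exp e_def by simp
      have ij: "i \<noteq> j" "i \<le> j - 1" using 1 by auto
      show ?thesis
        unfolding lhs unfolding kj B_Q[OF x i jn] B_w_neq[OF i j ij(1)] B_w[OF j] rule e_def[symmetric] pow
          if_P[OF 1] if_not_P[OF ij(1)] if_P[OF ij(2)]
        by (simp add: wz[OF i j ij(1)] wz_diag[OF j] zw_diag[OF j] vec_simps del: One_nat_def)
    next
      case 2
      have Nz: "N (j - 1) (z j * x) = z j * N (j - 1) x + scale (h * h * inverse q * (q * q)) (Q (j - 1) * B j x)"
        using N_z[OF x j jn] j by (simp add: power2_eq_square)
      have BQ: "B j (Q (j - 1) * x) = scale (inverse q) (Q (j - 1) * B j x)"
        using B_Q[OF x j jn] j by auto
      have Bz: "B j (z j * x) = z j * B j x"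
        using rule 2 by simp
      show ?thesis
        unfolding lhs unfolding 2 kj BQ B_w[OF j] Bz Nz if_P[OF refl]
        by (simp add: wz_diag[OF j] zw_diag[OF j] vec_simps del: One_nat_def)
    next
      case 3
      then have ij: "i \<noteq> j" "\<not> i \<le> j - 1" "\<not> i < j" by auto
      show ?thesis
        unfolding lhs unfolding kj B_Q[OF x i jn] B_w_neq[OF i j ij(1)] rule
          if_not_P[OF ij(1)] if_not_P[OF ij(2)] if_not_P[OF ij(3)]
        by (simp add: wz_diag[OF j] zw_diag[OF j] vec_simps del: One_nat_def)
    qed
  qed
qed

text \<open>The induction starts at \<open>z\<close>-monomials, which every \<open>B_i\<close>
  annihilates, and attaches \<open>w\<close>'s on the left.\<close>

lemma B_z_rule_all: "B_z_rule x"
proof -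
  have "x \<in> {x. B_z_rule x}"
  proof (rule W.zfirst_induct)
    let ?F = "\<lambda>i j x. if i = j then z j * B j x
      else if i < j then scale (inverse q) (z j * B i x) + scale (h * inverse q * q ^ (2 * (j - i))) (z i * B j x)
      else scale (inverse q) (z j * B i x)"
    \<comment> \<open>As an intersection of spaces on which two linear maps agree, the set is a
      subspace.\<close>
    have eq: "{x. B_z_rule x} = (\<Inter>i\<in>{1..n}. \<Inter>j\<in>{1..n}. {x. B i (z j * x) = ?F i j x})"
      unfolding B_z_rule_def by (simp only: set_eq_iff INT_iff mem_Collect_eq simp_thms)
    have sub: "subspace {x. B i (z j * x) = ?F i j x}" if "i \<in> {1..n}" "j \<in> {1..n}" for i j
      by (rule subspace_eq) (use that in \<open>auto intro!: lin_intros lin_B\<close>)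
    show "subspace {x. B_z_rule x}"
      unfolding eq by (intro subspace_Int sub)
  next
    fix s
    have B0: "B i (ordered_monomial n z s) = 0" if "i \<in> {1..n}" for i s
      using W.D_monomial_w[OF that] .
    have "B i (z j * ordered_monomial n z s) = 0" if "i \<in> {1..n}" "j \<in> {1..n}" for i j
      unfolding W.w_monomial[OF that(2)] B_scale[OF that(1)] B0[OF that(1)] by simp
    then show "ordered_monomial n z s \<in> {x. B_z_rule x}"
      by (simp add: B_z_rule_def B0)
  next
    fix j x assume "j \<in> {1..n}" "x \<in> {x. B_z_rule x}"
    then show "w j * x \<in> {x. B_z_rule x}"
      using B_z_rule_w by simp
  qed
  then show ?thesis by simp
qed

lemma B_z_eq: "i \<in> {1..n} \<Longrightarrow> B i (z i * x) = z i * B i x"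
  and B_z_less: "i \<in> {1..n} \<Longrightarrow> j \<in> {1..n} \<Longrightarrow> i < j \<Longrightarrow> B i (z j * x) =
    scale (inverse q) (z j * B i x) + scale (h * inverse q * q ^ (2 * (j - i))) (z i * B j x)"
  and B_z_greater: "i \<in> {1..n} \<Longrightarrow> j \<in> {1..n} \<Longrightarrow> j < i \<Longrightarrow> B i (z j * x) = scale (inverse q) (z j * B i x)"
  using B_z_rule_all[of x] unfolding B_z_rule_def by auto

section \<open>The commutator of the Laplace operator with Q\<close>

abbreviation "L \<equiv> q_laplace n q scale z w"

lemma partial_bar_eq: "partial_bar n q scale z w = B"
  by (simp add: fun_eq_iff partial_bar_def partial_def qnum_inverse)

lemma L_def: "L x = (\<Sum>i\<in>{1..n}. D i (B i x))"
  by (simp add: q_laplace_def partial_bar_eq)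

lemma lin_L: "lin F \<Longrightarrow> lin (\<lambda>x. L (F x))"
  unfolding L_def by (intro lin_sum Z.lin_D W.lin_D)

text \<open>The summands with \<open>i < j\<close> leave multiples of \<open>D_i z_i B_j\<close>,
  which are differences of diagonal operators. Together with the summand \<open>i = j\<close> they
  telescope down to \<open>M 0\<close>.\<close>

lemma L_z:
  assumes j: "j \<in> {1..n}"
  shows "L (z j * x) = scale (inverse q) (z j * L x) + scale (inverse q * inverse q * q ^ (2 * j)) (M 0 (B j x))"
proof -
  \<comment> \<open>The powers in \<open>g\<close> make the surplus \<open>e i\<close> of the
    \<open>i\<close>-th summand over \<open>inverse q * z_j D_i B_i\<close> a difference of
    consecutive values.\<close>
  define g where "g i = scale (inverse q * inverse q * q ^ (2 * (j - i))) (M i (B j x))" for i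
  define e where "e i = (if i < j then g (i - 1) - g i else if i = j then g (i - 1) else 0)" for i
  have "D i (B i (z j * x)) = scale (inverse q) (z j * D i (B i x)) + e i" if i: "i \<in> {1..n}" for i
  proof -
    consider "i < j" | "i = j" | "j < i" by linarith
    then show ?thesis
    proof cases
      case 1
      define c where "c = q ^ (2 * (j - i))"
      have exp: "2 * (j - (i - 1)) = Suc (Suc (2 * (j - i)))" using 1 i by auto
      have pow: "q ^ (2 * (j - (i - 1))) = q * (q * c)"
        unfolding exp c_def by simp
      have "D i (B i (z j * x)) = scale (inverse q) (z j * D i (B i x))
          + scale (inverse q * c) (scale h (D i (z i * B j x)))"
        unfolding B_z_less[OF i j 1] c_def[symmetric] using Z.D_z_neq[OF i j] 1 i
        by (simp add: D_add D_scale mult.commute mult.left_commute)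
      then show ?thesis
        using 1 unfolding Z.D_z[OF i] e_def g_def pow c_def[symmetric] by (simp add: vec_simps)
    next
      case 2
      have "q ^ (2 * (j - (j - 1))) = q * q" using j by (simp add: power2_eq_square)
      then have "e j = M (j - 1) (B j x)" by (simp add: e_def g_def mult.assoc)
      then show ?thesis
        unfolding 2 B_z_eq[OF j] D_z[OF j] by simp
    next
      case 3
      then show ?thesis
        unfolding B_z_greater[OF i j 3] using Z.D_z_neq[OF i j] i
        by (simp add: D_scale e_def)
    qed
  qed
  then have "L (z j * x) = scale (inverse q) (z j * L x) + sum e {1..n}"
    by (simp add: L_def sum.distrib scale_sum_right sum_distrib_left)
  moreover have "sum e {1..n} = g 0"
  proof -
    have "sum e {1..n} = sum e {1..j}"
      using j by (intro sum.mono_neutral_right) (auto simp: e_def)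
    also have "{1..j} = insert j {1..<j}" using j by auto
    also have "sum e \<dots> = g (j - 1) + (\<Sum>i\<in>{1..<j}. g (i - 1) - g i)"
      by (simp add: e_def)
    also have "(\<Sum>i\<in>{1..<j}. g (i - 1) - g i) = (\<Sum>i<j - 1. g i - g (Suc i))"
      by (rule sum.reindex_bij_witness[of _ Suc "\<lambda>i. i - 1"]) auto
    also have "\<dots> = g 0 - g (j - 1)"
      by (rule sum_lessThan_telescope')
    finally show ?thesis by simp
  qed
  ultimately show ?thesis by (simp add: g_def)
qed

lemma L_monomial_w: "L (ordered_monomial n w s) = 0"
proof -
  have "ordered_monomial n w s = W.mon s (\<lambda>_. 0)" for s
    by (simp add: W.mon_def ordered_monomial_zero)
  then have "\<exists>c s'. B i (ordered_monomial n w s) = scale c (ordered_monomial n w s')" if "i \<in> {1..n}" for i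
    using W.D_mon[OF that] by metis
  then have "D i (B i (ordered_monomial n w s)) = 0" if "i \<in> {1..n}" for i
    using that Z.D_monomial_w by (metis D_scale scale_zero_right)
  then show ?thesis by (simp add: L_def)
qed

text \<open>As \<open>M 0\<close> fixes \<open>w\<close>-monomials, \<open>L_z\<close> and
  \<open>h_B_w\<close> turn each \<open>L (z_j w_j x)\<close> into a difference in the
  \<open>N j\<close>, and the sum telescopes. This is the base case of \<open>L_Q\<close>.\<close>

lemma L_Q_monomial_w:
  "scale h (L (Q n * ordered_monomial n w s)) =
     scale (inverse q * q ^ (2 * n)) (N n (ordered_monomial n w s)) - scale (inverse q) (N 0 (ordered_monomial n w s))"
proof -
  let ?x = "ordered_monomial n w s"
  define g where "g j = scale (inverse q * q ^ (2 * j)) (N j ?x)" for j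
  have mon: "ordered_monomial n w s = W.mon s (\<lambda>_. 0)" for s
    by (simp add: W.mon_def ordered_monomial_zero)
  have M0: "M 0 (N j ?x) = N j ?x" if "j \<le> n" for j
    using W.M_mon[OF that, of s "\<lambda>_. 0"] Z.M_monomial_w[of 0 s]
    by (simp add: mon[symmetric] M_scale)
  have "scale h (L (z j * (w j * ?x))) = g j - g (j - 1)" if j: "j \<in> {1..n}" for j
  proof -
    have j1: "j - 1 \<le> n" using j by auto
    define c where "c = q ^ (2 * (j - 1))"
    have exp: "2 * j = Suc (Suc (2 * (j - 1)))" using j by auto
    have pow: "q ^ (2 * j) = q * (q * c)"
      unfolding exp c_def by simp
    have "L (w j * ?x) = 0"
      unfolding Z.w_monomial[OF j] using lin_map_scale[OF lin_L[OF lin_ident]] by (simp add: L_monomial_w)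
    then have "scale h (L (z j * (w j * ?x))) =
        scale (inverse q * inverse q * q ^ (2 * j)) (M 0 (scale h (B j (w j * ?x))))"
      unfolding L_z[OF j] by (simp add: M_scale mult.commute)
    also have "\<dots> = g j - g (j - 1)"
      using j M0[of j] M0[OF j1] unfolding h_B_w[OF j] g_def pow c_def[symmetric]
      by (simp add: M_diff M_scale vec_simps)
    finally show ?thesis .
  qed
  then have "scale h (L (Q n * ?x)) = (\<Sum>j\<in>{1..n}. g j - g (j - 1))"
    by (simp add: Q_def sum_distrib_right mult.assoc lin_map_sum[OF lin_L[OF lin_ident]] scale_sum_right)
  also have "\<dots> = (\<Sum>j<n. g (Suc j) - g j)"
    by (rule sum.reindex_bij_witness[of _ Suc "\<lambda>i. i - 1"]) auto
  also have "\<dots> = g n - g 0"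
    by (rule sum_lessThan_telescope)
  finally show ?thesis by (simp add: g_def)
qed

text \<open>With diagonal operators in place of degrees this is an identity of linear maps, so it
  can be extended from \<open>w\<close>-monomials by left multiplication with \<open>z\<close>'s.
  The step combines \<open>L_z\<close> with \<open>B_Q\<close> for the full sum
  \<open>Q n\<close>.\<close>

lemma L_Q:
  "scale h (L (Q n * x) - Q n * L x) =
     scale (inverse q * q ^ (2 * n)) (M 0 (N n x)) - scale (inverse q) (M n (N 0 x))"
    (is "?F x = ?G x")
proof -
  have "x \<in> {x. ?F x = ?G x}"
  proof (rule Z.zfirst_induct)
    show "subspace {x. ?F x = ?G x}"
      by (rule subspace_eq) (intro lin_intros lin_L Z.lin_M W.lin_M; simp)+
    fix s
    have "M i (N j (ordered_monomial n w s)) = N j (ordered_monomial n w s)" if "i \<le> n" "j \<le> n" for i j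
    proof -
      have mon: "ordered_monomial n w s = W.mon s (\<lambda>_. 0)"
        by (simp add: W.mon_def ordered_monomial_zero)
      show ?thesis
        using W.M_mon[OF that(2), of s "\<lambda>_. 0"] Z.M_monomial_w[OF that(1), of s] that
        by (simp add: mon[symmetric] M_scale)
    qed
    then show "ordered_monomial n w s \<in> {x. ?F x = ?G x}"
      using L_Q_monomial_w[of s] by (simp add: L_monomial_w)
  next
    fix j x assume j: "j \<in> {1..n}" and x: "x \<in> {x. ?F x = ?G x}"
    have Qz: "Q n * (z j * y) = z j * (Q n * y)" for y
      using Q_z[OF j order_refl] j by simp
    have exp: "2 * j + 2 * (n - j) = 2 * n" using j by auto
    have pow: "q ^ (2 * j) * q ^ (2 * (n - j)) = q ^ (2 * n)"
      unfolding power_add[symmetric] exp ..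
    have BQ: "B j (Q n * x) = scale (inverse q) (Q n * B j x) + scale (q ^ (2 * (n - j))) (z j * N n x)"
      using B_Q[OF B_z_rule_all j order_refl] j by simp
    have "L (Q n * (z j * x)) - Q n * L (z j * x) = scale (inverse q) (z j * (L (Q n * x) - Q n * L x))
        + scale (inverse q * inverse q * (q ^ (2 * j) * q ^ (2 * (n - j)))) (M 0 (z j * N n x))"
      unfolding Qz L_z[OF j] BQ
      by (simp add: M_add M_scale M_0_Q Qz vec_simps)
    also have "M 0 (z j * N n x) = scale q (z j * M 0 (N n x))"
      by (rule M_0_z[OF j])
    finally have diff: "L (Q n * (z j * x)) - Q n * L (z j * x) = scale (inverse q) (z j * (L (Q n * x) - Q n * L x))
        + scale (inverse q * inverse q * (q ^ (2 * j) * q ^ (2 * (n - j)))) (scale q (z j * M 0 (N n x)))" .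
    \<comment> \<open>Both sides obey the same recursion from \<open>x\<close> to
      \<open>z_j x\<close>; for the \<open>M 0 (N n x)\<close> term on the right this is
      \<open>inverse q * inverse q + h * inverse q = 1\<close>.\<close>
    have "?F (z j * x) = scale (inverse q) (z j * ?F x) + scale (h * inverse q * q ^ (2 * n)) (z j * M 0 (N n x))"
      unfolding diff pow by (simp add: vec_simps)
    also have "?F x = ?G x" using x by simp
    also have "scale (inverse q) (z j * ?G x) + scale (h * inverse q * q ^ (2 * n)) (z j * M 0 (N n x)) = ?G (z j * x)"
      unfolding N_n_z[OF j] N_0_z[OF j] M_0_z[OF j] M_n_z[OF j] by (simp add: vec_simps)
    finally show "z j * x \<in> {x. ?F x = ?G x}" by simp
  qed
  then show ?thesis by simp
qed

text \<open>This is \<open>q^(n-1) [n + m]\<close>; the factor \<open>inverse q * q ^ n\<close>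
  avoids a truncated exponent.\<close>

definition laplace_coeff :: "nat \<Rightarrow> complex" where
  "laplace_coeff m = inverse q * q ^ n * qnum q (n + m)"

text \<open>On bidegree \<open>(a, b)\<close> the operators \<open>M 0\<close>, \<open>N n\<close>,
  \<open>M n\<close>, \<open>N 0\<close> are multiplications by \<open>q^a\<close>,
  \<open>q^b\<close>, \<open>q^(-a)\<close>, \<open>q^(-b)\<close>, so only \<open>a + b\<close>
  enters.\<close>

lemma L_Q_hom:
  assumes "x \<in> Z.hom a b"
  shows "L (Q n * x) = Q n * L x + scale (laplace_coeff (a + b)) x"
proof -
  have "scale h (L (Q n * x) - Q n * L x) = scale (inverse q * q ^ (2 * n) * q ^ (a + b) - inverse q * inverse q ^ (a + b)) x"
    unfolding L_Q using assms
    by (simp add: N_hom M_scale M_hom scale_left_diff_distrib power_add mult.commute mult.left_commute)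
  also have "inverse q * q ^ (2 * n) * q ^ (a + b) - inverse q * inverse q ^ (a + b)
      = inverse q * q ^ n * (q ^ (n + (a + b)) - inverse q ^ (n + (a + b)))"
  proof -
    have "q ^ n * inverse q ^ n = 1" using Z.q by (simp add: power_mult_distrib[symmetric])
    then have "inverse q ^ (a + b) = q ^ n * inverse q ^ (n + (a + b))"
      by (simp add: power_add mult.assoc[symmetric])
    then show ?thesis by (simp only: right_diff_distrib power_add mult_2 mult.assoc)
  qed
  also have "\<dots> = h * laplace_coeff (a + b)"
    unfolding Z.h_qnum[symmetric] laplace_coeff_def by (simp only: ac_simps)
  finally have "scale h (L (Q n * x) - Q n * L x) = scale h (scale (laplace_coeff (a + b)) x)"
    by simp
  from scale_h_cancel[OF this] show ?thesis by (simp add: algebra_simps)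
qed

end

section \<open>Tensor products with a polynomial algebra\<close>

lemma lookup_pm_scale [simp]: "Poly_Mapping.lookup (pm_scale c t) k = c * Poly_Mapping.lookup t k"
  by (simp add: pm_scale_def Poly_Mapping.map.rep_eq when_def)

interpretation pm: vector_space pm_scale
  by standard (auto intro!: poly_mapping_eqI simp: lookup_add algebra_simps)

lemma pm_scale_single: "pm_scale c (Poly_Mapping.single k d) = Poly_Mapping.single k (c * d)"
  by (rule poly_mapping_eqI) (simp add: lookup_single when_def)

context complex_algebra
begin

section \<open>The multiplication map on formal tensors\<close>

definition tensor_mult :: "('a \<times> 'a \<Rightarrow>\<^sub>0 complex) \<Rightarrow> 'a" where
  "tensor_mult t = (\<Sum>p\<in>Poly_Mapping.keys t. scale (Poly_Mapping.lookup t p) (fst p * snd p))"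

lemma tensor_mult_superset:
  assumes "finite K" "Poly_Mapping.keys t \<subseteq> K"
  shows "tensor_mult t = (\<Sum>p\<in>K. scale (Poly_Mapping.lookup t p) (fst p * snd p))"
  unfolding tensor_mult_def using assms
  by (intro sum.mono_neutral_left) (auto simp: in_keys_iff)

lemma linear_tensor_mult: "Vector_Spaces.linear pm_scale scale tensor_mult"
proof -
  have "tensor_mult (t + t') = tensor_mult t + tensor_mult t'" for t t'
  proof -
    let ?K = "Poly_Mapping.keys t \<union> Poly_Mapping.keys t'"
    have "finite ?K" "Poly_Mapping.keys (t + t') \<subseteq> ?K"
      using keys_add[of t t'] by auto
    then show ?thesis
      by (simp add: tensor_mult_superset[of ?K] lookup_add scale_left_distrib sum.distrib)
  qed
  moreover have "tensor_mult (pm_scale c t) = scale c (tensor_mult t)" for c t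
  proof -
    have "Poly_Mapping.keys (pm_scale c t) \<subseteq> Poly_Mapping.keys t"
      by (auto simp: in_keys_iff)
    then show ?thesis
      by (simp add: tensor_mult_superset[of "Poly_Mapping.keys t"] scale_sum_right)
  qed
  ultimately show ?thesis
    by (simp add: Vector_Spaces.linear_iff vector_space_axioms pm.vector_space_axioms)
qed

sublocale tensor_mult: Vector_Spaces.linear pm_scale scale tensor_mult
  by (rule linear_tensor_mult)

lemma tensor_mult_single [simp]: "tensor_mult (Poly_Mapping.single (u, v) c) = scale c (u * v)"
  by (simp add: tensor_mult_def)

lemma tensor_mult_null: "t \<in> tensor_null scale scale U V \<Longrightarrow> tensor_mult t = 0"
  unfolding tensor_null_def
  by (erule tensor_mult.eq_0_on_span[rotated])
    (auto simp: tensor_mult.diff tensor_mult.scale scale_mult_left scale_mult_right distrib_left distrib_right)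

text \<open>The definition of \<open>polynomials_in\<close> sums exactly up to the degree;
  coefficients beyond it are zero, so any bound is allowed.\<close>

lemma polynomials_inI: "(\<Sum>i\<le>m. scale (c i) (x ^ i)) \<in> polynomials_in scale x"
proof -
  define p where "p = (\<Sum>i\<le>m. monom (c i) i)"
  have coeff: "coeff p i = (if i \<le> m then c i else 0)" for i
    by (simp add: p_def coeff_sum)
  have "Polynomial.degree p \<le> m"
    by (rule degree_le) (simp add: coeff)
  moreover have zero: "c i = 0" if "i \<le> m" "Polynomial.degree p < i" for i
    using coeff[of i] coeff_eq_0[OF that(2)] that(1) by simp
  ultimately have "(\<Sum>i\<le>m. scale (c i) (x ^ i)) = (\<Sum>i\<le>Polynomial.degree p. scale (coeff p i) (x ^ i))"
    using zero by (intro sum.mono_neutral_cong_right) (auto simp: coeff)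
  then show ?thesis unfolding polynomials_in_def by blast
qed

lemma power_scale_in_polynomials: "scale c (x ^ k) \<in> polynomials_in scale x"
proof -
  have "(\<Sum>i\<le>k. scale (if i = k then c else 0) (x ^ i)) = scale c (x ^ k)"
    by (simp add: if_distrib[of "\<lambda>c. scale c _"] cong: if_cong)
  then show ?thesis using polynomials_inI[of "\<lambda>i. if i = k then c else 0" x k] by simp
qed

lemma power_in_polynomials: "x ^ k \<in> polynomials_in scale x"
  using power_scale_in_polynomials[of 1 x k] by simp

text \<open>Bilinearity expands the left factor into powers of \<open>x\<close> and moves the
  scalars to the right, where one element of \<open>H\<close> is collected for each power.\<close>

lemma tensor_normal_form:
  assumes H: "subspace H" and t: "t \<in> free_space (polynomials_in scale x) H"
  shows "\<exists>K f. (\<forall>k. f k \<in> H) \<and>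
    t - (\<Sum>k\<le>K. free_pair (x ^ k) (f k)) \<in> tensor_null scale scale (polynomials_in scale x) H"
proof -
  let ?C = "polynomials_in scale x"
  let ?N = "tensor_null scale scale ?C H"
  have N: "pm.subspace ?N" by (simp add: tensor_null_def)
  have null_add_left: "free_pair (u + u') v - free_pair u v - free_pair u' v \<in> ?N"
    if "u \<in> ?C" "u' \<in> ?C" "v \<in> H" for u u' v
    unfolding tensor_null_def using that by (intro pm.span_base) blast
  have null_add_right: "free_pair u (v + v') - free_pair u v - free_pair u v' \<in> ?N"
    if "u \<in> ?C" "v \<in> H" "v' \<in> H" for u v v'
    unfolding tensor_null_def using that by (intro pm.span_base) blast
  have null_scale_left: "free_pair (scale c u) v - pm_scale c (free_pair u v) \<in> ?N"
    if "u \<in> ?C" "v \<in> H" for c u v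
    unfolding tensor_null_def using that by (intro pm.span_base) blast
  have null_scale_right: "free_pair u (scale c v) - pm_scale c (free_pair u v) \<in> ?N"
    if "u \<in> ?C" "v \<in> H" for c u v
    unfolding tensor_null_def using that by (intro pm.span_base) blast
  have null_zero: "free_pair u 0 \<in> ?N" if "u \<in> ?C" for u
    using null_scale_right[OF that subspace_0[OF H], of 0] by simp
  define T where "T = {t. \<exists>K f. (\<forall>k. f k \<in> H) \<and> t - (\<Sum>k\<le>K. free_pair (x ^ k) (f k)) \<in> ?N}"
  have T_I: "t \<in> T" if "\<forall>k. f k \<in> H" "t - (\<Sum>k\<le>K. free_pair (x ^ k) (f k)) \<in> ?N" for t K f
    unfolding T_def using that by (intro CollectI exI[of _ K] exI[of _ f] conjI)
  have T_null: "t' \<in> T" if tT: "t \<in> T" and diff: "t' - t \<in> ?N" for t t'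
  proof -
    obtain K f where "\<forall>k. f k \<in> H" and *: "t - (\<Sum>k\<le>K. free_pair (x ^ k) (f k)) \<in> ?N"
      using tT unfolding T_def by blast
    moreover have "t' - (\<Sum>k\<le>K. free_pair (x ^ k) (f k)) \<in> ?N"
      using pm.subspace_add[OF N diff *] by simp
    ultimately show ?thesis by (intro T_I)
  qed
  \<comment> \<open>Padding with \<open>x ^ k\<close> tensor \<open>0\<close>, which is null, gives
    two normal forms a common bound.\<close>
  have extend: "\<exists>f'. (\<forall>k. f' k \<in> H) \<and> t - (\<Sum>k\<le>K'. free_pair (x ^ k) (f' k)) \<in> ?N"
    if "\<forall>k. f k \<in> H" "t - (\<Sum>k\<le>K. free_pair (x ^ k) (f k)) \<in> ?N" "K \<le> K'" for t K K' f
  proof (intro exI conjI)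
    let ?f = "\<lambda>k. if k \<le> K then f k else 0"
    show "\<forall>k. ?f k \<in> H" using that subspace_0[OF H] by simp
    have "(\<Sum>k\<le>K'. free_pair (x ^ k) (?f k)) = (\<Sum>k\<le>K. free_pair (x ^ k) (?f k)) + (\<Sum>k\<in>{K<..K'}. free_pair (x ^ k) (?f k))"
      using that(3) by (subst sum.union_disjoint[symmetric]) (auto intro: sum.cong)
    moreover have "(\<Sum>k\<in>{K<..K'}. free_pair (x ^ k) (?f k)) \<in> ?N"
      by (intro pm.subspace_sum[OF N]) (auto intro: null_zero power_in_polynomials)
    ultimately show "t - (\<Sum>k\<le>K'. free_pair (x ^ k) (?f k)) \<in> ?N"
      using pm.subspace_diff[OF N that(2)] by (simp add: diff_diff_eq)
  qed
  have T_add: "t + t' \<in> T" if tT: "t \<in> T" and t'T: "t' \<in> T" for t t'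
  proof -
    obtain K f where f: "\<forall>k. f k \<in> H" "t - (\<Sum>k\<le>K. free_pair (x ^ k) (f k)) \<in> ?N"
      using tT unfolding T_def by blast
    obtain K' f' where f': "\<forall>k. f' k \<in> H" "t' - (\<Sum>k\<le>K'. free_pair (x ^ k) (f' k)) \<in> ?N"
      using t'T unfolding T_def by blast
    obtain g where g: "\<forall>k. g k \<in> H" "t - (\<Sum>k\<le>max K K'. free_pair (x ^ k) (g k)) \<in> ?N"
      using extend[OF f max.cobounded1] by blast
    obtain g' where g': "\<forall>k. g' k \<in> H" "t' - (\<Sum>k\<le>max K K'. free_pair (x ^ k) (g' k)) \<in> ?N"
      using extend[OF f' max.cobounded2] by blast
    have "(\<Sum>k\<le>max K K'. free_pair (x ^ k) (g k + g' k) - free_pair (x ^ k) (g k) - free_pair (x ^ k) (g' k)) \<in> ?N"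
      using g g' by (intro pm.subspace_sum[OF N] null_add_right power_in_polynomials) auto
    from pm.subspace_diff[OF N pm.subspace_add[OF N g(2) g'(2)] this]
    have "t + t' - (\<Sum>k\<le>max K K'. free_pair (x ^ k) (g k + g' k)) \<in> ?N"
      by (simp add: sum_subtractf sum.distrib algebra_simps)
    moreover have "\<forall>k. g k + g' k \<in> H" using g(1) g'(1) subspace_add[OF H] by blast
    ultimately show ?thesis by (intro T_I[of "\<lambda>k. g k + g' k"])
  qed
  have T_zero: "0 \<in> T"
    unfolding T_def using null_zero[OF power_in_polynomials, of 0] subspace_0[OF H] pm.subspace_neg[OF N]
    by (intro CollectI exI[of _ "0::nat"] exI[of _ "\<lambda>_. 0"]) fastforce
  have T_power: "free_pair (x ^ k) v \<in> T" if "v \<in> H" for k v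
  proof -
    let ?f = "\<lambda>i. if i = k then v else 0"
    have "(\<Sum>i\<le>k. free_pair (x ^ i) (?f i)) = (\<Sum>i<k. free_pair (x ^ i) 0) + free_pair (x ^ k) v"
      by (simp add: lessThan_Suc_atMost[symmetric])
    moreover have "(\<Sum>i<k. free_pair (x ^ i) 0) \<in> ?N"
      by (intro pm.subspace_sum[OF N] null_zero power_in_polynomials)
    ultimately have "free_pair (x ^ k) v - (\<Sum>i\<le>k. free_pair (x ^ i) (?f i)) \<in> ?N"
      using pm.subspace_neg[OF N] by simp
    moreover have "\<forall>i. ?f i \<in> H" using that subspace_0[OF H] by simp
    ultimately show ?thesis by (intro T_I[of ?f])
  qed
  have T_scale_power: "free_pair (scale c (x ^ k)) v \<in> T" if "v \<in> H" for c k v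
  proof (rule T_null[OF T_power])
    show "scale c v \<in> H" by (rule subspace_scale[OF H that])
    show "free_pair (scale c (x ^ k)) v - free_pair (x ^ k) (scale c v) \<in> ?N"
      using pm.subspace_diff[OF N null_scale_left[OF power_in_polynomials that, of c k]
          null_scale_right[OF power_in_polynomials that, of k c]]
      by simp
  qed
  have T_sum: "free_pair (\<Sum>i\<le>m. scale (c i) (x ^ i)) v \<in> T" if "v \<in> H" for c m v
  proof (induction m)
    case 0
    show ?case using T_scale_power[OF that, of "c 0" 0] by simp
  next
    case (Suc m)
    show ?case
    proof (rule T_null[OF T_add[OF Suc T_scale_power[OF that]]])
      show "free_pair (\<Sum>i\<le>Suc m. scale (c i) (x ^ i)) v -
        (free_pair (\<Sum>i\<le>m. scale (c i) (x ^ i)) v + free_pair (scale (c (Suc m)) (x ^ Suc m)) v) \<in> ?N"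
        using null_add_left[OF polynomials_inI power_scale_in_polynomials that]
        by (simp add: diff_diff_eq del: power_Suc)
    qed
  qed
  have T_single: "Poly_Mapping.single (u, v) c \<in> T" if "u \<in> ?C" "v \<in> H" for u v c
  proof (rule T_null)
    show "free_pair u (scale c v) \<in> T"
      using that(1) T_sum[OF subspace_scale[OF H that(2)]] by (auto simp: polynomials_in_def)
    have "pm_scale c (free_pair u v) = Poly_Mapping.single (u, v) c"
      by (simp add: pm_scale_single)
    then show "Poly_Mapping.single (u, v) c - free_pair u (scale c v) \<in> ?N"
      using pm.subspace_neg[OF N null_scale_right[OF that, of c]] by simp
  qed
  have eq: "t = (\<Sum>p\<in>Poly_Mapping.keys t. Poly_Mapping.single p (Poly_Mapping.lookup t p))"
  proof (rule poly_mapping_eqI)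
    fix p
    show "Poly_Mapping.lookup t p = Poly_Mapping.lookup
      (\<Sum>p\<in>Poly_Mapping.keys t. Poly_Mapping.single p (Poly_Mapping.lookup t p)) p"
      by (auto simp: lookup_sum lookup_single when_def in_keys_iff)
  qed
  have "(\<Sum>p\<in>S. Poly_Mapping.single p (Poly_Mapping.lookup t p)) \<in> T"
    if "S \<subseteq> ?C \<times> H" for S
    using that by (induction S rule: infinite_finite_induct) (auto intro: T_zero T_add T_single)
  moreover have "Poly_Mapping.keys t \<subseteq> ?C \<times> H"
    using t by (simp add: free_space_def)
  ultimately have "(\<Sum>p\<in>Poly_Mapping.keys t. Poly_Mapping.single p (Poly_Mapping.lookup t p)) \<in> T"
    by blast
  then have "t \<in> T" by (subst eq)
  then show ?thesis by (simp add: T_def)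
qed

text \<open>The map is multiplication on representatives. Existence of expansions makes it
  surjective; by the normal form, their uniqueness forces every tensor in the kernel to be
  null.\<close>

lemma tensor_polynomials_iso:
  assumes H: "subspace H"
    and exist: "\<And>a. \<exists>K f. (\<forall>k. f k \<in> H) \<and> a = (\<Sum>k\<le>K. x ^ k * f k)"
    and unique: "\<And>K f. (\<And>k. f k \<in> H) \<Longrightarrow> (\<Sum>k\<le>K. x ^ k * f k) = 0 \<Longrightarrow> \<forall>k\<le>K. f k = 0"
  shows "\<exists>\<Phi>. tensor_linear scale scale (polynomials_in scale x) H scale \<Phi> \<and>
     bij_betw \<Phi> (tensor_space scale scale (polynomials_in scale x) H) UNIV \<and>
     (\<forall>f\<in>polynomials_in scale x. \<forall>h\<in>H. \<Phi> (pure_tensor scale scale (polynomials_in scale x) H f h) = f * h)"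
proof -
  let ?C = "polynomials_in scale x"
  let ?N = "tensor_null scale scale ?C H"
  let ?coset = "tensor_coset scale scale ?C H"
  have N: "pm.subspace ?N" by (simp add: tensor_null_def)
  \<comment> \<open>Any representative of the coset serves, since multiplication annihilates null
    tensors.\<close>
  define \<Phi> where "\<Phi> C = tensor_mult (SOME t. t \<in> C)" for C
  have coset: "\<Phi> (?coset t) = tensor_mult t" for t
  proof -
    have "t \<in> ?coset t" using pm.subspace_0[OF N] by (simp add: tensor_coset_def)
    then have "(SOME t'. t' \<in> ?coset t) \<in> ?coset t" by (rule someI)
    then have "(SOME t'. t' \<in> ?coset t) - t \<in> ?N" by (simp add: tensor_coset_def)
    from tensor_mult_null[OF this] show ?thesis
      by (simp add: \<Phi>_def tensor_mult.diff)
  qed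
  have kernel: "t \<in> ?N" if t: "t \<in> free_space ?C H" "tensor_mult t = 0" for t
  proof -
    obtain K f where f: "\<And>k. f k \<in> H" "t - (\<Sum>k\<le>K. free_pair (x ^ k) (f k)) \<in> ?N"
      using tensor_normal_form[OF H t(1)] by blast
    from tensor_mult_null[OF f(2)] have "(\<Sum>k\<le>K. x ^ k * f k) = 0"
      using t(2) by (simp add: tensor_mult.diff tensor_mult.sum)
    then have "\<forall>k\<le>K. f k = 0" using unique f(1) by blast
    have "free_pair (x ^ k) 0 \<in> ?N" for k
    proof -
      have "free_pair (x ^ k) (scale 0 0) - pm_scale 0 (free_pair (x ^ k) 0) \<in> ?N"
        unfolding tensor_null_def using subspace_0[OF H] power_in_polynomials
        by (intro pm.span_base) blast
      then show ?thesis by simp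
    qed
    then have "(\<Sum>k\<le>K. free_pair (x ^ k) (f k)) \<in> ?N"
      using \<open>\<forall>k\<le>K. f k = 0\<close> by (intro pm.subspace_sum[OF N]) auto
    from pm.subspace_add[OF N f(2) this] show ?thesis by simp
  qed
  have "tensor_linear scale scale ?C H scale \<Phi>"
    by (simp add: tensor_linear_def coset tensor_mult.add tensor_mult.scale)
  moreover have "bij_betw \<Phi> (tensor_space scale scale ?C H) UNIV"
    unfolding bij_betw_def
  proof
    show "inj_on \<Phi> (tensor_space scale scale ?C H)"
    proof (rule inj_onI)
      fix X Y assume "X \<in> tensor_space scale scale ?C H" "Y \<in> tensor_space scale scale ?C H" "\<Phi> X = \<Phi> Y"
      then obtain t t' where t: "t \<in> free_space ?C H" "X = ?coset t" "t' \<in> free_space ?C H" "Y = ?coset t'"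
        "tensor_mult t = tensor_mult t'"
        by (auto simp: tensor_space_def coset)
      have "t - t' \<in> free_space ?C H"
        using t keys_diff[of t t'] by (auto simp: free_space_def)
      then have "t - t' \<in> ?N"
        using t by (intro kernel) (simp_all add: tensor_mult.diff)
      then have "s - t \<in> ?N \<longleftrightarrow> s - t' \<in> ?N" for s
        using pm.subspace_add[OF N, of "s - t" "t - t'"] pm.subspace_diff[OF N, of "s - t'" "t - t'"] by auto
      then show "X = Y" using t by (simp add: tensor_coset_def)
    qed
    have "a \<in> \<Phi> ` tensor_space scale scale ?C H" for a
    proof -
      obtain K f where f: "\<And>k. f k \<in> H" "a = (\<Sum>k\<le>K. x ^ k * f k)"
        using exist by blast
      let ?t = "\<Sum>k\<le>K. free_pair (x ^ k) (f k)"
      have "?t \<in> free_space ?C H"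
        using keys_sum[of "\<lambda>k. free_pair (x ^ k) (f k)" "{..K}"] f(1) power_in_polynomials
        by (fastforce simp: free_space_def)
      moreover have "\<Phi> (?coset ?t) = a"
        by (simp add: coset tensor_mult.sum f(2))
      ultimately show ?thesis
        unfolding tensor_space_def by blast
    qed
    then show "\<Phi> ` tensor_space scale scale ?C H = UNIV" by blast
  qed
  moreover have "\<forall>f\<in>?C. \<forall>h\<in>H. \<Phi> (pure_tensor scale scale ?C H f h) = f * h"
    by (simp add: pure_tensor_def coset)
  ultimately show ?thesis by blast
qed

end

section \<open>Decomposition into powers of Q times harmonic elements\<close>

locale q_generic = q_double +
  assumes qnum_nonzero: "k \<ge> 1 \<Longrightarrow> qnum q k \<noteq> 0"
begin

section \<open>Projections to the components of given total degree\<close>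

definition P :: "nat \<Rightarrow> 'a \<Rightarrow> 'a" where
  "P m = (THE F. lin F \<and> (\<forall>r s. F (Z.mon r s) =
     (if (\<Sum>i\<in>{1..n}. r i) + (\<Sum>i\<in>{1..n}. s i) = m then Z.mon r s else 0)))"

lemma P_lin_mon: "lin (P m) \<and> (\<forall>r s. P m (Z.mon r s) =
     (if (\<Sum>i\<in>{1..n}. r i) + (\<Sum>i\<in>{1..n}. s i) = m then Z.mon r s else 0))"
proof -
  let ?f = "\<lambda>r s. if (\<Sum>i\<in>{1..n}. r i) + (\<Sum>i\<in>{1..n}. s i) = m then Z.mon r s else 0"
  have "\<exists>!F. lin F \<and> (\<forall>r s. F (Z.mon r s) = ?f r s)"
  proof (rule Z.linear_on_mon)
    fix r r' s s' :: "nat \<Rightarrow> nat"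
    assume r: "\<And>i. i \<in> {1..n} \<Longrightarrow> r i = r' i" "\<And>i. i \<in> {1..n} \<Longrightarrow> s i = s' i"
    have "(\<Sum>i\<in>{1..n}. r i) = (\<Sum>i\<in>{1..n}. r' i)" "(\<Sum>i\<in>{1..n}. s i) = (\<Sum>i\<in>{1..n}. s' i)"
      by (rule sum.cong; simp add: r)+
    moreover have "Z.mon r s = Z.mon r' s'" using r by (rule Z.mon_cong)
    ultimately show "?f r s = ?f r' s'" by simp
  qed
  from theI'[OF this] show ?thesis unfolding P_def .
qed

lemma lin_P: "lin F \<Longrightarrow> lin (\<lambda>x. P m (F x))"
  using lin_comp[of "P m" F] P_lin_mon[of m] by simp

lemmas P_add = lin_map_add[OF lin_P[OF lin_ident]]
lemmas P_diff = lin_map_diff[OF lin_P[OF lin_ident]]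
lemmas P_scale = lin_map_scale[OF lin_P[OF lin_ident]]
lemmas P_zero = lin_map_zero[OF lin_P[OF lin_ident]]
lemmas P_sum = lin_map_sum[OF lin_P[OF lin_ident]]
lemmas L_diff = lin_map_diff[OF lin_L[OF lin_ident]]
lemmas L_scale = lin_map_scale[OF lin_L[OF lin_ident]]
lemmas L_zero = lin_map_zero[OF lin_L[OF lin_ident]]
lemmas L_sum = lin_map_sum[OF lin_L[OF lin_ident]]

lemma P_hom: "x \<in> Z.hom a b \<Longrightarrow> P m x = (if a + b = m then x else 0)"
  by (erule Z.hom_eq) (use P_lin_mon in \<open>auto intro!: lin_intros lin_P\<close>)

lemma P_eq_sum: "\<exists>m0. \<forall>m1\<ge>m0. x = (\<Sum>m\<le>m1. P m x)"
proof -
  let ?S = "{x. \<exists>m0. \<forall>m1\<ge>m0. x = (\<Sum>m\<le>m1. P m x)}"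
  have S: "subspace ?S"
  proof (rule subspaceI)
    show "0 \<in> ?S" by (simp add: P_zero)
    fix x y assume "x \<in> ?S" "y \<in> ?S"
    then obtain m0 m0' where "\<forall>m1\<ge>m0. x = (\<Sum>m\<le>m1. P m x)" "\<forall>m1\<ge>m0'. y = (\<Sum>m\<le>m1. P m y)" by auto
    then have "\<forall>m1\<ge>max m0 m0'. x + y = (\<Sum>m\<le>m1. P m (x + y))"
      by (simp add: P_add sum.distrib)
    then show "x + y \<in> ?S" by blast
  next
    fix c x assume "x \<in> ?S"
    then obtain m0 where "\<forall>m1\<ge>m0. x = (\<Sum>m\<le>m1. P m x)" by auto
    then have "\<forall>m1\<ge>m0. scale c x = (\<Sum>m\<le>m1. P m (scale c x))"
      by (simp add: P_scale scale_sum_right[symmetric])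
    then show "scale c x \<in> ?S" by blast
  qed
  have "b \<in> ?S" if b: "b \<in> range (case_prod Z.mon)" for b
  proof -
    obtain r s where b: "b = Z.mon r s" using b by auto
    define t where "t = (\<Sum>i\<in>{1..n}. r i) + (\<Sum>i\<in>{1..n}. s i)"
    have "b = (\<Sum>m\<le>m1. P m b)" if "m1 \<ge> t" for m1
    proof -
      have "P m b = (if m = t then b else 0)" for m
        using P_lin_mon[of m] by (auto simp: b t_def)
      then show ?thesis using that by simp
    qed
    then show ?thesis by blast
  qed
  from span_map[OF Z.span_mon[of x] lin_ident this S] show ?thesis by simp
qed

lemma P_eq_zero: "(\<And>m. P m x = 0) \<Longrightarrow> x = 0"
  using P_eq_sum[of x] by auto

lemma hom_swap': "W.hom b a \<subseteq> Z.hom a b"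
proof
  fix x assume "x \<in> W.hom b a"
  then show "x \<in> Z.hom a b"
  proof (rule W.hom_map[OF _ lin_ident Z.subspace_hom])
    fix r s :: "nat \<Rightarrow> nat" assume *: "(\<Sum>i\<in>{1..n}. r i) = b" "(\<Sum>i\<in>{1..n}. s i) = a"
    have "ordered_monomial n z s \<in> Z.hom a 0"
      using Z.mon_hom[of s "\<lambda>_. 0"] * by (simp add: Z.mon_def ordered_monomial_zero)
    from Z.w_monomial_hom[OF this, of r] show "W.mon r s \<in> Z.hom a b"
      using * by (simp add: W.mon_def)
  qed
qed

text \<open>If the \<open>w\<close>-degree is zero, every \<open>B_i\<close> kills \<open>x\<close>.
  If the \<open>z\<close>-degree is zero, it stays zero under \<open>B_i\<close>, and
  \<open>D_i\<close> kills the result.\<close>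

lemma L_hom_zero:
  assumes x: "x \<in> Z.hom a b" and "a = 0 \<or> b = 0"
  shows "L x = 0"
proof -
  have x': "x \<in> W.hom b a" using hom_swap x by blast
  have "D i (B i x) = 0" if i: "i \<in> {1..n}" for i
  proof (cases b)
    case 0
    then show ?thesis
      using W.D_hom_0[OF i] x' i lin_map_zero[OF Z.lin_D[OF i lin_ident]] by simp
  next
    case (Suc b')
    then have "B i x \<in> Z.hom 0 b'"
      using W.D_hom_Suc[OF i, of x b' a] x' hom_swap' assms(2) by auto
    then show ?thesis by (rule Z.D_hom_0[OF i])
  qed
  then show ?thesis by (simp add: L_def)
qed

lemma L_hom_Suc:
  assumes x: "x \<in> Z.hom (Suc a) (Suc b)"
  shows "L x \<in> Z.hom a b"
proof -
  have "B i x \<in> Z.hom (Suc a) b" if i: "i \<in> {1..n}" for i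
    using W.D_hom_Suc[OF i] x hom_swap hom_swap' by blast
  then show ?thesis
    unfolding L_def by (intro subspace_sum Z.subspace_hom Z.D_hom_Suc)
qed

text \<open>\<open>L\<close> lowers both degrees by one, or gives zero if one of them is zero
  already; so it lowers the total degree by two.\<close>

lemma L_P: "L (P (Suc (Suc m)) x) = P m (L x)"
proof (rule Z.hom_cover[of "\<lambda>x. L (P (Suc (Suc m)) x)" "\<lambda>x. P m (L x)"])
  fix a b x assume x: "x \<in> Z.hom a b"
  show "L (P (Suc (Suc m)) x) = P m (L x)"
  proof (cases "a = 0 \<or> b = 0")
    case True
    then show ?thesis using L_hom_zero[OF x] by (simp add: P_hom[OF x] L_zero P_zero)
  next
    case False
    then obtain a' b' where "a = Suc a'" "b = Suc b'" by (meson not0_implies_Suc)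
    then show ?thesis using L_hom_Suc[of x a' b'] x by (simp add: P_hom[OF x] P_hom L_zero)
  qed
qed (intro lin_L lin_P lin_ident)+

lemma L_P_small:
  assumes "m < 2"
  shows "L (P m x) = 0"
proof (rule Z.hom_cover[of "\<lambda>x. L (P m x)" "\<lambda>x. 0"])
  fix a b x assume x: "x \<in> Z.hom a b"
  show "L (P m x) = 0"
  proof (cases "a + b = m")
    case True
    then have "a = 0 \<or> b = 0" using assms by linarith
    then show ?thesis using L_hom_zero[OF x] by (simp add: P_hom[OF x] L_zero)
  qed (simp add: P_hom[OF x] L_zero)
qed (intro lin_L lin_P lin_ident lin_zero)+

lemma L_P_harmonic: "L x = 0 \<Longrightarrow> L (P m x) = 0"
  using L_P[of "m - 2" x] L_P_small[of m x] by (cases "m < 2") (auto simp: P_zero numeral_2_eq_2 Suc_diff_Suc)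

lemma P_Q_Suc: "P (Suc (Suc m)) (Q n * x) = Q n * P m x"
  by (rule Z.hom_cover[of "\<lambda>x. P (Suc (Suc m)) (Q n * x)" "\<lambda>x. Q n * P m x"])
    (auto intro!: lin_intros lin_P simp: P_hom P_hom[OF Q_hom])

lemma P_Q_small: "m < 2 \<Longrightarrow> P m (Q n * x) = 0"
  by (rule Z.hom_cover[of "\<lambda>x. P m (Q n * x)" "\<lambda>x. 0"])
    (auto intro!: lin_intros lin_P simp: P_hom[OF Q_hom])

lemma P_Q_power: "P (m + 2 * k) (Q n ^ k * x) = Q n ^ k * P m x"
  by (induction k) (auto simp: mult.assoc P_Q_Suc)

lemma P_Q_power_small: "m < 2 * k \<Longrightarrow> P m (Q n ^ k * x) = 0"
proof (induction k arbitrary: m)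
  case (Suc k)
  show ?case
  proof (cases "m < 2")
    case False
    then obtain m' where "m = Suc (Suc m')"
      by (metis add_2_eq_Suc le_Suc_ex not_less)
    then show ?thesis using Suc by (simp add: mult.assoc P_Q_Suc)
  qed (simp add: mult.assoc P_Q_small)
qed simp

lemma L_Q_P: "L (Q n * P m x) = Q n * L (P m x) + scale (laplace_coeff m) (P m x)"
proof (rule Z.hom_cover[of "\<lambda>x. L (Q n * P m x)" "\<lambda>x. Q n * L (P m x) + scale (laplace_coeff m) (P m x)"])
  fix a b x assume x: "x \<in> Z.hom a b"
  then show "L (Q n * P m x) = Q n * L (P m x) + scale (laplace_coeff m) (P m x)"
    using L_Q_hom[OF x] by (auto simp: P_hom[OF x] L_zero)
qed (intro lin_intros lin_L lin_P)+

section \<open>The Laplace operator on powers of Q times harmonic elements\<close>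

definition power_coeff :: "nat \<Rightarrow> nat \<Rightarrow> complex" where
  "power_coeff k m = inverse q * q ^ n * qnum q (Suc k) * qnum q (n + m + k)"

text \<open>Clearing denominators with \<open>h^2\<close> leaves an identity of Laurent polynomials
  in \<open>q\<close>, \<open>q^k\<close> and \<open>q^x\<close>. It sums the successive commutators
  in \<open>L_Q_power\<close>.\<close>

lemma qnum_step: "qnum q (Suc k) * qnum q (x + k) + qnum q (x + 2 * k + 2) = qnum q (Suc (Suc k)) * qnum q (x + Suc k)"
proof -
  define u v where "u = q ^ k" and "v = inverse q ^ k"
  define X Y where "X = q ^ x" and "Y = inverse q ^ x"
  have uv: "u * v = 1" "u * (v * c) = c" for c
    using Z.q by (simp_all add: u_def v_def power_mult_distrib[symmetric] mult.assoc[symmetric])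
  have pow: "q ^ (x + 2 * k + 2) = X * (u * (u * (q * q)))" "inverse q ^ (x + 2 * k + 2) = Y * (v * (v * (inverse q * inverse q)))"
    by (simp_all add: power_add X_def Y_def u_def v_def mult_2 power2_eq_square)
  have "h * h * (qnum q (Suc k) * qnum q (x + k) + qnum q (x + 2 * k + 2)) =
    (h * qnum q (Suc k)) * (h * qnum q (x + k)) + h * (h * qnum q (x + 2 * k + 2))"
    by (simp only: distrib_left ac_simps)
  also have "\<dots> = (h * qnum q (Suc (Suc k))) * (h * qnum q (x + Suc k))"
    unfolding Z.h_qnum pow
    by (simp add: power_add X_def[symmetric] Y_def[symmetric] u_def[symmetric] v_def[symmetric])
      (simp add: algebra_simps uv)
  also have "\<dots> = h * h * (qnum q (Suc (Suc k)) * qnum q (x + Suc k))"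
    by (simp only: ac_simps)
  finally show ?thesis using Z.h by simp
qed

text \<open>Moving \<open>L\<close> past one more factor \<open>Q n\<close> adds the commutator in
  degree \<open>m + 2 (k + 1)\<close> to the coefficient already obtained.\<close>

lemma L_Q_power:
  assumes x: "L x = 0" "P m x = x"
  shows "L (Q n ^ Suc k * x) = scale (power_coeff k m) (Q n ^ k * x)"
proof (induction k)
  case 0
  have "L (Q n * x) = Q n * L x + scale (laplace_coeff m) x"
    using L_Q_P[of m x] x by simp
  moreover have "qnum q (Suc 0) = 1"
    using Z.h by (simp add: qnum_def)
  ultimately show ?case
    using x by (simp add: laplace_coeff_def power_coeff_def)
next
  case (Suc k)
  have "P (m + 2 * Suc k) (Q n ^ Suc k * x) = Q n ^ Suc k * x"
    using P_Q_power[of m "Suc k" x] x by simp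
  then have "L (Q n * (Q n ^ Suc k * x)) = Q n * L (Q n ^ Suc k * x) + scale (laplace_coeff (m + 2 * Suc k)) (Q n ^ Suc k * x)"
    using L_Q_P[of "m + 2 * Suc k" "Q n ^ Suc k * x"] by simp
  also have "\<dots> = scale (power_coeff k m + laplace_coeff (m + 2 * Suc k)) (Q n ^ Suc k * x)"
    unfolding Suc by (simp add: scale_mult_right scale_left_distrib mult.assoc)
  also have "power_coeff k m + laplace_coeff (m + 2 * Suc k) = power_coeff (Suc k) m"
    using qnum_step[of k "n + m"]
    by (simp add: power_coeff_def laplace_coeff_def distrib_left[symmetric] mult.assoc add.assoc)
  finally show ?case by (simp add: mult.assoc)
qed

text \<open>A positive \<open>n\<close> keeps the argument \<open>n + m + k\<close> of the q-number
  positive even for \<open>m = k = 0\<close>.\<close>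

lemma power_coeff_nonzero: "n \<ge> 1 \<Longrightarrow> power_coeff k m \<noteq> 0"
  using qnum_nonzero Z.q by (simp add: power_coeff_def)

section \<open>Existence and uniqueness of harmonic expansions\<close>

text \<open>The degrees are those for which every \<open>Q^k f_k\<close> has total degree
  \<open>m\<close>; the last clause excludes indices where \<open>m - 2 * k\<close> is
  truncated.\<close>

definition graded_harmonic :: "nat \<Rightarrow> (nat \<Rightarrow> 'a) \<Rightarrow> bool" where
  "graded_harmonic m f \<longleftrightarrow> (\<forall>k. L (f k) = 0 \<and> (2 * k \<le> m \<longrightarrow> P (m - 2 * k) (f k) = f k) \<and> (m < 2 * k \<longrightarrow> f k = 0))"

lemma graded_harmonicD:
  assumes "graded_harmonic m f"
  shows "L (f k) = 0" "2 * k \<le> m \<Longrightarrow> P (m - 2 * k) (f k) = f k" "m < 2 * k \<Longrightarrow> f k = 0"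
  using assms by (simp_all add: graded_harmonic_def)

lemma graded_decomposition:
  assumes n: "n \<ge> 1" and "P m x = x"
  shows "\<exists>f. graded_harmonic m f \<and> x = (\<Sum>k\<le>m. Q n ^ k * f k)"
  using assms(2)
proof (induction m arbitrary: x rule: less_induct)
  case (less m)
  show ?case
  proof (cases "m < 2")
    case True
    let ?f = "\<lambda>k. if k = 0 then x else 0"
    have "L x = 0" using L_P_small[OF True, of x] less.prems by simp
    then have "graded_harmonic m ?f"
      using less.prems by (auto simp: graded_harmonic_def L_zero P_zero)
    moreover have "x = (\<Sum>k\<le>m. Q n ^ k * ?f k)"
      by (subst sum.atMost_shift) simp
    ultimately show ?thesis by blast
  next
    case False
    then obtain m' where m: "m = Suc (Suc m')"
      by (metis add_2_eq_Suc le_Suc_ex not_less)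
    have "P m' (L x) = L x" using L_P[of m' x] less.prems by (simp add: m)
    then obtain f where f: "graded_harmonic m' f" "L x = (\<Sum>k\<le>m'. Q n ^ k * f k)"
      using less.IH[of m' "L x"] by (auto simp: m)
    \<comment> \<open>By \<open>L_Q_power\<close> this normalisation gives
      \<open>L (Q^(k+1) g_k) = Q^k f_k\<close>, so removing these terms from \<open>x\<close> leaves
      a harmonic remainder.\<close>
    define g where "g k = scale (inverse (power_coeff k (m' - 2 * k))) (f k)" for k
    define x0 where "x0 = x - (\<Sum>k\<le>Suc m'. Q n ^ Suc k * g k)"
    let ?f = "\<lambda>k. if k = 0 then x0 else g (k - 1)"
    \<comment> \<open>The sum in \<open>x0\<close> has one term more than the expansion of
      \<open>L x\<close>; this makes the additional term harmless.\<close>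
    have f_top: "f (Suc m') = 0" using f(1) by (simp add: graded_harmonic_def)
    have Lg: "L (Q n ^ Suc k * g k) = Q n ^ k * f k" for k
    proof (cases "2 * k \<le> m'")
      case True
      have "L (Q n ^ Suc k * f k) = scale (power_coeff k (m' - 2 * k)) (Q n ^ k * f k)"
        using f(1) True by (intro L_Q_power) (auto simp: graded_harmonic_def)
      then show ?thesis
        using power_coeff_nonzero[OF n] by (simp add: g_def scale_mult_right L_scale)
    next
      case False
      then show ?thesis using f(1) by (simp add: g_def graded_harmonic_def L_zero)
    qed
    have "L x0 = 0"
      unfolding x0_def L_diff L_sum Lg f(2) by (simp add: f_top)
    moreover have Pg: "P m (Q n ^ Suc k * g k) = Q n ^ Suc k * g k" for k
    proof (cases "2 * k \<le> m'")
      case True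
      then have "m = (m' - 2 * k) + 2 * Suc k" by (simp add: m)
      then have "P m (Q n ^ Suc k * g k) = Q n ^ Suc k * P (m' - 2 * k) (g k)"
        using P_Q_power[of "m' - 2 * k" "Suc k"] by metis
      then show ?thesis using f(1) True by (simp add: g_def P_scale graded_harmonic_def)
    next
      case False
      then show ?thesis using f(1) by (simp add: g_def graded_harmonic_def P_zero)
    qed
    moreover have "P m x0 = x0"
      unfolding x0_def P_diff P_sum Pg less.prems ..
    moreover have "m - 2 * k = m' - 2 * (k - 1)" if "k \<noteq> 0" for k
      using that by (cases k) (auto simp: m)
    ultimately have "graded_harmonic m ?f"
      using f(1) by (auto simp: graded_harmonic_def g_def L_scale P_scale m)
    moreover have "x = (\<Sum>k\<le>m. Q n ^ k * ?f k)"
      unfolding m by (subst sum.atMost_Suc_shift) (simp add: x0_def)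
    ultimately show ?thesis by blast
  qed
qed

text \<open>Applying \<open>L\<close> kills \<open>f 0\<close> and turns each
  \<open>Q^(k+1) f (k+1)\<close> into a nonzero multiple of \<open>Q^k f (k+1)\<close>: a shorter
  relation of the same kind.\<close>

lemma graded_unique:
  assumes n: "n \<ge> 1" and "graded_harmonic m f" "(\<Sum>k\<le>K. Q n ^ k * f k) = 0"
  shows "\<forall>k\<le>K. f k = 0"
  using assms(2,3)
proof (induction K arbitrary: m f)
  case (Suc K)
  define g where "g k = scale (power_coeff k (m - 2 * Suc k)) (f (Suc k))" for k
  have Lf: "L (Q n ^ Suc k * f (Suc k)) = Q n ^ k * g k" for k
  proof (cases "2 * Suc k \<le> m")
    case True
    then have "L (Q n ^ Suc k * f (Suc k)) = scale (power_coeff k (m - 2 * Suc k)) (Q n ^ k * f (Suc k))"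
      using graded_harmonicD[OF Suc.prems(1), of "Suc k"] by (intro L_Q_power)
    then show ?thesis by (simp add: g_def scale_mult_right)
  next
    case False
    then have "f (Suc k) = 0" using graded_harmonicD(3)[OF Suc.prems(1), of "Suc k"] by simp
    then show ?thesis by (simp add: g_def L_zero)
  qed
  have split: "(\<Sum>k\<le>Suc K. Q n ^ k * f k) = f 0 + (\<Sum>k\<le>K. Q n ^ Suc k * f (Suc k))"
    by (subst sum.atMost_Suc_shift) simp
  have "L (\<Sum>k\<le>Suc K. Q n ^ k * f k) = L (f 0) + (\<Sum>k\<le>K. Q n ^ k * g k)"
    unfolding split lin_map_add[OF lin_L[OF lin_ident]] L_sum Lf ..
  then have "(\<Sum>k\<le>K. Q n ^ k * g k) = 0"
    using Suc.prems by (simp add: L_zero graded_harmonic_def)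
  moreover have "graded_harmonic (m - 2) g"
    unfolding graded_harmonic_def
  proof (intro allI conjI impI)
    fix k
    show "L (g k) = 0" using Suc.prems(1) by (simp add: g_def L_scale graded_harmonic_def)
    \<comment> \<open>Where the difference is truncated, \<open>g k\<close> is zero.\<close>
    show "P (m - 2 - 2 * k) (g k) = g k"
    proof (cases "2 * Suc k \<le> m")
      case True
      moreover have "m - 2 - 2 * k = m - 2 * Suc k" by simp
      ultimately show ?thesis
        using graded_harmonicD(2)[OF Suc.prems(1), of "Suc k"] by (simp only: g_def P_scale)
    next
      case False
      then show ?thesis using graded_harmonicD(3)[OF Suc.prems(1), of "Suc k"] by (simp add: g_def P_zero)
    qed
    show "g k = 0" if "m - 2 < 2 * k"
      using graded_harmonicD(3)[OF Suc.prems(1), of "Suc k"] that by (simp add: g_def)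
  qed
  ultimately have "\<forall>k\<le>K. g k = 0" using Suc.IH by blast
  then have "\<forall>k\<le>K. f (Suc k) = 0"
    using power_coeff_nonzero[OF n] by (simp add: g_def)
  moreover from this have "f 0 = 0"
    using Suc.prems(2) unfolding split by simp
  ultimately show ?case
    by (metis Suc_le_mono not0_implies_Suc)
qed simp

text \<open>Each homogeneous component is expanded and equal powers of \<open>Q n\<close> are
  collected. The coefficients vanish beyond the degree, so one bound fits all components.\<close>

lemma harmonic_decomposition:
  assumes n: "n \<ge> 1"
  shows "\<exists>K f. (\<forall>k. L (f k) = 0) \<and> x = (\<Sum>k\<le>K. Q n ^ k * f k)"
proof -
  obtain m0 where m0: "x = (\<Sum>m\<le>m0. P m x)" using P_eq_sum[of x] by blast
  have "P m (P m x) = P m x" for m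
    by (rule Z.hom_cover[of "\<lambda>x. P m (P m x)" "\<lambda>x. P m x"])
      (auto intro!: lin_intros lin_P simp: P_hom P_zero)
  then have "\<exists>f. graded_harmonic m f \<and> P m x = (\<Sum>k\<le>m. Q n ^ k * f k)" for m
    by (rule graded_decomposition[OF n])
  then obtain F where F: "\<And>m. graded_harmonic m (F m)" "\<And>m. P m x = (\<Sum>k\<le>m. Q n ^ k * F m k)"
    by metis
  have "P m x = (\<Sum>k\<le>m0. Q n ^ k * F m k)" if "m \<le> m0" for m
    unfolding F(2) using that F(1)[of m]
    by (intro sum.mono_neutral_left) (auto simp: graded_harmonic_def)
  then have "x = (\<Sum>m\<le>m0. \<Sum>k\<le>m0. Q n ^ k * F m k)"
    using m0 by simp
  also have "\<dots> = (\<Sum>k\<le>m0. Q n ^ k * (\<Sum>m\<le>m0. F m k))"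
    by (subst sum.swap) (simp add: sum_distrib_left)
  finally have "x = (\<Sum>k\<le>m0. Q n ^ k * (\<Sum>m\<le>m0. F m k))" .
  moreover have "L (\<Sum>m\<le>m0. F m k) = 0" for k
    using F(1) by (simp add: L_sum graded_harmonic_def)
  ultimately show ?thesis
    by (intro exI[of _ m0] exI[of _ "\<lambda>k. \<Sum>m\<le>m0. F m k"] conjI allI)
qed

lemma harmonic_unique:
  assumes n: "n \<ge> 1" and f: "\<And>k. L (f k) = 0" and sum: "(\<Sum>k\<le>K. Q n ^ k * f k) = 0"
  shows "\<forall>k\<le>K. f k = 0"
proof (intro allI impI)
  fix k assume k: "k \<le> K"
  show "f k = 0"
  proof (rule P_eq_zero)
    fix m0
    \<comment> \<open>In total degree \<open>m\<close> the term \<open>Q^k f_k\<close> contributes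
      exactly through the component of \<open>f k\<close> of degree \<open>m0\<close>.\<close>
    define m where "m = m0 + 2 * k"
    let ?g = "\<lambda>k. if 2 * k \<le> m then P (m - 2 * k) (f k) else 0"
    have "P m (Q n ^ k * f k) = Q n ^ k * ?g k" for k
      using P_Q_power[of "m - 2 * k" k "f k"] P_Q_power_small[of m k "f k"] by auto
    then have "(\<Sum>k\<le>K. Q n ^ k * ?g k) = P m (\<Sum>k\<le>K. Q n ^ k * f k)"
      by (simp add: P_sum)
    then have "(\<Sum>k\<le>K. Q n ^ k * ?g k) = 0"
      unfolding sum P_zero .
    moreover have "P m (P m x) = P m x" for m x
      by (rule Z.hom_cover[of "\<lambda>x. P m (P m x)" "\<lambda>x. P m x"])
        (auto intro!: lin_intros lin_P simp: P_hom P_zero)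
    then have "graded_harmonic m ?g"
      using f by (auto simp: graded_harmonic_def L_P_harmonic L_zero)
    ultimately have "\<forall>k\<le>K. ?g k = 0"
      by (intro graded_unique[OF n])
    then show "P m0 (f k) = 0" using k by (auto simp: m_def split: if_splits)
  qed
qed

lemma tensor_decomposition:
  assumes "n \<ge> 1"
  shows "\<exists>\<Phi>. tensor_linear scale scale (polynomials_in scale (Q_elem n z w)) (q_harmonic n q scale z w) scale \<Phi> \<and>
     bij_betw \<Phi> (tensor_space scale scale (polynomials_in scale (Q_elem n z w)) (q_harmonic n q scale z w)) UNIV \<and>
     (\<forall>f\<in>polynomials_in scale (Q_elem n z w). \<forall>h\<in>q_harmonic n q scale z w.
        \<Phi> (pure_tensor scale scale (polynomials_in scale (Q_elem n z w)) (q_harmonic n q scale z w) f h) = f * h)"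
proof (rule tensor_polynomials_iso)
  have Q: "Q_elem n z w = Q n" by (simp add: Q_elem_def Q_def)
  show "subspace (q_harmonic n q scale z w)"
    unfolding q_harmonic_def by (rule subspace_eq) (intro lin_L lin_ident lin_zero)+
  show "\<exists>K f. (\<forall>k. f k \<in> q_harmonic n q scale z w) \<and> a = (\<Sum>k\<le>K. Q_elem n z w ^ k * f k)" for a
    using harmonic_decomposition[OF assms, of a] by (simp add: Q q_harmonic_def)
  show "\<forall>k\<le>K. f k = 0"
    if "\<And>k. f k \<in> q_harmonic n q scale z w" "(\<Sum>k\<le>K. Q_elem n z w ^ k * f k) = 0" for K f
    by (rule harmonic_unique[OF assms]) (use that Q in \<open>simp_all add: q_harmonic_def\<close>)
qed

end

section \<open>Passage from the presentation\<close>

lemma (in presented_algebra) act_regular_relator: "r \<in> R \<Longrightarrow> act scale (\<lambda>x. (*) (g x)) r 1 = 0"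
  using relator_eval by (simp add: act_regular)

locale zw_presented =
  fixes n :: nat and q :: complex and scale :: "complex \<Rightarrow> 'a::ring_1 \<Rightarrow> 'a" and z w :: "nat \<Rightarrow> 'a"
  assumes zw: "zw_algebra n q scale z w" and q: "q \<noteq> 0" "q\<^sup>2 \<noteq> 1"
begin

sublocale presented_algebra scale "generators n" "relators n q" "case_generator z w"
  using zw by (simp add: presented_algebra_def zw_algebra_def)

lemma relations:
  "i \<in> {1..n} \<Longrightarrow> j \<in> {1..n} \<Longrightarrow> i < j \<Longrightarrow> z i * z j = scale q (z j * z i)"
  "i \<in> {1..n} \<Longrightarrow> j \<in> {1..n} \<Longrightarrow> i < j \<Longrightarrow> w i * w j = scale (inverse q) (w j * w i)"
  "i \<in> {1..n} \<Longrightarrow> j \<in> {1..n} \<Longrightarrow> i \<noteq> j \<Longrightarrow> w j * z i = scale q (z i * w j)"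
  "k \<in> {1..n} \<Longrightarrow> w k * z k = z k * w k + scale (1 - q\<^sup>2) (\<Sum>s\<in>{1..<k}. z s * w s)"
proof -
  have rel: "act scale (\<lambda>x. (*) (case_generator z w x)) r 1 = 0" if "r \<in> relators n q" for r
    using that by (rule act_regular_relator)
  note simps = act_diff act_add act_sum act_mult[OF linear_mult_left]
  show "z i * z j = scale q (z j * z i)" if "i \<in> {1..n}" "j \<in> {1..n}" "i < j"
  proof -
    have "fZ i * fZ j - free_const q * fZ j * fZ i \<in> relators n q"
      unfolding relators_def using that by blast
    from rel[OF this] show ?thesis by (simp add: simps)
  qed
  show "w i * w j = scale (inverse q) (w j * w i)" if "i \<in> {1..n}" "j \<in> {1..n}" "i < j"
  proof -
    have "fW i * fW j - free_const (inverse q) * fW j * fW i \<in> relators n q"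
      unfolding relators_def using that by blast
    from rel[OF this] show ?thesis by (simp add: simps)
  qed
  show "w j * z i = scale q (z i * w j)" if "i \<in> {1..n}" "j \<in> {1..n}" "i \<noteq> j"
  proof -
    have "fW j * fZ i - free_const q * fZ i * fW j \<in> relators n q"
      unfolding relators_def using that by blast
    from rel[OF this] show ?thesis by (simp add: simps)
  qed
  show "w k * z k = z k * w k + scale (1 - q\<^sup>2) (\<Sum>s\<in>{1..<k}. z s * w s)" if "k \<in> {1..n}"
  proof -
    have "fW k * fZ k - (fZ k * fW k + free_const (1 - q^2) * (\<Sum>s\<in>{1..<k}. fZ s * fW s)) \<in> relators n q"
      unfolding relators_def using that by blast
    from rel[OF this] show ?thesis by (simp add: simps)
  qed
qed

lemma generated_zw:
  assumes "subspace S" "1 \<in> S"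
    and "\<And>j a. j \<in> {1..n} \<Longrightarrow> a \<in> S \<Longrightarrow> z j * a \<in> S"
    and "\<And>j a. j \<in> {1..n} \<Longrightarrow> a \<in> S \<Longrightarrow> w j * a \<in> S"
  shows "a \<in> S"
  by (rule generated_induct[OF assms(1,2)]) (use assms in \<open>auto simp: generators_def\<close>)

section \<open>Independence of the ordered monomials through the faithful module\<close>

lemma model_map:
  obtains T where "Vector_Spaces.linear scale model_scale T"
    "lead n (T 1) (\<lambda>_. 0) (\<lambda>_. 0)"
    "\<And>j a. j \<in> {1..n} \<Longrightarrow> T (z j * a) = model_z q j (T a)"
    "\<And>j a. j \<in> {1..n} \<Longrightarrow> T (w j * a) = model_w q n j (T a)"
proof -
  \<comment> \<open>The vector stands for the monomial 1.\<close>
  define v :: model where "v = (\<lambda>a b. of_bool (a = (\<lambda>_. 0) \<and> b = (\<lambda>_. 0)))"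
  have rel: "act model_scale (case_generator (model_z q) (model_w q n)) r v' = 0" if "r \<in> relators n q" for r v'
    by (rule model.act_relator[OF linear_model _ _ _ _ that])
      (simp_all add: model_zz[OF q(1)] model_ww[OF q(1)] model_wz[OF q(1)] model_wz_diag[OF q(1)])
  obtain T where T: "Vector_Spaces.linear scale model_scale T" "T 1 = v"
    "\<And>x a. x \<in> generators n \<Longrightarrow> T (case_generator z w x * a) = case_generator (model_z q) (model_w q n) x (T a)"
    by (rule module_map[where v = v, OF linear_model rel]; blast)
  show ?thesis
  proof (rule that[OF T(1)])
    show "lead n (T 1) (\<lambda>_. 0) (\<lambda>_. 0)" by (auto simp: T(2) v_def lead_def)
    show "T (z j * a) = model_z q j (T a)" if "j \<in> {1..n}" for j a
      using T(3)[of "Zgen j" a] that by (simp add: generators_def)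
    show "T (w j * a) = model_w q n j (T a)" if "j \<in> {1..n}" for j a
      using T(3)[of "Wgen j" a] that by (simp add: generators_def)
  qed
qed

text \<open>These partial sums are the index of \<open>z^r\<close> in the model, written in the form
  that repeated use of \<open>lead_z\<close> produces.\<close>

definition shift :: "(nat \<Rightarrow> nat) \<Rightarrow> nat \<Rightarrow> int" where
  "shift r k = (\<Sum>i\<in>{1..n}. int (r i) * of_bool (i \<le> k))"

definition exponent :: "(nat \<Rightarrow> nat) \<Rightarrow> nat \<Rightarrow> int" where
  "exponent r k = (\<Sum>i\<in>{1..n}. int (r i) * of_bool (k = i))"

lemma exponent_eq: "exponent r k = (if k \<in> {1..n} then int (r k) else 0)"
  by (simp add: exponent_def of_bool_def if_distrib[of "\<lambda>c. _ * c"] cong: if_cong)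

lemma exponent_eq_iff:
  assumes "\<forall>i. i \<notin> {1..n} \<longrightarrow> r i = 0" "\<forall>i. i \<notin> {1..n} \<longrightarrow> s i = 0"
  shows "exponent r = exponent s \<longleftrightarrow> r = s"
proof
  assume eq: "exponent r = exponent s"
  show "r = s"
  proof
    fix k
    show "r k = s k"
      using fun_cong[OF eq, of k] assms by (cases "k \<in> {1..n}") (auto simp: exponent_eq)
  qed
qed simp

text \<open>Exponents are recovered as differences of consecutive partial sums.\<close>

lemma shift_eq_iff:
  assumes "\<forall>i. i \<notin> {1..n} \<longrightarrow> r i = 0" "\<forall>i. i \<notin> {1..n} \<longrightarrow> s i = 0"
  shows "shift r = shift s \<longleftrightarrow> r = s"
proof
  assume eq: "shift r = shift s"
  have step: "exponent r k = shift r k - shift r (k - 1)" if "k \<in> {1..n}" for r k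
    unfolding exponent_def shift_def sum_subtractf[symmetric] using that by (intro sum.cong) auto
  have "exponent r k = exponent s k" for k
    using step[of k r] step[of k s] eq by (cases "k \<in> {1..n}") (auto simp: exponent_eq)
  then have "exponent r = exponent s" by blast
  then show "r = s" using exponent_eq_iff[OF assms] by simp
qed simp

lemma lead_ordered_monomial:
  assumes T: "\<And>j a. j \<in> {1..n} \<Longrightarrow> T (z j * a) = model_z q j (T a)"
    "\<And>j a. j \<in> {1..n} \<Longrightarrow> T (w j * a) = model_w q n j (T a)"
    and x: "lead n (T x) a b"
  shows "lead n (T (ordered_monomial n z r * x)) (\<lambda>k. a k + shift r k) b"
    and "lead n (T (ordered_monomial n w r * x)) (\<lambda>k. a k - shift r k) (\<lambda>k. b k + exponent r k)"
proof -
  have z_pow: "lead n (T (z j ^ m * x)) (\<lambda>k. a k + int m * of_bool (j \<le> k)) b"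
    if "j \<in> {1..n}" "lead n (T x) a b" for j m x a b
  proof (induction m)
    case (Suc m)
    then show ?case
      using lead_z[OF q(1) Suc, of j] that by (simp add: mult.assoc T algebra_simps)
  qed (use that in simp)
  have w_pow: "lead n (T (w j ^ m * x)) (\<lambda>k. a k - int m * of_bool (j \<le> k)) (\<lambda>k. b k + int m * of_bool (k = j))"
    if "j \<in> {1..n}" "lead n (T x) a b" for j m x a b
  proof (induction m)
    case (Suc m)
    then show ?case
      using lead_w[OF q(1) _ _ Suc, of j] that by (simp add: mult.assoc T algebra_simps)
  qed (use that in simp)
  have z_list: "lead n (T (prod_list (map (\<lambda>i. z i ^ r i) js) * x))
      (\<lambda>k. a k + (\<Sum>i\<leftarrow>js. int (r i) * of_bool (i \<le> k))) b" if "set js \<subseteq> {1..n}" for js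
    using that
  proof (induction js)
    case (Cons j js)
    then show ?case
      using z_pow[of j _ "\<lambda>k. a k + (\<Sum>i\<leftarrow>js. int (r i) * of_bool (i \<le> k))" b "r j"]
      by (simp add: mult.assoc ac_simps)
  qed (use x in simp)
  have w_list: "lead n (T (prod_list (map (\<lambda>i. w i ^ r i) js) * x))
      (\<lambda>k. a k - (\<Sum>i\<leftarrow>js. int (r i) * of_bool (i \<le> k)))
      (\<lambda>k. b k + (\<Sum>i\<leftarrow>js. int (r i) * of_bool (k = i)))" if "set js \<subseteq> {1..n}" for js
    using that
  proof (induction js)
    case (Cons j js)
    then show ?case
      using w_pow[of j _ "\<lambda>k. a k - (\<Sum>i\<leftarrow>js. int (r i) * of_bool (i \<le> k))"
          "\<lambda>k. b k + (\<Sum>i\<leftarrow>js. int (r i) * of_bool (k = i))" "r j"]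
      by (simp add: mult.assoc algebra_simps)
  qed (use x in simp)
  have sum_list: "(\<Sum>i\<leftarrow>[1..<Suc n]. f i) = (\<Sum>i\<in>{1..n}. f i)" for f :: "nat \<Rightarrow> int"
    by (simp add: sum_list_distinct_conv_sum_set atLeastLessThanSuc_atLeastAtMost del: upt_Suc)
  show "lead n (T (ordered_monomial n z r * x)) (\<lambda>k. a k + shift r k) b"
    using z_list[of "[1..<Suc n]"] unfolding sum_list ordered_monomial_def shift_def
    by (simp add: atLeastLessThanSuc_atLeastAtMost del: upt_Suc)
  show "lead n (T (ordered_monomial n w r * x)) (\<lambda>k. a k - shift r k) (\<lambda>k. b k + exponent r k)"
    using w_list[of "[1..<Suc n]"] unfolding sum_list ordered_monomial_def shift_def exponent_def
    by (simp add: atLeastLessThanSuc_atLeastAtMost del: upt_Suc)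
qed

text \<open>In the order \<open>z^r w^s\<close> the leading term has \<open>Q\<close>-exponent
  \<open>s\<close> and \<open>z\<close>-exponent \<open>r - s\<close>, which determine
  \<open>s\<close> and then \<open>r\<close>. The opposite order works in the same way.\<close>

lemma independent_ordered:
  defines "I \<equiv> {(r :: nat \<Rightarrow> nat, s :: nat \<Rightarrow> nat). \<forall>i. i \<notin> {1..n} \<longrightarrow> r i = 0 \<and> s i = 0}"
  shows "inj_on (\<lambda>(r, s). ordered_monomial n z r * ordered_monomial n w s) I"
    "independent ((\<lambda>(r, s). ordered_monomial n z r * ordered_monomial n w s) ` I)"
    "inj_on (\<lambda>(r, s). ordered_monomial n w r * ordered_monomial n z s) I"
    "independent ((\<lambda>(r, s). ordered_monomial n w r * ordered_monomial n z s) ` I)"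
proof -
  obtain T where T: "Vector_Spaces.linear scale model_scale T" "lead n (T 1) (\<lambda>_. 0) (\<lambda>_. 0)"
    "\<And>j a. j \<in> {1..n} \<Longrightarrow> T (z j * a) = model_z q j (T a)"
    "\<And>j a. j \<in> {1..n} \<Longrightarrow> T (w j * a) = model_w q n j (T a)"
    using model_map by blast
  have lead: "lead n (T (ordered_monomial n z r * x)) (\<lambda>k. a k + shift r k) b"
    "lead n (T (ordered_monomial n w r * x)) (\<lambda>k. a k - shift r k) (\<lambda>k. b k + exponent r k)"
    if "lead n (T x) a b" for r x a b
    using lead_ordered_monomial[of T, OF _ _ that] T(3,4) by blast+
  let ?pos = "\<lambda>(r, s). (\<lambda>k. shift r k - shift s k, exponent s)"
  let ?pos' = "\<lambda>(r, s). (\<lambda>k. shift s k - shift r k, exponent r)"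
  have pos: "inj_on ?pos I" "inj_on ?pos' I"
  proof (safe intro!: inj_onI)
    fix r s r' s' assume I: "(r, s) \<in> I" "(r', s') \<in> I"
    have supp: "\<forall>i. i \<notin> {1..n} \<longrightarrow> r i = 0" "\<forall>i. i \<notin> {1..n} \<longrightarrow> s i = 0"
      "\<forall>i. i \<notin> {1..n} \<longrightarrow> r' i = 0" "\<forall>i. i \<notin> {1..n} \<longrightarrow> s' i = 0"
      using I by (auto simp: I_def)
    {
      assume "(\<lambda>k. shift r k - shift s k) = (\<lambda>k. shift r' k - shift s' k)" "exponent s = exponent s'"
      moreover from this have "s = s'" using exponent_eq_iff[OF supp(2,4)] by simp
      ultimately have "shift r = shift r'" by (auto simp: fun_eq_iff)
      then show "r = r'" "s = s'" using shift_eq_iff[OF supp(1,3)] \<open>s = s'\<close> by simp_all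
    }
    {
      assume "(\<lambda>k. shift s k - shift r k) = (\<lambda>k. shift s' k - shift r' k)" "exponent r = exponent r'"
      moreover from this have "r = r'" using exponent_eq_iff[OF supp(1,3)] by simp
      ultimately have "shift s = shift s'" by (auto simp: fun_eq_iff)
      then show "r = r'" "s = s'" using shift_eq_iff[OF supp(2,4)] \<open>r = r'\<close> by simp_all
    }
  qed
  have zw: "lead n (T (case p of (r, s) \<Rightarrow> ordered_monomial n z r * ordered_monomial n w s))
      (fst (?pos p)) (snd (?pos p))" if "p \<in> I" for p
    using lead(1)[OF lead(2)[OF T(2)], of "fst p" "snd p"]
    by (cases p) (simp add: algebra_simps)
  have wz: "lead n (T (case p of (r, s) \<Rightarrow> ordered_monomial n w r * ordered_monomial n z s))
      (fst (?pos' p)) (snd (?pos' p))" if "p \<in> I" for p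
    using lead(2)[OF lead(1)[OF T(2)], of "fst p" "snd p"]
    by (cases p) (simp add: algebra_simps)
  show "inj_on (\<lambda>(r, s). ordered_monomial n z r * ordered_monomial n w s) I"
    "independent ((\<lambda>(r, s). ordered_monomial n z r * ordered_monomial n w s) ` I)"
    by (rule lead_independent[OF T(1) zw pos(1)]; assumption)+
  show "inj_on (\<lambda>(r, s). ordered_monomial n w r * ordered_monomial n z s) I"
    "independent ((\<lambda>(r, s). ordered_monomial n w r * ordered_monomial n z s) ` I)"
    by (rule lead_independent[OF T(1) wz pos(2)]; assumption)+
qed

text \<open>Iterating \<open>Q_k = q^2 Q_(k-1) + w_k z_k\<close> expresses the partial sums by the
  products \<open>w_s z_s\<close>; this brings the diagonal relation into the shape required of the
  exchanged pair.\<close>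

lemma reordering:
  assumes "k \<in> {1..n}"
  shows "z k * w k = w k * z k + (\<Sum>s\<in>{1..<k}. scale (- ((1 - q\<^sup>2) * q ^ (2 * (k - 1 - s)))) (w s * z s))"
proof -
  have sum: "(\<Sum>s\<in>{1..<k}. z s * w s) = (\<Sum>s\<in>{1..<k}. scale (q ^ (2 * (k - 1 - s))) (w s * z s))" if "1 \<le> k" "k \<le> n" for k
    using that
  proof (induction k rule: dec_induct)
    case (step k)
    have shift: "(\<Sum>s\<in>{1..<k}. scale (q ^ (2 * (k - s))) (w s * z s)) =
        scale (q\<^sup>2) (\<Sum>s\<in>{1..<k}. scale (q ^ (2 * (k - 1 - s))) (w s * z s))"
      unfolding scale_sum_right
    proof (rule sum.cong)
      fix s assume "s \<in> {1..<k}"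
      then have "2 * (k - s) = 2 + 2 * (k - 1 - s)" by auto
      then show "scale (q ^ (2 * (k - s))) (w s * z s) = scale (q\<^sup>2) (scale (q ^ (2 * (k - 1 - s))) (w s * z s))"
        by (simp only: power_add scale_scale)
    qed simp
    let ?R = "\<Sum>s\<in>{1..<k}. z s * w s"
    have "z k * w k = w k * z k - scale (1 - q\<^sup>2) ?R"
      using relations(4)[of k] step by simp
    then have "(\<Sum>s\<in>{1..<Suc k}. z s * w s) = scale (q\<^sup>2) ?R + w k * z k"
      using step by (simp add: sum.atLeastLessThan_Suc scale_left_diff_distrib)
    also have "scale (q\<^sup>2) ?R = (\<Sum>s\<in>{1..<k}. scale (q ^ (2 * (k - s))) (w s * z s))"
      unfolding shift using step by simp
    finally show ?case using step by (simp add: sum.atLeastLessThan_Suc)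
  qed simp
  have "(\<Sum>s\<in>{1..<k}. scale (- ((1 - q\<^sup>2) * q ^ (2 * (k - 1 - s)))) (w s * z s)) = - scale (1 - q\<^sup>2) (\<Sum>s\<in>{1..<k}. z s * w s)"
    using assms by (subst sum) (auto simp: scale_sum_right sum_negf)
  then show ?thesis using relations(4)[OF assms] by simp
qed

lemma q_double: "q_double scale n q z w (\<lambda>k s. - ((1 - q\<^sup>2) * q ^ (2 * (k - 1 - s))))"
proof (intro q_double.intro q_pair.intro q_pair_axioms.intro)
  show "inverse q \<noteq> 0" "(inverse q)\<^sup>2 \<noteq> 1" using q by (simp_all add: power_inverse)
  show "w k * z k = z k * w k + (\<Sum>s\<in>{1..<k}. scale (1 - q\<^sup>2) (z s * w s))" if "k \<in> {1..n}" for k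
    using relations(4)[OF that] by (simp only: scale_sum_right)
  show "z i * z j = scale (inverse (inverse q)) (z j * z i)" if "i \<in> {1..n}" "j \<in> {1..n}" "i < j" for i j
    using relations(1)[OF that] by simp
  show "z j * w i = scale (inverse q) (w i * z j)" if "i \<in> {1..n}" "j \<in> {1..n}" "i \<noteq> j" for i j
    using relations(3)[OF that(2,1) that(3)[symmetric]] q by simp
qed (fact q relations independent_ordered reordering complex_algebra_axioms | (rule generated_zw; assumption))+

end

theorem theorem1:
  fixes n :: nat and q :: complex
    and scale :: "complex \<Rightarrow> 'a::ring_1 \<Rightarrow> 'a"
    and z w :: "nat \<Rightarrow> 'a"
  assumes "n \<ge> 1"
    and "q \<noteq> 0"
    and "\<And>k::nat. k \<ge> 1 \<Longrightarrow> q ^ k \<noteq> 1"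
    and "zw_algebra n q scale z w"
  shows "let CQ = polynomials_in scale (Q_elem n z w); H = q_harmonic n q scale z w in
           \<exists>\<Phi>. tensor_linear scale scale CQ H scale \<Phi> \<and>
               bij_betw \<Phi> (tensor_space scale scale CQ H) (UNIV :: 'a set) \<and>
               (\<forall>f\<in>CQ. \<forall>h\<in>H. \<Phi> (pure_tensor scale scale CQ H f h) = f * h)"
proof -
  interpret zw_presented n q scale z w
    using assms by unfold_locales auto
  interpret q_double scale n q z w "\<lambda>k s. - ((1 - q\<^sup>2) * q ^ (2 * (k - 1 - s)))"
    by (rule q_double)
  \<comment> \<open>A vanishing \<open>[k]\<close> would give \<open>q^k = q^(-k)\<close>, hence
    \<open>q^(2k) = 1\<close>.\<close>
  have "qnum q k \<noteq> 0" if "k \<ge> 1" for k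
  proof
    assume "qnum q k = 0"
    then have eq: "q ^ k = inverse q ^ k" using Z.h by (simp add: qnum_def)
    have "q ^ (2 * k) = q ^ k * q ^ k" by (simp add: mult_2 power_add)
    also have "\<dots> = q ^ k * inverse q ^ k" by (rule arg_cong[OF eq])
    also have "\<dots> = 1" using assms(2) by (simp add: power_mult_distrib[symmetric])
    finally show False using assms(3)[of "2 * k"] that by simp
  qed
  then interpret q_generic scale n q z w "\<lambda>k s. - ((1 - q\<^sup>2) * q ^ (2 * (k - 1 - s)))"
    by unfold_locales
  show ?thesis
    unfolding Let_def by (rule tensor_decomposition[OF assms(1)])
qed

end
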